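(* Let $G$ be a nontrivial finite MP group. Then $G/\Phi(G)$ is isomorphic to a subdirect product of finite primitive MP groups; if moreover $G$ is SMP, then $G/\Phi(G)$ is isomorphic to a subdirect product of finite primitive SMP groups. Up to isomorphism, the finite primitive MP groups are exactly $C_2$, $C_3$, $S_3$, $A_4$, $\mathrm{AGL}(1,5)$, $C_7\rtimes C_3$, $\mathrm{AGL}(1,7)$ and $M(9)$, and the finite primitive SMP groups are exactly $C_2$, $S_3$ and $M(9)$.
   Context: A group $G$ has the Magnus Property (MP) if whenever $x,y\in G$ have the same normal closure in $G$, $x$ is conjugate in $G$ to $y$ or to $y^{-1}$. It has the Strong Magnus Property (SMP) if whenever $x,y\in G$ have the same normal closure, $x$ is conjugate to $y$. $\Phi(G)$ is the Frattini subgroup of $G$ (the intersection of all maximal subgroups). A finite group is primitive if it has a maximal subgroup $M$ with $\bigcap_{g\in G}g^{-1}Mg=\{1\}$. $C_m$ is the cyclic group of order $m$, $C_7\rtimes C_3$ is the semidirect product with respect to the nontrivial action, $\mathrm{AGL}(1,q)=\mathbb{F}_q\rtimes\mathbb{F}_q^{*}$. $M(9)=\mathbb{F}_3^2\rtimes Q_8$ where $Q_8=\langle i,j\rangle\le \mathrm{GL}(2,3)$ acts naturally, with $i\mapsto\begin{pmatrix}0&2\\1&0\end{pmatrix}$ and $j\mapsto\begin{pmatrix}1&1\\1&2\end{pmatrix}$. *)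

theory Defs
  imports "HOL-Algebra.Algebra"
begin

definition conj_in :: "('a, 'b) monoid_scheme \<Rightarrow> 'a \<Rightarrow> 'a \<Rightarrow> bool" where
  "conj_in G x y \<longleftrightarrow> (\<exists>g\<in>carrier G. y = inv\<^bsub>G\<^esub> g \<otimes>\<^bsub>G\<^esub> x \<otimes>\<^bsub>G\<^esub> g)"

definition normal_closure :: "('a, 'b) monoid_scheme \<Rightarrow> 'a \<Rightarrow> 'a set" where
  "normal_closure G x = generate G {inv\<^bsub>G\<^esub> g \<otimes>\<^bsub>G\<^esub> x \<otimes>\<^bsub>G\<^esub> g | g. g \<in> carrier G}"

definition MP :: "('a, 'b) monoid_scheme \<Rightarrow> bool" where
  "MP G \<longleftrightarrow> (\<forall>x\<in>carrier G. \<forall>y\<in>carrier G.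
      normal_closure G x = normal_closure G y \<longrightarrow> conj_in G y x \<or> conj_in G (inv\<^bsub>G\<^esub> y) x)"

definition SMP :: "('a, 'b) monoid_scheme \<Rightarrow> bool" where
  "SMP G \<longleftrightarrow> (\<forall>x\<in>carrier G. \<forall>y\<in>carrier G.
      normal_closure G x = normal_closure G y \<longrightarrow> conj_in G y x)"

definition maximal_subgroup :: "('a, 'b) monoid_scheme \<Rightarrow> 'a set \<Rightarrow> bool" where
  "maximal_subgroup G M \<longleftrightarrow> subgroup M G \<and> M \<noteq> carrier G \<and>
     (\<forall>H. subgroup H G \<and> M \<subseteq> H \<longrightarrow> H = M \<or> H = carrier G)"

definition Frattini :: "('a, 'b) monoid_scheme \<Rightarrow> 'a set" where
  "Frattini G = carrier G \<inter> \<Inter> {M. maximal_subgroup G M}"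

definition core :: "('a, 'b) monoid_scheme \<Rightarrow> 'a set \<Rightarrow> 'a set" where
  "core G M = (\<Inter>g\<in>carrier G. {inv\<^bsub>G\<^esub> g \<otimes>\<^bsub>G\<^esub> m \<otimes>\<^bsub>G\<^esub> g | m. m \<in> M})"

definition primitive :: "('a, 'b) monoid_scheme \<Rightarrow> bool" where
  "primitive G \<longleftrightarrow> (\<exists>M. maximal_subgroup G M \<and> core G M = {\<one>\<^bsub>G\<^esub>})"

definition iso_subdirect :: "('a, 'b) monoid_scheme \<Rightarrow> 'i set \<Rightarrow> ('i \<Rightarrow> ('c, 'd) monoid_scheme) \<Rightarrow> bool" where
  "iso_subdirect G I Hs \<longleftrightarrow> (\<exists>S. subgroup S (product_group I Hs) \<and>
      (\<forall>i\<in>I. (\<lambda>f. f i) ` S = carrier (Hs i)) \<and>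
      G \<cong> (product_group I Hs)\<lparr>carrier := S\<rparr>)"

text \<open>\<open>aff1 q U\<close>: the affine group \<open>x \<mapsto> a x + b\<close> of \<open>\<int>/q\<close> with \<open>a \<in> U\<close>, as pairs \<open>(a,b)\<close>,
  multiplication being composition of maps.\<close>
definition aff1 :: "int \<Rightarrow> int set \<Rightarrow> (int \<times> int) monoid" where
  "aff1 q U = \<lparr>carrier = U \<times> {0..<q},
     monoid.mult = (\<lambda>(a,b) (c,d). ((a * c) mod q, (a * d + b) mod q)), one = (1, 0)\<rparr>"

definition AGL1 :: "int \<Rightarrow> (int \<times> int) monoid" where
  "AGL1 q = aff1 q {1..<q}"   \<comment> \<open>for \<open>q\<close> prime\<close>

text \<open>\<open>C\<^sub>7 \<rtimes> C\<^sub>3\<close>: \<open>{1,2,4}\<close> is the subgroup of order 3 of \<open>\<bbbF>\<^sub>7\<^sup>*\<close>.\<close>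
definition C7_C3 :: "(int \<times> int) monoid" where
  "C7_C3 = aff1 7 {1, 2, 4}"

text \<open>2x2 matrices over \<open>\<bbbF>\<^sub>3\<close> as \<open>((a,b),(c,d))\<close> = rows.\<close>
type_synonym mat3 = "(int \<times> int) \<times> (int \<times> int)"

definition mmul3 :: "mat3 \<Rightarrow> mat3 \<Rightarrow> mat3" where
  "mmul3 A B = (case A of ((a,b),(c,d)) \<Rightarrow> case B of ((e,f),(g,h)) \<Rightarrow>
      (((a*e + b*g) mod 3, (a*f + b*h) mod 3), ((c*e + d*g) mod 3, (c*f + d*h) mod 3)))"

definition mvec3 :: "mat3 \<Rightarrow> int \<times> int \<Rightarrow> int \<times> int" where
  "mvec3 A v = (case A of ((a,b),(c,d)) \<Rightarrow> case v of (x,y) \<Rightarrow> ((a*x + b*y) mod 3, (c*x + d*y) mod 3))"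

definition vadd3 :: "int \<times> int \<Rightarrow> int \<times> int \<Rightarrow> int \<times> int" where
  "vadd3 v w = (case v of (x,y) \<Rightarrow> case w of (u,z) \<Rightarrow> ((x + u) mod 3, (y + z) mod 3))"

definition Q8i :: mat3 where "Q8i = ((0,2),(1,0))"
definition Q8j :: mat3 where "Q8j = ((1,1),(1,2))"
definition GL3_one :: mat3 where "GL3_one = ((1,0),(0,1))"

inductive_set Q8 :: "mat3 set" where
  Q8_one: "GL3_one \<in> Q8"
| Q8_i: "A \<in> Q8 \<Longrightarrow> mmul3 A Q8i \<in> Q8"
| Q8_j: "A \<in> Q8 \<Longrightarrow> mmul3 A Q8j \<in> Q8"

text \<open>\<open>M(9) = \<bbbF>\<^sub>3\<^sup>2 \<rtimes> Q\<^sub>8\<close>, as affine maps \<open>v \<mapsto> A v + w\<close> (pairs \<open>(A,w)\<close>), composed.\<close>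
definition M9 :: "(mat3 \<times> (int \<times> int)) monoid" where
  "M9 = \<lparr>carrier = Q8 \<times> ({0..<3} \<times> {0..<3}),
     monoid.mult = (\<lambda>(A,v) (B,w). (mmul3 A B, vadd3 (mvec3 A w) v)),
     one = (GL3_one, (0,0))\<rparr>"

end

theory Submission
  imports Defs
begin

text \<open>Both properties pass to quotients of a finite group, so \<open>G/\<Phi>(G)\<close>, which embeds into the product of
  the primitive quotients of \<open>G\<close> by the cores of its maximal subgroups, reduces everything to primitive groups.

  Let \<open>H\<close> be primitive with the Magnus property. A minimal normal subgroup \<open>N\<close> has all its nontrivial
  elements conjugate up to inversion, so it is an elementary abelian \<open>p\<close>-group, and \<open>H = N \<rtimes> M\<close>. For
  \<open>1 \<noteq> m \<in> M\<close> all elements of the coset \<open>N m\<close> are conjugate up to inversion, which forces \<open>m\<close> to act on \<open>N\<close>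
  without fixed points. Hence \<open>|N| = |M| + 1\<close> or \<open>|N| = 2 |M| + 1\<close>. Summing the images of a vector
  over a subset of \<open>M\<close> in two ways gives the Frobenius complement conditions: subgroups of order \<open>r s\<close>
  with \<open>r\<close>, \<open>s\<close> prime are cyclic. As \<open>M\<close> itself has the Magnus property, each of its elements is conjugate
  up to inversion to every generator of its cyclic group, and together with these conditions
  \<open>|M|\<close> has to divide 24. Of the ten remaining pairs \<open>(|N|, |M|)\<close> the pairs \<open>(13, 12)\<close> and \<open>(25, 24)\<close> do not occur. For the other eight \<open>H\<close> is
  determined up to isomorphism, and the groups in the list realise them.\<close>

section \<open>Normal closures and the Frattini quotient\<close>

text \<open>That \<open>N m\<close> is one class under \<open>N\<close> says that
  \<open>n \<mapsto> n m n^-1 m^-1\<close> maps \<open>N\<close> onto \<open>N\<close>; on a finite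
  set this is injectivity, hence fixed-point-freeness. Afterwards |N| is 1 modulo |M|, so a
  nontrivial \<open>N\<close> cannot have an exponent dividing |M|. This clash drives the conditions
  on subgroups of order \<open>r s\<close>: where powers of suitable elements fill cosets of a
  cyclic group, summing by powers and by cosets shows that the order of that group kills every
  vector.

  Behind the bound 24: an element of odd prime order \<open>r\<close> is conjugate to its square up
  to inversion, but the conjugating element induces an automorphism of order at most 2, so
  \<open>r\<close> divides \<open>2^2 - 1\<close>. Element orders 8 and 9 fail because a conjugating
  element, corrected inside the cyclic group, would produce a second subgroup of prime order. A
  subgroup of exponent 4 with one involution has at most 8 elements.

  The orders determine the group except for \<open>(9, 8)\<close>, shared with AGL(1,9), whose
  complement is cyclic; therefore the exponent of \<open>M\<close> is recorded next to the
  orders.\<close>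

lemma (in group) normal_closure_normal:
  assumes "x \<in> carrier G"
  shows "normal_closure G x \<lhd> G"
proof -
  let ?S = "{inv g \<otimes> x \<otimes> g | g. g \<in> carrier G}"
  have "g \<otimes> h \<otimes> inv g \<in> ?S" if h: "h \<in> ?S" and g: "g \<in> carrier G" for h g
  proof -
    obtain k where k: "k \<in> carrier G" "h = inv k \<otimes> x \<otimes> k" using h by auto
    then have "g \<otimes> h \<otimes> inv g = inv (k \<otimes> inv g) \<otimes> x \<otimes> (k \<otimes> inv g)"
      using g assms by (simp add: inv_mult_group m_assoc)
    then show ?thesis using k g by auto
  qed
  moreover have "?S \<subseteq> carrier G" using assms by auto
  ultimately show ?thesis unfolding normal_closure_def by (intro normal_generateI) auto
qed

lemma (in group) normal_closure_mem:
  assumes "x \<in> carrier G"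
  shows "x \<in> normal_closure G x"
proof -
  have "x = inv \<one> \<otimes> x \<otimes> \<one>" using assms by simp
  then show ?thesis unfolding normal_closure_def by (intro generate.incl) blast
qed

lemma (in group) normal_closure_least:
  assumes "N \<lhd> G" and "x \<in> N"
  shows "normal_closure G x \<subseteq> N"
proof -
  interpret N: normal N G by fact
  show ?thesis unfolding normal_closure_def
    by (rule generate_subgroup_incl) (use assms N.inv_op_closed1 in \<open>auto simp: N.subgroup_axioms\<close>)
qed

lemma (in group) normal_closure_eqI:
  assumes "x \<in> carrier G" "y \<in> carrier G" "x \<in> normal_closure G y" "y \<in> normal_closure G x"
  shows "normal_closure G x = normal_closure G y"
  using assms by (intro equalityI normal_closure_least normal_closure_normal)

lemma (in group) normal_closure_one: "normal_closure G \<one> = {\<one>}"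
  using normal_closure_least[OF one_is_normal] normal_closure_mem by fastforce

lemma (in group_hom) normal_closure_img:
  assumes "h ` carrier G = carrier H" and "x \<in> carrier G"
  shows "h ` normal_closure G x = normal_closure H (h x)"
proof -
  have "h ` {inv g \<otimes> x \<otimes> g | g. g \<in> carrier G}
      = {inv\<^bsub>H\<^esub> g \<otimes>\<^bsub>H\<^esub> h x \<otimes>\<^bsub>H\<^esub> g | g. g \<in> carrier H}" (is "?L = ?R")
  proof
    show "?L \<subseteq> ?R" using assms(2) by fastforce
    show "?R \<subseteq> ?L"
    proof
      fix u assume "u \<in> ?R"
      then obtain k where "k \<in> h ` carrier G" "u = inv\<^bsub>H\<^esub> k \<otimes>\<^bsub>H\<^esub> h x \<otimes>\<^bsub>H\<^esub> k"
        unfolding assms(1) by blast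
      then obtain g where "g \<in> carrier G" "u = inv\<^bsub>H\<^esub> h g \<otimes>\<^bsub>H\<^esub> h x \<otimes>\<^bsub>H\<^esub> h g"
        by blast
      then have "u = h (inv g \<otimes> x \<otimes> g)" "g \<in> carrier G" using assms(2) by simp_all
      then show "u \<in> ?L" by blast
    qed
  qed
  then show ?thesis unfolding normal_closure_def
    using generate_img[of "{inv g \<otimes> x \<otimes> g | g. g \<in> carrier G}"] assms(2) by auto
qed

lemma (in group) conj_in_trans:
  assumes "conj_in G x y" "conj_in G y z" "x \<in> carrier G"
  shows "conj_in G x z"
proof -
  obtain g h where "g \<in> carrier G" "h \<in> carrier G" "y = inv g \<otimes> x \<otimes> g" "z = inv h \<otimes> y \<otimes> h"
    using assms unfolding conj_in_def by auto
  then have "z = inv (g \<otimes> h) \<otimes> x \<otimes> (g \<otimes> h)" "g \<otimes> h \<in> carrier G"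
    using assms by (simp_all add: inv_mult_group m_assoc)
  then show ?thesis unfolding conj_in_def by blast
qed

lemma (in group) conj_in_sym:
  assumes "conj_in G x y" "x \<in> carrier G"
  shows "conj_in G y x"
proof -
  obtain g where "g \<in> carrier G" "y = inv g \<otimes> x \<otimes> g" using assms unfolding conj_in_def by auto
  then have "x = inv (inv g) \<otimes> y \<otimes> inv g" "inv g \<in> carrier G"
    using assms by (simp_all add: m_assoc) (simp add: m_assoc[symmetric])
  then show ?thesis unfolding conj_in_def by blast
qed

lemma (in group) conj_in_refl: "x \<in> carrier G \<Longrightarrow> conj_in G x x"
  unfolding conj_in_def by (rule bexI[of _ \<one>]) auto

lemma (in group) conj_in_inv:
  assumes "conj_in G x y" "x \<in> carrier G"
  shows "conj_in G (inv x) (inv y)"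
proof -
  obtain g where "g \<in> carrier G" "y = inv g \<otimes> x \<otimes> g" using assms unfolding conj_in_def by auto
  then have "inv y = inv g \<otimes> inv x \<otimes> g" "g \<in> carrier G"
    using assms by (simp_all add: m_assoc inv_mult_group)
  then show ?thesis unfolding conj_in_def by blast
qed

lemma (in group) conj_in_closed: "conj_in G x y \<Longrightarrow> x \<in> carrier G \<Longrightarrow> y \<in> carrier G"
  unfolding conj_in_def by auto

lemma (in group_hom) conj_in_img:
  assumes "conj_in G x y" "x \<in> carrier G"
  shows "conj_in H (h x) (h y)"
  using assms unfolding conj_in_def by fastforce

text \<open>A preimage of \<open>u\<close> whose normal closure is as small as possible has the same normal
  closure as some preimage of \<open>v\<close>.\<close>

lemma (in group_hom) normal_closure_lift:
  assumes fin: "finite (carrier G)" and surj: "h ` carrier G = carrier H"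
    and u: "u \<in> carrier H" and v: "v \<in> carrier H"
    and eq: "normal_closure H u = normal_closure H v"
  obtains x y where "x \<in> carrier G" "y \<in> carrier G" "h x = u" "h y = v"
    "normal_closure G x = normal_closure G y"
proof -
  let ?P = "\<lambda>x. x \<in> carrier G \<and> h x = u"
  obtain x where x: "?P x" and
    least: "\<And>z. ?P z \<Longrightarrow> card (normal_closure G x) \<le> card (normal_closure G z)"
  proof -
    have "\<exists>x. ?P x" using surj u by (metis imageE)
    then show ?thesis using ex_has_least_nat[of ?P _ "\<lambda>x. card (normal_closure G x)"] that by blast
  qed
  have "v \<in> h ` normal_closure G x"
    using normal_closure_img[OF surj] x eq H.normal_closure_mem[OF v] by simp
  then obtain y where y: "y \<in> normal_closure G x" "h y = v" by auto
  have xN: "normal_closure G x \<lhd> G" using G.normal_closure_normal x by simp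
  have yc: "y \<in> carrier G" using y xN by (meson normal_imp_subgroup subgroup.mem_carrier)
  have sub: "normal_closure G y \<subseteq> normal_closure G x"
    using G.normal_closure_least[OF xN y(1)] .
  \<comment> \<open>A preimage \<open>z\<close> of \<open>u\<close> inside the normal closure of
    \<open>y\<close> has a closure no smaller than that of \<open>x\<close>; lying between the two,
    the closure of \<open>y\<close> equals that of \<open>x\<close>.\<close>
  have "u \<in> h ` normal_closure G y"
    using normal_closure_img[OF surj yc] y eq H.normal_closure_mem[OF u] by simp
  then obtain z where z: "z \<in> normal_closure G y" "h z = u" by auto
  have yN: "normal_closure G y \<lhd> G" using G.normal_closure_normal yc by simp
  have zc: "z \<in> carrier G" using z yN by (meson normal_imp_subgroup subgroup.mem_carrier)
  have "normal_closure G z \<subseteq> normal_closure G y"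
    using G.normal_closure_least[OF yN z(1)] .
  moreover have fx: "finite (normal_closure G x)"
    using finite_subset[OF _ fin] xN normal_imp_subgroup subgroup.subset by metis
  ultimately have "card (normal_closure G x) \<le> card (normal_closure G y)"
    using least[of z] z zc card_mono[of "normal_closure G y" "normal_closure G z"]
      finite_subset[OF sub fx] by force
  then have "normal_closure G y = normal_closure G x" by (intro card_seteq fx sub)
  then show ?thesis using that x y yc by metis
qed

lemma (in group_hom) MP_img:
  assumes "finite (carrier G)" and "h ` carrier G = carrier H" and "MP G"
  shows "MP H"
  unfolding MP_def
proof (intro ballI impI)
  fix u v assume "u \<in> carrier H" "v \<in> carrier H" "normal_closure H u = normal_closure H v"
  then obtain x y where xy: "x \<in> carrier G" "y \<in> carrier G" "h x = u" "h y = v"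
    "normal_closure G x = normal_closure G y"
    using normal_closure_lift assms by metis
  then have "conj_in G y x \<or> conj_in G (inv y) x" using \<open>MP G\<close> unfolding MP_def by blast
  then show "conj_in H v u \<or> conj_in H (inv\<^bsub>H\<^esub> v) u"
    using conj_in_img[of y x] conj_in_img[of "inv y" x] xy by auto
qed

lemma (in group_hom) SMP_img:
  assumes "finite (carrier G)" and "h ` carrier G = carrier H" and "SMP G"
  shows "SMP H"
  unfolding SMP_def
proof (intro ballI impI)
  fix u v assume "u \<in> carrier H" "v \<in> carrier H" "normal_closure H u = normal_closure H v"
  then obtain x y where xy: "x \<in> carrier G" "y \<in> carrier G" "h x = u" "h y = v"
    "normal_closure G x = normal_closure G y"
    using normal_closure_lift assms by metis
  then have "conj_in G y x" using \<open>SMP G\<close> unfolding SMP_def by blast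
  then show "conj_in H v u"
    using conj_in_img[of y x] xy by auto
qed

lemma SMP_imp_MP: "SMP G \<Longrightarrow> MP G"
  unfolding SMP_def MP_def by blast

section \<open>Maximal subgroups, cores and primitive quotients\<close>

lemma (in group) maximal_subgroup_conj:
  assumes M: "maximal_subgroup G M" and g: "g \<in> carrier G"
  shows "maximal_subgroup G {inv g \<otimes> m \<otimes> g | m. m \<in> M}"
proof -
  define c where "c u x = inv u \<otimes> x \<otimes> u" for u x
  have hom: "group_hom G G (c u)" if u: "u \<in> carrier G" for u
  proof -
    have "c u (x \<otimes> y) = c u x \<otimes> c u y" if "x \<in> carrier G" "y \<in> carrier G" for x y
      unfolding c_def using that u by (simp add: m_assoc) (simp add: m_assoc[symmetric])
    moreover have "c u x \<in> carrier G" if "x \<in> carrier G" for x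
      using that u by (simp add: c_def)
    ultimately show ?thesis
      unfolding group_hom_def group_hom_axioms_def hom_def using is_group by simp
  qed
  have cc: "c (inv g) (c g x) = x" "c g (c (inv g) x) = x" if "x \<in> carrier G" for x
    unfolding c_def using that g by (simp add: m_assoc, simp add: m_assoc[symmetric])+
  have sub: "c u ` S \<subseteq> carrier G" "subgroup (c u ` S) G" if "subgroup S G" "u \<in> carrier G" for u S
    using group_hom.subgroup_img_is_subgroup[OF hom that(1)] that(2) subgroup.subset by metis+
  have inv2: "c (inv g) ` c g ` S = S" "c g ` c (inv g) ` S = S" if "S \<subseteq> carrier G" for S
  proof -
    have "c (inv g) (c g x) = x" "c g (c (inv g) x) = x" if "x \<in> S" for x
      using cc \<open>S \<subseteq> carrier G\<close> that by blast+
    then show "c (inv g) ` c g ` S = S" "c g ` c (inv g) ` S = S"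
      by (simp_all add: image_image cong: image_cong)
  qed
  have Ms: "subgroup M G" "M \<noteq> carrier G" using M unfolding maximal_subgroup_def by auto
  have "maximal_subgroup G (c g ` M)"
    unfolding maximal_subgroup_def
  proof (intro conjI allI impI)
    show "subgroup (c g ` M) G" using sub(2)[OF Ms(1) g] .
    have sc: "c g ` carrier G \<subseteq> carrier G" "c (inv g) ` carrier G \<subseteq> carrier G"
      using sub(1)[OF subgroup_self] g by auto
    have full: "c (inv g) ` carrier G = carrier G" "c g ` carrier G = carrier G"
      using inv2[of "carrier G"] image_mono[OF sc(1), of "c (inv g)"]
        image_mono[OF sc(2), of "c g"] sc by auto
    show "c g ` M \<noteq> carrier G"
      using inv2(1)[of M] full(1) Ms subgroup.subset[OF Ms(1)] by metis
    fix H assume H: "subgroup H G \<and> c g ` M \<subseteq> H"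
    then have "M \<subseteq> c (inv g) ` H" using inv2(1)[of M] subgroup.subset[OF Ms(1)] by blast
    moreover have "subgroup (c (inv g) ` H) G" using sub(2) H g by auto
    ultimately have "c (inv g) ` H = M \<or> c (inv g) ` H = carrier G"
      using M unfolding maximal_subgroup_def by auto
    then show "H = c g ` M \<or> H = carrier G"
      using inv2(2)[of H] full H subgroup.subset by metis
  qed
  moreover have "c g ` M = {inv g \<otimes> m \<otimes> g | m. m \<in> M}" unfolding c_def by auto
  ultimately show ?thesis by simp
qed

lemma (in group) core_subset:
  assumes "M \<subseteq> carrier G"
  shows "core G M \<subseteq> M"
proof
  fix x assume "x \<in> core G M"
  then have "x \<in> {inv \<one> \<otimes> m \<otimes> \<one> | m. m \<in> M}" unfolding core_def by blast
  then show "x \<in> M" using assms by auto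
qed

lemma (in group) mem_coreI:
  assumes x: "x \<in> carrier G" and M: "M \<subseteq> carrier G"
    and "\<And>g. g \<in> carrier G \<Longrightarrow> g \<otimes> x \<otimes> inv g \<in> M"
  shows "x \<in> core G M"
  unfolding core_def
proof (intro INT_I)
  fix g assume g: "g \<in> carrier G"
  then have "x = inv g \<otimes> (g \<otimes> x \<otimes> inv g) \<otimes> g"
    using x by (simp add: m_assoc) (simp add: m_assoc[symmetric])
  then show "x \<in> {inv g \<otimes> m \<otimes> g | m. m \<in> M}" using assms(3)[OF g] by blast
qed

lemma (in group) core_conj:
  assumes "x \<in> core G M" "M \<subseteq> carrier G" "g \<in> carrier G"
  shows "g \<otimes> x \<otimes> inv g \<in> M"
proof -
  have "x \<in> {inv g \<otimes> m \<otimes> g | m. m \<in> M}" using assms unfolding core_def by blast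
  then obtain m where m: "m \<in> M" "x = inv g \<otimes> m \<otimes> g" by auto
  then have mc: "m \<in> carrier G" using assms by auto
  have "g \<otimes> x \<otimes> inv g = m" unfolding m(2)
    using mc assms(3) by (simp add: m_assoc) (simp add: m_assoc[symmetric])
  then show ?thesis using m by simp
qed

lemma (in group) normal_subset_core:
  assumes "N \<lhd> G" "N \<subseteq> M" "M \<subseteq> carrier G"
  shows "N \<subseteq> core G M"
proof
  fix x assume x: "x \<in> N"
  show "x \<in> core G M"
    by (rule mem_coreI) (use assms x normal.inv_op_closed2[OF assms(1)] in auto)
qed

lemma (in group) core_normal:
  assumes M: "subgroup M G"
  shows "core G M \<lhd> G"
proof -
  interpret M: subgroup M G by fact
  have ccl: "core G M \<subseteq> carrier G" using core_subset[OF M.subset] M.subset by blast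
  have "subgroup (core G M) G"
  proof (rule subgroupI)
    show "core G M \<subseteq> carrier G" by (fact ccl)
    have "\<one> \<in> core G M" by (rule mem_coreI) auto
    then show "core G M \<noteq> {}" by blast
  next
    fix a assume a: "a \<in> core G M"
    show "inv a \<in> core G M"
    proof (rule mem_coreI)
      fix g assume g: "g \<in> carrier G"
      have "g \<otimes> inv a \<otimes> inv g = inv (g \<otimes> a \<otimes> inv g)"
        using g a ccl by (auto simp: inv_mult_group m_assoc subset_iff)
      then show "g \<otimes> inv a \<otimes> inv g \<in> M" using core_conj[OF a M.subset g] by simp
    qed (use a ccl M.subset in auto)
    fix b assume b: "b \<in> core G M"
    show "a \<otimes> b \<in> core G M"
    proof (rule mem_coreI)
      fix g assume g: "g \<in> carrier G"
      have ab: "a \<in> carrier G" "b \<in> carrier G" using a b ccl by auto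
      have "g \<otimes> (a \<otimes> b) \<otimes> inv g = (g \<otimes> a \<otimes> inv g) \<otimes> (g \<otimes> b \<otimes> inv g)"
        using g ab by (simp add: m_assoc) (simp add: m_assoc[symmetric])
      then show "g \<otimes> (a \<otimes> b) \<otimes> inv g \<in> M"
        using core_conj[OF a M.subset g] core_conj[OF b M.subset g] by simp
    qed (use a b ccl M.subset in auto)
  qed
  moreover have "x \<otimes> a \<otimes> inv x \<in> core G M" if "x \<in> carrier G" "a \<in> core G M" for x a
  proof (rule mem_coreI)
    have ac: "a \<in> carrier G" using that ccl by auto
    show "x \<otimes> a \<otimes> inv x \<in> carrier G" using ac that by simp
    fix g assume g: "g \<in> carrier G"
    have "g \<otimes> (x \<otimes> a \<otimes> inv x) \<otimes> inv g = (g \<otimes> x) \<otimes> a \<otimes> inv (g \<otimes> x)"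
      using g ac that by (simp add: inv_mult_group m_assoc)
    then show "g \<otimes> (x \<otimes> a \<otimes> inv x) \<otimes> inv g \<in> M"
      using core_conj[OF that(2) M.subset, of "g \<otimes> x"] g that by simp
  qed (rule M.subset)
  ultimately show ?thesis unfolding normal_inv_iff by blast
qed

text \<open>Conjugates of maximal subgroups are maximal, so an element of all maximal subgroups lies
  in all their conjugates, that is, in their cores. Cores are normal, so this form exhibits the
  Frattini subgroup as the common kernel of quotient maps.\<close>

lemma (in group) Frattini_eq_Inter_core:
  "Frattini G = {x \<in> carrier G. \<forall>M. maximal_subgroup G M \<longrightarrow> x \<in> core G M}"
proof (intro equalityI subsetI CollectI conjI allI impI)
  fix x assume x: "x \<in> Frattini G"
  then show "x \<in> carrier G" unfolding Frattini_def by blast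
  fix M assume M: "maximal_subgroup G M"
  have "x \<in> {inv g \<otimes> m \<otimes> g | m. m \<in> M}" if "g \<in> carrier G" for g
    using x maximal_subgroup_conj[OF M that] unfolding Frattini_def by blast
  then show "x \<in> core G M" unfolding core_def by blast
next
  fix x assume x: "x \<in> {x \<in> carrier G. \<forall>M. maximal_subgroup G M \<longrightarrow> x \<in> core G M}"
  have "x \<in> M" if M: "maximal_subgroup G M" for M
  proof -
    have "M \<subseteq> carrier G" using M subgroup.subset unfolding maximal_subgroup_def by blast
    then show ?thesis using core_subset x M by blast
  qed
  then show "x \<in> Frattini G" using x unfolding Frattini_def by blast
qed

text \<open>Dividing out the core of \<open>M\<close> keeps \<open>M\<close> maximal, by the
  correspondence of subgroups, and makes the core of its image trivial.\<close>

lemma (in group_hom) primitive_img: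
  assumes surj: "h ` carrier G = carrier H" and M: "maximal_subgroup G M"
    and ker: "kernel G H h = core G M"
  shows "primitive H"
  unfolding primitive_def
proof (intro exI conjI)
  have Ms: "subgroup M G" "M \<noteq> carrier G" using M unfolding maximal_subgroup_def by auto
  interpret M: subgroup M G by fact
  have kM: "kernel G H h \<subseteq> M" using ker G.core_subset M.subset by simp
  \<comment> \<open>\<open>M\<close> contains the kernel, hence is the full preimage of its image.
    Properness of the image and triviality of its core are both pulled back through this.\<close>
  have sat: "x \<in> M" if x: "x \<in> carrier G" "h x \<in> h ` M" for x
  proof -
    obtain m where m: "m \<in> M" "h x = h m" using x by auto
    then have "x \<otimes> inv m \<in> kernel G H h" unfolding kernel_def using x by auto
    then have "x \<otimes> inv m \<otimes> m \<in> M" using kM m by blast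
    then show ?thesis using x m by (simp add: G.m_assoc)
  qed
  show "maximal_subgroup H (h ` M)"
    unfolding maximal_subgroup_def
  proof (intro conjI allI impI)
    show "subgroup (h ` M) H" using subgroup_img_is_subgroup[OF Ms(1)] .
    show "h ` M \<noteq> carrier H"
    proof
      assume "h ` M = carrier H"
      then have "carrier G \<subseteq> M" using sat surj by blast
      then show False using Ms M.subset by blast
    qed
    fix L assume L: "subgroup L H \<and> h ` M \<subseteq> L"
    interpret L: subgroup L H using L by blast
    let ?L = "{x \<in> carrier G. h x \<in> L}"
    have "subgroup ?L G" by (rule G.subgroupI) auto
    moreover have "M \<subseteq> ?L" using L M.subset by auto
    ultimately have "?L = M \<or> ?L = carrier G" using M unfolding maximal_subgroup_def by blast
    moreover have "h ` ?L = L" using surj L.subset by auto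
    ultimately show "L = h ` M \<or> L = carrier H" using surj by metis
  qed
  show "core H (h ` M) = {\<one>\<^bsub>H\<^esub>}"
  proof
    have hMc: "h ` M \<subseteq> carrier H" by auto
    show "core H (h ` M) \<subseteq> {\<one>\<^bsub>H\<^esub>}"
    proof
      fix u assume u: "u \<in> core H (h ` M)"
      then have "u \<in> h ` carrier G" using H.core_subset[OF hMc] M.subset by blast
      then obtain x where x: "x \<in> carrier G" "h x = u" by blast
      have "x \<in> core G M"
      proof (rule G.mem_coreI[OF x(1) M.subset])
        fix g assume g: "g \<in> carrier G"
        have "h (g \<otimes> x \<otimes> inv g) \<in> h ` M"
          using H.core_conj[OF u hMc, of "h g"] g x by simp
        then show "g \<otimes> x \<otimes> inv g \<in> M" using sat g x by simp
      qed
      then show "u \<in> {\<one>\<^bsub>H\<^esub>}" using ker x unfolding kernel_def by auto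
    qed
    show "{\<one>\<^bsub>H\<^esub>} \<subseteq> core H (h ` M)"
      using H.core_normal[OF subgroup_img_is_subgroup[OF Ms(1)]]
      by (simp add: normal_imp_subgroup subgroup.one_closed)
  qed
qed

section \<open>Isomorphic copies and the subdirect embedding\<close>

lemma primitive_iso:
  assumes "group G" "group H" "G \<cong> H" "primitive G"
  shows "primitive H"
proof -
  obtain h where h: "h \<in> iso G H" using assms unfolding is_iso_def by auto
  interpret group_hom G H h
    using assms h unfolding group_hom_def group_hom_axioms_def iso_def by auto
  obtain M where M: "maximal_subgroup G M" "core G M = {\<one>\<^bsub>G\<^esub>}" using assms unfolding primitive_def by auto
  have "kernel G H h = {\<one>\<^bsub>G\<^esub>}"
    using h inj_iff_trivial_ker unfolding iso_def bij_betw_def by auto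
  then show ?thesis using primitive_img M h unfolding iso_def bij_betw_def by auto
qed

lemma MP_iso:
  assumes "group G" "group H" "G \<cong> H" "finite (carrier G)" "MP G"
  shows "MP H"
proof -
  obtain h where h: "h \<in> iso G H" using assms unfolding is_iso_def by auto
  interpret group_hom G H h
    using assms h unfolding group_hom_def group_hom_axioms_def iso_def by auto
  show ?thesis using MP_img assms h unfolding iso_def bij_betw_def by auto
qed

lemma SMP_iso:
  assumes "group G" "group H" "G \<cong> H" "finite (carrier G)" "SMP G"
  shows "SMP H"
proof -
  obtain h where h: "h \<in> iso G H" using assms unfolding is_iso_def by auto
  interpret group_hom G H h
    using assms h unfolding group_hom_def group_hom_axioms_def iso_def by auto
  show ?thesis using SMP_img assms h unfolding iso_def bij_betw_def by auto
qed

text \<open>All factors of the subdirect product have to live in the one type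
  \<open>nat monoid\<close>, whereas quotients of \<open>G\<close> consist of cosets; finiteness
  permits relabelling.\<close>

lemma finite_group_nat_copy:
  assumes "group K" and fin: "finite (carrier K)"
  obtains Q :: "nat monoid" and f where "group Q" "f \<in> iso K Q" "finite (carrier Q)"
proof -
  interpret group K by fact
  obtain f :: "'a \<Rightarrow> nat" where f: "inj_on f (carrier K)"
    using fin finite_imp_inj_to_nat_seg by metis
  define b where "b = the_inv_into (carrier K) f"
  define Q :: "nat monoid" where
    "Q = \<lparr>carrier = f ` carrier K, monoid.mult = (\<lambda>x y. f (b x \<otimes>\<^bsub>K\<^esub> b y)), one = f \<one>\<^bsub>K\<^esub>\<rparr>"
  have b: "b (f x) = x" if "x \<in> carrier K" for x
    unfolding b_def using the_inv_into_f_f[OF f that] .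
  have iso: "f \<in> iso K Q"
    unfolding iso_def hom_def bij_betw_def using f b by (auto simp: Q_def)
  have "group Q"
    using iso_imp_img_group[OF iso] by (simp add: Q_def)
  then show thesis using that iso fin unfolding Q_def by auto
qed

lemma (in group) quotient_nat_copy:
  assumes "N \<lhd> G" and fin: "finite (carrier G)"
  obtains Q :: "nat monoid" and h where "group_hom G Q h" "h ` carrier G = carrier Q"
    "kernel G Q h = N" "finite (carrier Q)"
proof -
  interpret normal N G by fact
  have "finite (carrier (G Mod N))" using fin by (simp add: FactGroup_def RCOSETS_def)
  then obtain Q :: "nat monoid" and f where Q: "group Q" "f \<in> iso (G Mod N) Q" "finite (carrier Q)"
    using finite_group_nat_copy factorgroup_is_group by metis
  define h where "h = f \<circ> (\<lambda>a. N #> a)"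
  have hom: "h \<in> hom G Q" unfolding h_def
    using Q(2) Group.hom_compose[OF r_coset_hom_Mod] unfolding iso_def by blast
  have gh: "group_hom G Q h"
    using Q(1) hom is_group by (simp add: group_hom_def group_hom_axioms_def)
  have img: "h ` carrier G = carrier Q"
  proof -
    have "(\<lambda>a. N #> a) ` carrier G = carrier (G Mod N)" by (auto simp: FactGroup_def RCOSETS_def)
    then have "h ` carrier G = f ` carrier (G Mod N)" unfolding h_def image_comp[symmetric] by simp
    then show ?thesis using Q(2) unfolding iso_def bij_betw_def by simp
  qed
  have "h x = \<one>\<^bsub>Q\<^esub> \<longleftrightarrow> x \<in> N" if "x \<in> carrier G" for x
  proof -
    have "f N = \<one>\<^bsub>Q\<^esub>" using Q hom_one[of f "G Mod N" Q] factorgroup_is_group unfolding iso_def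
      by (auto simp: FactGroup_def)
    moreover have "inj_on f (carrier (G Mod N))" using Q(2) unfolding iso_def bij_betw_def by auto
    moreover have "N #> x \<in> carrier (G Mod N)" "N \<in> carrier (G Mod N)"
      using that rcosetsI[OF subset] subgroup_in_rcosets[OF is_group] by (auto simp: FactGroup_def)
    ultimately have "h x = \<one>\<^bsub>Q\<^esub> \<longleftrightarrow> N #> x = N" unfolding h_def comp_def by (metis inj_onD)
    also have "\<dots> \<longleftrightarrow> x \<in> N" using that rcos_const[OF is_group] rcos_self[OF that] subgroup_axioms coset_join1 by blast
    finally show ?thesis .
  qed
  then have "kernel G Q h = N" unfolding kernel_def using subset by auto
  then show thesis using that gh img Q(3) by blast
qed

text \<open>The diagonal map into the product of the quotients by the cores of all maximal subgroups
  has the Frattini subgroup as its kernel. An injection \<open>e\<close> numbers the maximal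
  subgroups and so supplies the index set. The maps \<open>h i\<close> are returned as well, so that
  the Magnus properties can be pushed along them.\<close>

lemma (in group) Frattini_quotient_subdirect:
  assumes fin: "finite (carrier G)"
  obtains I :: "nat set" and Hs :: "nat \<Rightarrow> nat monoid" and h
  where "finite I" "iso_subdirect (G Mod Frattini G) I Hs"
    "\<And>i. i \<in> I \<Longrightarrow> group_hom G (Hs i) (h i)" "\<And>i. i \<in> I \<Longrightarrow> h i ` carrier G = carrier (Hs i)"
    "\<And>i. i \<in> I \<Longrightarrow> primitive (Hs i)"
proof -
  have fM: "finite {M. maximal_subgroup G M}"
    by (rule finite_subset[of _ "Pow (carrier G)"])
       (use fin in \<open>auto simp: maximal_subgroup_def dest: subgroup.subset\<close>)
  then obtain e :: "'a set \<Rightarrow> nat" where e: "inj_on e {M. maximal_subgroup G M}"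
    using finite_imp_inj_to_nat_seg by metis
  define I where "I = e ` {M. maximal_subgroup G M}"
  define Mx where "Mx = inv_into {M. maximal_subgroup G M} e"
  have Mx: "maximal_subgroup G (Mx i)" if "i \<in> I" for i
    using inv_into_into[of i e "{M. maximal_subgroup G M}"] that unfolding I_def Mx_def by auto
  have Mx_surj: "\<exists>i\<in>I. Mx i = M" if "maximal_subgroup G M" for M
    using that e unfolding I_def Mx_def by auto
  have "\<exists>Q :: nat monoid. \<exists>h. group_hom G Q h \<and> h ` carrier G = carrier Q \<and>
          kernel G Q h = core G (Mx i) \<and> finite (carrier Q)" if "i \<in> I" for i
    using quotient_nat_copy[OF core_normal fin] Mx[OF that] unfolding maximal_subgroup_def by metis
  then obtain Hs :: "nat \<Rightarrow> nat monoid" and h where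
    Hs: "\<And>i. i \<in> I \<Longrightarrow> group_hom G (Hs i) (h i)" "\<And>i. i \<in> I \<Longrightarrow> h i ` carrier G = carrier (Hs i)"
      "\<And>i. i \<in> I \<Longrightarrow> kernel G (Hs i) (h i) = core G (Mx i)"
    by metis
  have grp: "group (Hs i)" if "i \<in> I" for i using Hs(1)[OF that] by (simp add: group_hom_def)
  let ?P = "product_group I Hs"
  interpret P: group ?P using grp by simp
  define f where "f x = (\<lambda>i\<in>I. h i x)" for x
  have fhom: "f \<in> hom G ?P"
    unfolding hom_def f_def using Hs(1) group_hom.hom_closed[OF Hs(1)] group_hom.hom_mult[OF Hs(1)]
    by (auto simp: restrict_def)
  interpret f: group_hom G ?P f
    using fhom by unfold_locales
  define S where "S = f ` carrier G"
  have S: "subgroup S ?P" unfolding S_def by (rule f.img_is_subgroup)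
  have fS: "group_hom G (?P\<lparr>carrier := S\<rparr>) f"
    using S fhom P.subgroup_imp_group is_group unfolding group_hom_def group_hom_axioms_def hom_def S_def
    by auto
  have kerf: "kernel G (?P\<lparr>carrier := S\<rparr>) f = Frattini G"
  proof -
    have "f x = \<one>\<^bsub>?P\<^esub> \<longleftrightarrow> (\<forall>i\<in>I. x \<in> core G (Mx i))" if "x \<in> carrier G" for x
    proof -
      have "f x = \<one>\<^bsub>?P\<^esub> \<longleftrightarrow> (\<forall>i\<in>I. h i x = \<one>\<^bsub>Hs i\<^esub>)"
        unfolding f_def by (auto simp: restrict_def fun_eq_iff)
      also have "\<dots> \<longleftrightarrow> (\<forall>i\<in>I. x \<in> core G (Mx i))"
        using Hs(3) that unfolding kernel_def by blast
      finally show ?thesis .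
    qed
    then have "kernel G (?P\<lparr>carrier := S\<rparr>) f = {x \<in> carrier G. \<forall>i\<in>I. x \<in> core G (Mx i)}"
      unfolding kernel_def by auto
    also have "\<dots> = Frattini G"
      unfolding Frattini_eq_Inter_core using Mx Mx_surj by blast
    finally show ?thesis .
  qed
  have "G Mod Frattini G \<cong> ?P\<lparr>carrier := S\<rparr>"
    using group_hom.FactGroup_iso[OF fS] kerf S_def by simp
  moreover have "(\<lambda>u. u i) ` S = carrier (Hs i)" if "i \<in> I" for i
    using Hs(2)[OF that] that unfolding S_def f_def image_image by simp
  ultimately have "iso_subdirect (G Mod Frattini G) I Hs"
    unfolding iso_subdirect_def using S by blast
  moreover have "primitive (Hs i)" if "i \<in> I" for i
    using group_hom.primitive_img[OF Hs(1,2) Mx Hs(3)] that by blast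
  moreover have "finite I" unfolding I_def using fM by simp
  ultimately show thesis using that Hs by blast
qed

section \<open>Conjugation, powers and element orders\<close>

text \<open>The conjugation of \<open>conj_in\<close>, named so that it can be used as an
  endomorphism. It is a right action: in \<open>cj_cj\<close> the element
  \<open>u \<otimes> v\<close> means \<open>u\<close> first.\<close>

definition (in group) cj :: "'a \<Rightarrow> 'a \<Rightarrow> 'a" where
  "cj u x = inv u \<otimes> x \<otimes> u"

context group
begin

lemma cj_closed [simp, intro]: "u \<in> carrier G \<Longrightarrow> x \<in> carrier G \<Longrightarrow> cj u x \<in> carrier G"
  by (simp add: cj_def)

lemma cj_mult:
  "u \<in> carrier G \<Longrightarrow> x \<in> carrier G \<Longrightarrow> y \<in> carrier G \<Longrightarrow> cj u (x \<otimes> y) = cj u x \<otimes> cj u y"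
  unfolding cj_def by (simp add: m_assoc) (simp add: m_assoc[symmetric])

lemma cj_cj:
  "u \<in> carrier G \<Longrightarrow> v \<in> carrier G \<Longrightarrow> x \<in> carrier G \<Longrightarrow> cj v (cj u x) = cj (u \<otimes> v) x"
  unfolding cj_def by (simp add: m_assoc inv_mult_group)

lemma cj_one [simp]: "x \<in> carrier G \<Longrightarrow> cj \<one> x = x"
  by (simp add: cj_def)

lemma cj_group_hom: "u \<in> carrier G \<Longrightarrow> group_hom G G (cj u)"
  unfolding group_hom_def group_hom_axioms_def hom_def using is_group cj_mult by simp

lemma cj_int_pow:
  "u \<in> carrier G \<Longrightarrow> x \<in> carrier G \<Longrightarrow> cj u (x [^] (i::int)) = cj u x [^] i"
  using group_hom.hom_int_pow[OF cj_group_hom] by simp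

lemma cj_nat_pow:
  "u \<in> carrier G \<Longrightarrow> x \<in> carrier G \<Longrightarrow> cj u (x [^] (i::nat)) = cj u x [^] i"
  using group_hom.hom_nat_pow[OF cj_group_hom] by simp

lemma cj_eq_iff:
  assumes "u \<in> carrier G" "x \<in> carrier G" "y \<in> carrier G"
  shows "cj u x = y \<longleftrightarrow> x \<otimes> u = u \<otimes> y"
  unfolding cj_def using assms by (metis inv_closed inv_solve_left m_assoc m_closed)

lemma cj_eq_self_iff:
  assumes "u \<in> carrier G" "x \<in> carrier G"
  shows "cj u x = x \<longleftrightarrow> x \<otimes> u = u \<otimes> x"
  using cj_eq_iff assms by simp

lemma cj_pow_left:
  assumes "u \<in> carrier G" "x \<in> carrier G" "cj u x = x [^] (c::int)"
  shows "cj (u [^] (n::nat)) x = x [^] (c ^ n)"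
proof (induction n)
  case (Suc n)
  have "cj (u [^] Suc n) x = cj u (cj (u [^] n) x)" using assms cj_cj by simp
  also have "\<dots> = cj u x [^] (c ^ n)" using Suc assms cj_int_pow by simp
  also have "\<dots> = x [^] (c ^ Suc n)" using assms by (simp add: int_pow_pow mult.commute)
  finally show ?case .
qed (use assms in simp)

lemma commute_nat_pow:
  assumes "x \<in> carrier G" "y \<in> carrier G" "x \<otimes> y = y \<otimes> x"
  shows "x \<otimes> (y [^] (n::nat)) = (y [^] n) \<otimes> x"
  using assms by (metis cj_eq_self_iff cj_nat_pow nat_pow_closed)

lemma commute_int_pow:
  assumes "x \<in> carrier G" "y \<in> carrier G" "x \<otimes> y = y \<otimes> x"
  shows "x \<otimes> (y [^] (n::int)) = (y [^] n) \<otimes> x"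
  using assms by (metis cj_eq_self_iff cj_int_pow int_pow_closed)

lemma commute_mult:
  assumes "x \<in> carrier G" "y \<in> carrier G" "z \<in> carrier G"
    "x \<otimes> y = y \<otimes> x" "x \<otimes> z = z \<otimes> x"
  shows "x \<otimes> (y \<otimes> z) = (y \<otimes> z) \<otimes> x"
  using assms by (metis m_assoc)

text \<open>Here \<open>h u = u h^c\<close>, so moving each factor \<open>h [^] i\<close> to the
  right past the later factors \<open>u\<close> multiplies its exponent by a power of
  \<open>c\<close>; the exponents add up to a geometric sum. A good choice of \<open>i\<close> will
  make such a power trivial.\<close>

lemma twisted_power:
  assumes u: "u \<in> carrier G" and h: "h \<in> carrier G" and c: "cj u h = h [^] (c::int)"
  shows "(u \<otimes> h [^] (i::int)) [^] (n::nat) = u [^] n \<otimes> h [^] (i * (\<Sum>j<n. c ^ j))"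
proof (induction n)
  case (Suc n)
  let ?s = "\<Sum>j<n. c ^ j"
  have mv: "h [^] (i * ?s) \<otimes> u = u \<otimes> h [^] (c * (i * ?s))"
    using cj_int_pow[OF u h, of "i * ?s"] c cj_eq_iff[of u "h [^] (i * ?s)"] u h
    by (simp add: int_pow_pow)
  have "(u \<otimes> h [^] i) [^] Suc n = u [^] n \<otimes> (h [^] (i * ?s) \<otimes> u) \<otimes> h [^] i"
    using u h Suc by (simp add: m_assoc)
  also have "\<dots> = u [^] Suc n \<otimes> (h [^] (c * (i * ?s)) \<otimes> h [^] i)"
    unfolding mv using u h by (simp add: m_assoc)
  also have "h [^] (c * (i * ?s)) \<otimes> h [^] i = h [^] (i * (\<Sum>j<Suc n. c ^ j))"
  proof -
    have "(\<Sum>j<Suc n. c ^ j) = 1 + c * ?s"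
      by (simp add: sum.lessThan_Suc_shift sum_distrib_left del: sum.lessThan_Suc)
    then have "i * (\<Sum>j<Suc n. c ^ j) = c * (i * ?s) + i" by (simp add: algebra_simps)
    then show ?thesis using h by (simp add: int_pow_mult)
  qed
  finally show ?case .
qed (use assms in simp)

lemma ord_eq_prime:
  assumes "x \<in> carrier G" "x \<noteq> \<one>" "x [^] (p::nat) = \<one>" "Factorial_Ring.prime p"
  shows "ord x = p"
  using pow_eq_id[OF assms(1), of p] assms ord_eq_1 prime_nat_iff by blast

text \<open>Sylow's theorem with exponent 1 gives a subgroup of order \<open>p\<close>, and any
  nontrivial element of it will do.\<close>

lemma cauchy:
  assumes "finite (carrier G)" "Factorial_Ring.prime p" "p dvd order G"
  obtains x where "x \<in> carrier G" "ord x = p" "x \<noteq> \<one>" "x [^] p = \<one>"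
proof -
  obtain m where "order G = p ^ 1 * m" using assms by auto
  then obtain H where H: "subgroup H G" "card H = p"
    using sylow_thm[OF assms(2) is_group _ assms(1), of 1 m] by auto
  have "card H > 1" using H prime_gt_1_nat assms by simp
  then have "\<not> H \<subseteq> {\<one>}" using card_mono[of "{\<one>}" H] by auto
  then obtain x where x: "x \<in> H" "x \<noteq> \<one>" by auto
  have xc: "x \<in> carrier G" using x H subgroup.mem_carrier by metis
  have "x [^]\<^bsub>G\<lparr>carrier := H\<rparr>\<^esub> order (G\<lparr>carrier := H\<rparr>) = \<one>\<^bsub>G\<lparr>carrier := H\<rparr>\<^esub>"
    using group.pow_order_eq_1[OF subgroup_imp_group[OF H(1)]] x by simp
  then have "x [^] p = \<one>" using H(2) nat_pow_consistent by (simp add: order_def)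
  then show thesis using that xc x ord_eq_prime[OF xc x(2) _ assms(2)] by blast
qed

lemma subgroup_pow_card:
  assumes H: "subgroup H G" "finite H" and "x \<in> H"
  shows "x [^] card H = \<one>"
proof -
  have "x [^]\<^bsub>G\<lparr>carrier := H\<rparr>\<^esub> order (G\<lparr>carrier := H\<rparr>) = \<one>\<^bsub>G\<lparr>carrier := H\<rparr>\<^esub>"
    using group.pow_order_eq_1[OF subgroup_imp_group[OF H(1)]] assms by simp
  then show ?thesis using nat_pow_consistent by (simp add: order_def)
qed

lemma subgroup_cauchy:
  assumes H: "subgroup H G" "finite H" and p: "Factorial_Ring.prime p" "p dvd card H"
  obtains x where "x \<in> H" "x \<noteq> \<one>" "x [^] p = \<one>"
proof -
  interpret H: group "G\<lparr>carrier := H\<rparr>" using subgroup_imp_group[OF H(1)] .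
  show ?thesis
    using H.cauchy[OF _ p(1)] H(2) p(2) that nat_pow_consistent by (auto simp: order_def)
qed

lemma subgroup_card_dvd:
  assumes "subgroup H G" "finite (carrier G)"
  shows "card H dvd order G"
  using lagrange_finite[OF assms(2,1)] by (metis dvd_triv_right)

lemma mem_generate_iff:
  assumes "x \<in> carrier G"
  shows "y \<in> generate G {x} \<longleftrightarrow> (\<exists>k::int. y = x [^] k)"
  using generate_pow[OF assms] by auto

text \<open>A power with exponent prime to the order generates the same cyclic group, hence has the
  same normal closure. Conjugacy to the inverse is absorbed in the sign of the exponent.\<close>

lemma MP_conj_pow:
  assumes "MP G" and x: "x \<in> carrier G" and cop: "coprime j (int (ord x))"
  obtains u where "u \<in> carrier G" "cj u x = x [^] j \<or> cj u x = x [^] (- j)"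
proof -
  obtain k l where "k * j + l * int (ord x) = 1" using bezout_int[of j "int (ord x)"] cop by auto
  then have "1 - j * k = int (ord x) * l" by (simp add: algebra_simps)
  then have k: "(x [^] j) [^] k = x"
    using int_pow_eq[OF x, of "j * k" 1] x by (simp add: int_pow_pow)
  have pow_in: "y [^] i \<in> normal_closure G y" if "y \<in> carrier G" for y and i :: int
    using that normal_closure_mem normal_closure_normal[THEN normal_imp_subgroup]
      subgroup_int_pow_closed by blast
  have "normal_closure G (x [^] j) = normal_closure G x"
    using normal_closure_eqI[of "x [^] j" x] pow_in[OF x] pow_in[of "x [^] j" k] k x by simp
  then have "conj_in G x (x [^] j) \<or> conj_in G (inv x) (x [^] j)"
    using assms(1) x unfolding MP_def by simp
  then show thesis
  proof
    assume "conj_in G x (x [^] j)"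
    then show thesis using that unfolding conj_in_def cj_def by metis
  next
    assume "conj_in G (inv x) (x [^] j)"
    then obtain g where g: "g \<in> carrier G" "x [^] j = cj g (inv x)"
      unfolding conj_in_def cj_def by metis
    then have "x [^] j = inv (cj g x)"
      using x group_hom.hom_inv[OF cj_group_hom] by simp
    then have "cj g x = x [^] (- j)" using g x by (simp add: int_pow_neg)
    then show thesis using that g by blast
  qed
qed

text \<open>\<open>m\<close> is the part of the order of \<open>u\<close> prime to \<open>s\<close>.
  It is invertible modulo \<open>s\<close>, so passing to \<open>u [^] m\<close> loses nothing that
  is visible at the prime \<open>s\<close>.\<close>

lemma prime_power_part:
  assumes "finite (carrier G)" "u \<in> carrier G" "Factorial_Ring.prime (s::nat)"
  obtains m f where "\<not> s dvd m" "(u [^] m) [^] (s ^ f) = \<one>"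
proof -
  have "ord u \<noteq> 0" using ord_ge_1[OF assms(1,2)] by simp
  then obtain m where m: "ord u = s ^ multiplicity s (ord u) * m" "\<not> s dvd m"
    using multiplicity_decompose'[of "ord u" s] assms(3) not_prime_unit by metis
  then have "u [^] (m * s ^ multiplicity s (ord u)) = \<one>"
    using pow_ord_eq_1[OF assms(2)] by (simp add: mult.commute)
  then show thesis using that[OF m(2)] assms(2) by (simp add: nat_pow_pow)
qed

end

text \<open>Rotation of a cyclic arrangement of factors. It makes a product over the powers of an
  element invariant under that element.\<close>

lemma (in comm_group) finprod_shift:
  assumes f: "f \<in> {..n} \<rightarrow> carrier G" and eq: "f n = f 0"
  shows "finprod G (\<lambda>i. f (Suc i)) {..<n} = finprod G f {..<n}"
proof (cases n)
  case (Suc k)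
  have c: "finprod G f {..k} \<in> carrier G" "finprod G (\<lambda>i. f (Suc i)) {..k} \<in> carrier G" "f 0 \<in> carrier G"
    using f Suc by (auto intro!: finprod_closed simp: Pi_def)
  have "f (Suc k) \<otimes> finprod G f {..k} = finprod G (\<lambda>i. f (Suc i)) {..k} \<otimes> f 0"
    using finprod_Suc[of f k] finprod_Suc2[of f k] f Suc by simp
  then have "finprod G f {..k} = finprod G (\<lambda>i. f (Suc i)) {..k}"
    using eq Suc c by (metis m_comm r_cancel)
  then show ?thesis using Suc by (simp add: lessThan_Suc_atMost)
qed simp

lemma (in comm_monoid) finprod_swap_lessThan:
  assumes "finite I" "\<And>i j. i \<in> I \<Longrightarrow> f i j \<in> carrier G"
  shows "finprod G (\<lambda>i. finprod G (f i) {..<s::nat}) I = finprod G (\<lambda>j. finprod G (\<lambda>i. f i j) I) {..<s}"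
proof (induction s)
  case (Suc s)
  have "finprod G (\<lambda>i. finprod G (f i) {..<Suc s}) I
      = finprod G (\<lambda>i. f i s \<otimes> finprod G (f i) {..<s}) I"
    by (rule finprod_cong') (use assms in \<open>auto simp: lessThan_Suc\<close>)
  also have "\<dots> = finprod G (\<lambda>i. f i s) I \<otimes> finprod G (\<lambda>i. finprod G (f i) {..<s}) I"
    by (rule finprod_multf) (use assms in auto)
  also have "\<dots> = finprod G (\<lambda>j. finprod G (\<lambda>i. f i j) I) {..<Suc s}"
    unfolding Suc using assms by (simp add: lessThan_Suc Pi_def)
  finally show ?case .
qed (use assms in simp)

lemma (in group_hom) hom_finprod:
  assumes "comm_group G" "comm_group H" "finite I" "f \<in> I \<rightarrow> carrier G"
  shows "h (finprod G f I) = finprod H (\<lambda>i. h (f i)) I"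
proof -
  interpret G: comm_group G by fact
  interpret H: comm_group H by fact
  show ?thesis using assms(3,4)
    by (induction I) (auto simp: Pi_def)
qed

section \<open>Fixed-point-free actions\<close>

text \<open>The action of a complement \<open>K\<close> on an abelian normal subgroup
  \<open>A\<close>, detached from the group that contains both. \<open>A\<close> is written
  multiplicatively, so sums over images of a vector appear as \<open>finprod\<close>. Nontriviality
  of \<open>A\<close> together with \<open>fpf\<close> makes the action faithful.\<close>

locale fpf_action = group K + A: comm_group A
  for K (structure) and A :: "('v, 'w) monoid_scheme" +
  fixes \<phi> :: "'a \<Rightarrow> 'v \<Rightarrow> 'v"
  assumes finite_K: "finite (carrier K)" and finite_A: "finite (carrier A)"
    and nontriv_A: "carrier A \<noteq> {\<one>\<^bsub>A\<^esub>}"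
    and act_hom: "g \<in> carrier K \<Longrightarrow> \<phi> g \<in> hom A A"
    and act_mult: "g \<in> carrier K \<Longrightarrow> h \<in> carrier K \<Longrightarrow> v \<in> carrier A \<Longrightarrow> \<phi> (g \<otimes> h) v = \<phi> g (\<phi> h v)"
    and act_one: "v \<in> carrier A \<Longrightarrow> \<phi> \<one> v = v"
    and fpf: "g \<in> carrier K \<Longrightarrow> g \<noteq> \<one> \<Longrightarrow> v \<in> carrier A \<Longrightarrow> \<phi> g v = v \<Longrightarrow> v = \<one>\<^bsub>A\<^esub>"
begin

lemma act_group_hom: "g \<in> carrier K \<Longrightarrow> group_hom A A (\<phi> g)"
  unfolding group_hom_def group_hom_axioms_def using act_hom A.is_group by simp

lemma act_closed [simp, intro]: "g \<in> carrier K \<Longrightarrow> v \<in> carrier A \<Longrightarrow> \<phi> g v \<in> carrier A"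
  using group_hom.hom_closed[OF act_group_hom] by simp

lemma act_int_pow: "g \<in> carrier K \<Longrightarrow> v \<in> carrier A \<Longrightarrow> \<phi> g (v [^]\<^bsub>A\<^esub> (i::int)) = \<phi> g v [^]\<^bsub>A\<^esub> i"
  using group_hom.hom_int_pow[OF act_group_hom] by simp

lemma act_inv_cancel: "g \<in> carrier K \<Longrightarrow> v \<in> carrier A \<Longrightarrow> \<phi> (inv g) (\<phi> g v) = v"
  using act_mult[of "inv g" g v] act_one by simp

lemma act_eq_one_iff: "g \<in> carrier K \<Longrightarrow> v \<in> carrier A \<Longrightarrow> \<phi> g v = \<one>\<^bsub>A\<^esub> \<longleftrightarrow> v = \<one>\<^bsub>A\<^esub>"
  using act_inv_cancel[of g v] group_hom.hom_one[OF act_group_hom] by (metis inv_closed)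

lemma act_inj:
  assumes "g \<in> carrier K" "h \<in> carrier K" "v \<in> carrier A" "v \<noteq> \<one>\<^bsub>A\<^esub>" "\<phi> g v = \<phi> h v"
  shows "g = h"
proof -
  have "\<phi> (inv h \<otimes> g) v = v" using assms act_mult[of "inv h" g v] act_inv_cancel by simp
  then have "inv h \<otimes> g = \<one>" using fpf[of "inv h \<otimes> g" v] assms(1-4) by blast
  moreover have "h \<otimes> (inv h \<otimes> g) = g" using assms(1,2) by (simp add: m_assoc[symmetric])
  ultimately show ?thesis using assms(2) by simp
qed

lemma ex_nontriv: "\<exists>v\<in>carrier A. v \<noteq> \<one>\<^bsub>A\<^esub>"
  using nontriv_A A.one_closed by blast

lemma act_eqI:
  assumes "g \<in> carrier K" "h \<in> carrier K" "\<And>v. v \<in> carrier A \<Longrightarrow> \<phi> g v = \<phi> h v"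
  shows "g = h"
  using assms act_inj ex_nontriv by metis

text \<open>\<open>y\<close> permutes the factors cyclically, so it fixes the product, and a
  nontrivial element fixes only the identity.\<close>

lemma prod_cyclic_eq_one:
  assumes y: "y \<in> carrier K" "y \<noteq> \<one>" "y [^] (n::nat) = \<one>" and v: "v \<in> carrier A"
  shows "finprod A (\<lambda>j. \<phi> (y [^] j) v) {..<n} = \<one>\<^bsub>A\<^esub>" (is "?P = _")
proof -
  have Pc: "?P \<in> carrier A" using y v by (intro A.finprod_closed) auto
  have "\<phi> y ?P = finprod A (\<lambda>j. \<phi> y (\<phi> (y [^] j) v)) {..<n}"
    using y v by (intro group_hom.hom_finprod[OF act_group_hom] A.comm_group_axioms) auto
  also have "\<dots> = finprod A (\<lambda>j. \<phi> (y [^] Suc j) v) {..<n}"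
  proof (rule A.finprod_cong')
    fix j
    have "y [^] Suc j = y \<otimes> y [^] j" using nat_pow_Suc2 y by simp
    then show "\<phi> y (\<phi> (y [^] j) v) = \<phi> (y [^] Suc j) v" using act_mult y v by simp
  qed (use y v in auto)
  also have "\<dots> = ?P" by (rule A.finprod_shift) (use y v in auto)
  finally show ?thesis using fpf y Pc by blast
qed

text \<open>The argument of \<open>prod_cyclic_eq_one\<close> with translation by \<open>x\<close>
  as the permutation; indexing by the subgroup itself is what the passage to its cosets
  requires.\<close>

lemma prod_powers_eq_one:
  assumes x: "x \<in> carrier K" "x \<noteq> \<one>" and v: "v \<in> carrier A"
  shows "finprod A (\<lambda>b. \<phi> b v) (generate K {x}) = \<one>\<^bsub>A\<^esub>" (is "?P = _")
proof -
  have sub: "generate K {x} \<subseteq> carrier K" using generate_in_carrier[of "{x}"] x by auto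
  interpret X: subgroup "generate K {x}" K using generate_is_subgroup x by simp
  have xX: "x \<in> generate K {x}" by (simp add: generate.incl)
  have fin: "finite (generate K {x})" using finite_subset[OF sub finite_K] .
  have Pc: "?P \<in> carrier A" using sub v by (intro A.finprod_closed) auto
  have bij: "inj_on ((\<otimes>) x) (generate K {x})" "(\<otimes>) x ` generate K {x} = generate K {x}"
  proof -
    show inj: "inj_on ((\<otimes>) x) (generate K {x})" using x sub by (auto intro!: inj_onI simp: subset_iff)
    show "(\<otimes>) x ` generate K {x} = generate K {x}"
      by (rule card_subset_eq) (use fin xX inj in \<open>auto simp: card_image\<close>)
  qed
  have "\<phi> x ?P = finprod A (\<lambda>b. \<phi> x (\<phi> b v)) (generate K {x})"
    using x v sub fin by (intro group_hom.hom_finprod[OF act_group_hom] A.comm_group_axioms) auto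
  also have "\<dots> = finprod A (\<lambda>b. \<phi> (x \<otimes> b) v) (generate K {x})"
    by (intro A.finprod_cong') (use x v act_mult sub in auto)
  also have "\<dots> = finprod A (\<lambda>b. \<phi> b v) ((\<otimes>) x ` generate K {x})"
    by (rule A.finprod_reindex[symmetric]) (use bij v sub in auto)
  also have "\<dots> = ?P" unfolding bij(2) ..
  finally show ?thesis using fpf x Pc by blast
qed

text \<open>Summing the action over all cyclic groups \<open>\<langle>y i\<rangle>\<close>, and over the cosets of \<open>\<langle>x\<rangle>\<close> that their nontrivial
  elements fill, isolates the contribution of the identity.\<close>

lemma coset_partition_exponent:
  assumes x: "x \<in> carrier K" "x \<noteq> \<one>" and s: "0 < (s::nat)"
    and y: "\<And>i. i < ord x \<Longrightarrow> y i \<in> carrier K \<and> y i \<noteq> \<one> \<and> y i [^] s = \<one>"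
    and g: "\<And>j. 0 < j \<Longrightarrow> j < s \<Longrightarrow> g j \<in> carrier K"
    and inj: "\<And>j. 0 < j \<Longrightarrow> j < s \<Longrightarrow> inj_on (\<lambda>i. y i [^] j) {..<ord x}"
    and coset: "\<And>i j. i < ord x \<Longrightarrow> 0 < j \<Longrightarrow> j < s \<Longrightarrow> \<exists>k::int. y i [^] j = g j \<otimes> x [^] k"
    and v: "v \<in> carrier A"
  shows "v [^]\<^bsub>A\<^esub> ord x = \<one>\<^bsub>A\<^esub>"
proof -
  let ?r = "ord x" and ?X = "generate K {x}"
  have Xsub: "?X \<subseteq> carrier K" using generate_in_carrier[of "{x}"] x by auto
  have fX: "finite ?X" using finite_subset[OF Xsub finite_K] .
  have cX: "card ?X = ?r" using generate_pow_card[OF x(1)] by simp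
  \<comment> \<open>For fixed \<open>j\<close> the powers \<open>y i [^] j\<close> run exactly
    through the coset of \<open>g j\<close>, by injectivity and counting. The product over a coset
    is the image under \<open>g j\<close> of the product over \<open>generate K {x}\<close>, hence
    trivial.\<close>
  have inner: "finprod A (\<lambda>i. \<phi> (y i [^] j) v) {..<?r} = \<one>\<^bsub>A\<^esub>" if j: "0 < j" "j < s" for j
  proof -
    let ?Y = "(\<lambda>b. g j \<otimes> b) ` ?X"
    have gj: "g j \<in> carrier K" using g j by simp
    have injg: "inj_on (\<lambda>b. g j \<otimes> b) ?X" using gj Xsub by (auto intro!: inj_onI simp: subset_iff)
    have "(\<lambda>i. y i [^] j) ` {..<?r} = ?Y"
    proof (rule card_subset_eq)
      show "finite ?Y" using fX by simp
      show "(\<lambda>i. y i [^] j) ` {..<?r} \<subseteq> ?Y"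
      proof (rule image_subsetI)
        fix i assume "i \<in> {..<?r}"
        then obtain k :: int where "y i [^] j = g j \<otimes> x [^] k" using coset j by auto
        then show "y i [^] j \<in> ?Y" using mem_generate_iff[OF x(1)] by blast
      qed
      show "card ((\<lambda>i. y i [^] j) ` {..<?r}) = card ?Y"
        using inj[OF j] injg cX by (simp add: card_image)
    qed
    moreover have "(\<lambda>b. \<phi> b v) \<in> ?Y \<rightarrow> carrier A" using gj Xsub v by auto
    ultimately have "finprod A (\<lambda>i. \<phi> (y i [^] j) v) {..<?r} = finprod A (\<lambda>b. \<phi> b v) ?Y"
      using A.finprod_reindex[of "\<lambda>b. \<phi> b v" "\<lambda>i. y i [^] j" "{..<?r}"] inj[OF j] by simp
    also have "\<dots> = finprod A (\<lambda>b. \<phi> (g j \<otimes> b) v) ?X"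
      by (rule A.finprod_reindex) (use injg gj Xsub v in auto)
    also have "\<dots> = finprod A (\<lambda>b. \<phi> (g j) (\<phi> b v)) ?X"
      by (intro A.finprod_cong') (use gj v act_mult Xsub in auto)
    also have "\<dots> = \<phi> (g j) (finprod A (\<lambda>b. \<phi> b v) ?X)"
      using gj v Xsub fX
      by (intro group_hom.hom_finprod[OF act_group_hom, symmetric] A.comm_group_axioms) auto
    also have "\<dots> = \<one>\<^bsub>A\<^esub>"
      using prod_powers_eq_one[OF x v] gj act_eq_one_iff by simp
    finally show ?thesis .
  qed
  have "\<one>\<^bsub>A\<^esub> = finprod A (\<lambda>i. finprod A (\<lambda>j. \<phi> (y i [^] j) v) {..<s}) {..<?r}"
    using prod_cyclic_eq_one y v by (intro A.finprod_one_eqI[symmetric]) auto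
  \<comment> \<open>Each row, taken over the powers of one \<open>y i\<close>, is trivial. After the
    exchange all columns except \<open>j = 0\<close> are trivial too, and that column consists of
    \<open>ord x\<close> copies of \<open>v\<close>.\<close>
  also have "\<dots> = finprod A (\<lambda>j. finprod A (\<lambda>i. \<phi> (y i [^] j) v) {..<?r}) {..<s}"
    by (rule A.finprod_swap_lessThan) (use y v in auto)
  also have "\<dots> = finprod A (\<lambda>i. \<phi> (y i [^] (0::nat)) v) {..<?r}
      \<otimes>\<^bsub>A\<^esub> finprod A (\<lambda>j. finprod A (\<lambda>i. \<phi> (y i [^] j) v) {..<?r}) ({..<s} - {0})"
  proof -
    have "{..<s} = insert 0 ({..<s} - {0})" using s by auto
    then show ?thesis
      using y v A.finprod_insert[of "{..<s} - {0}" 0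
          "\<lambda>j. finprod A (\<lambda>i. \<phi> (y i [^] j) v) {..<?r}"]
      by (simp add: Pi_def)
  qed
  also have "finprod A (\<lambda>j. finprod A (\<lambda>i. \<phi> (y i [^] j) v) {..<?r}) ({..<s} - {0}) = \<one>\<^bsub>A\<^esub>"
    by (rule A.finprod_one_eqI) (use inner in simp)
  also have "finprod A (\<lambda>i. \<phi> (y i [^] (0::nat)) v) {..<?r} = v [^]\<^bsub>A\<^esub> ?r"
    using A.finprod_const[OF v, of "{..<?r}"] act_one v by simp
  finally show ?thesis using v by simp
qed

text \<open>The product of \<open>v\<close> and its image is fixed by \<open>z\<close>, which swaps
  the two factors, and is therefore trivial.\<close>

lemma involution_inverts:
  assumes z: "z \<in> carrier K" "z \<noteq> \<one>" "z \<otimes> z = \<one>" and v: "v \<in> carrier A"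
  shows "\<phi> z v = inv\<^bsub>A\<^esub> v"
proof -
  have "\<phi> z (v \<otimes>\<^bsub>A\<^esub> \<phi> z v) = \<phi> z v \<otimes>\<^bsub>A\<^esub> \<phi> z (\<phi> z v)"
    using group_hom.hom_mult[OF act_group_hom] z v by simp
  also have "\<dots> = v \<otimes>\<^bsub>A\<^esub> \<phi> z v"
    using act_mult[of z z v] z v act_one A.m_comm by simp
  finally have "v \<otimes>\<^bsub>A\<^esub> \<phi> z v = \<one>\<^bsub>A\<^esub>" using fpf[of z "v \<otimes>\<^bsub>A\<^esub> \<phi> z v"] z v by simp
  then show ?thesis using z v by (metis A.inv_equality A.m_comm act_closed)
qed

text \<open>All involutions act as inversion, and the action is faithful.\<close>

lemma involution_unique:
  assumes "z \<in> carrier K" "z \<noteq> \<one>" "z \<otimes> z = \<one>" "y \<in> carrier K" "y \<noteq> \<one>" "y \<otimes> y = \<one>"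
  shows "y = z"
  by (rule act_eqI) (use assms involution_inverts in auto)

lemma involution_central:
  assumes z: "z \<in> carrier K" "z \<noteq> \<one>" "z \<otimes> z = \<one>" and u: "u \<in> carrier K"
  shows "z \<otimes> u = u \<otimes> z"
proof -
  have "cj u z \<noteq> \<one>" using z u cj_eq_iff[of u z \<one>] by auto
  moreover have "cj u z \<otimes> cj u z = \<one>"
    using cj_mult[of u z z] z u by (simp add: cj_def)
  ultimately have "cj u z = z" using involution_unique z u by simp
  then show ?thesis using cj_eq_self_iff z u by simp
qed

end

text \<open>What the Magnus property of the whole group says about a minimal normal subgroup: its
  nontrivial elements form at most two orbits, that of \<open>v\<close> and that of its
  inverse.\<close>

locale half_transitive_action = fpf_action +
  assumes trans: "u \<in> carrier A \<Longrightarrow> u \<noteq> \<one>\<^bsub>A\<^esub> \<Longrightarrow> v \<in> carrier A \<Longrightarrow> v \<noteq> \<one>\<^bsub>A\<^esub> \<Longrightarrow>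
    \<exists>g\<in>carrier K. u = \<phi> g v \<or> u = \<phi> g (inv\<^bsub>A\<^esub> v)"
begin

lemma act_inv: "g \<in> carrier K \<Longrightarrow> v \<in> carrier A \<Longrightarrow> \<phi> g (inv\<^bsub>A\<^esub> v) = inv\<^bsub>A\<^esub> (\<phi> g v)"
  using group_hom.hom_inv[OF act_group_hom] by simp

text \<open>Nontrivial orbits are regular, of size |K|. Those of \<open>v\<close> and of its inverse
  coincide or are disjoint. In the disjoint case \<open>K\<close> has no involution, because an
  involution would take \<open>v\<close> to its inverse, so |K| is odd.\<close>

lemma card_A_cases:
  "card (carrier A) = card (carrier K) + 1 \<or>
   odd (card (carrier K)) \<and> card (carrier A) = 2 * card (carrier K) + 1"
proof -
  obtain v where v: "v \<in> carrier A" "v \<noteq> \<one>\<^bsub>A\<^esub>" using ex_nontriv by blast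
  define O1 where "O1 = (\<lambda>g. \<phi> g v) ` carrier K"
  define O2 where "O2 = m_inv A ` O1"
  have O1c: "O1 \<subseteq> carrier A - {\<one>\<^bsub>A\<^esub>}" unfolding O1_def using v act_eq_one_iff by auto
  have O2c: "O2 \<subseteq> carrier A - {\<one>\<^bsub>A\<^esub>}" unfolding O2_def using O1c by (auto simp: subset_iff)
  have fO: "finite O1" "finite O2" unfolding O1_def O2_def using finite_K by auto
  have cO1: "card O1 = card (carrier K)" unfolding O1_def
    by (rule card_image) (use act_inj v in \<open>auto intro!: inj_onI\<close>)
  have cO2: "card O2 = card (carrier K)" unfolding O2_def cO1[symmetric]
    by (rule card_image) (use O1c in \<open>auto intro!: inj_onI simp: subset_iff\<close>)
  have un: "carrier A - {\<one>\<^bsub>A\<^esub>} = O1 \<union> O2"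
  proof
    show "O1 \<union> O2 \<subseteq> carrier A - {\<one>\<^bsub>A\<^esub>}" using O1c O2c by blast
    show "carrier A - {\<one>\<^bsub>A\<^esub>} \<subseteq> O1 \<union> O2"
    proof
      fix u assume "u \<in> carrier A - {\<one>\<^bsub>A\<^esub>}"
      then obtain g where "g \<in> carrier K" "u = \<phi> g v \<or> u = inv\<^bsub>A\<^esub> (\<phi> g v)"
        using trans[OF _ _ v, of u] act_inv v(1) by auto
      then show "u \<in> O1 \<union> O2" unfolding O1_def O2_def by blast
    qed
  qed
  have cA: "card (carrier A) = card (carrier A - {\<one>\<^bsub>A\<^esub>}) + 1"
    using finite_A A.one_closed by (metis Suc_eq_plus1 card_Suc_Diff1)
  show ?thesis
  proof (cases "O1 \<inter> O2 = {}")
    case True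
    have "odd (card (carrier K))"
    proof
      assume "even (card (carrier K))"
      then obtain z where z: "z \<in> carrier K" "z \<noteq> \<one>" "z [^] (2::nat) = \<one>"
        using cauchy[OF finite_K, of 2] unfolding order_def by auto
      then have "\<phi> z v = inv\<^bsub>A\<^esub> v" using involution_inverts v by (simp add: numeral_2_eq_2)
      then have "inv\<^bsub>A\<^esub> v \<in> O1" unfolding O1_def using z by (metis imageI)
      moreover have "inv\<^bsub>A\<^esub> v \<in> O2" unfolding O2_def O1_def using v act_one
        by (metis imageI one_closed)
      ultimately show False using True by blast
    qed
    then show ?thesis using cA un True fO cO1 cO2 by (simp add: card_Un_disjoint)
  next
    case False
    then obtain g h where gh: "g \<in> carrier K" "h \<in> carrier K" "\<phi> g v = inv\<^bsub>A\<^esub> (\<phi> h v)"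
      unfolding O1_def O2_def by auto
    have "O2 \<subseteq> O1"
    proof
      fix u assume "u \<in> O2"
      then obtain k where k: "k \<in> carrier K" "u = inv\<^bsub>A\<^esub> (\<phi> k v)" unfolding O1_def O2_def by auto
      have "\<phi> (k \<otimes> inv h \<otimes> g) v = \<phi> k (\<phi> (inv h) (\<phi> g v))"
        using k gh v act_mult by (simp add: m_assoc)
      also have "\<dots> = u" using k gh v act_inv act_inv_cancel by simp
      finally show "u \<in> O1" unfolding O1_def using k gh by blast
    qed
    then show ?thesis using cA un cO1 by (simp add: Un_absorb2)
  qed
qed

text \<open>In both cases of \<open>card_A_cases\<close> the order of \<open>A\<close> is 1 plus a
  multiple of that of \<open>K\<close>, so a divisor of |K| is coprime to |A| and cannot be an
  exponent of \<open>A\<close>.\<close>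

lemma odd_exponent_trivial:
  assumes "r dvd card (carrier K)" "\<And>v. v \<in> carrier A \<Longrightarrow> v [^]\<^bsub>A\<^esub> r = \<one>\<^bsub>A\<^esub>"
  shows False
proof -
  have "coprime r (card (carrier A))"
  proof (rule coprimeI)
    fix c assume c: "c dvd r" "c dvd card (carrier A)"
    then have "c dvd card (carrier K)" using assms dvd_trans by blast
    then show "is_unit c"
      using card_A_cases c(2) by (metis dvd_add_right_iff dvd_mult)
  qed
  obtain v where v: "v \<in> carrier A" "v \<noteq> \<one>\<^bsub>A\<^esub>" using ex_nontriv by blast
  have "A.ord v dvd r" using A.pow_eq_id[OF v(1), of r] assms(2)[OF v(1)] by simp
  moreover have "A.ord v dvd card (carrier A)" using A.ord_dvd_group_order v by (simp add: order_def)
  ultimately have "A.ord v = 1" using \<open>coprime r (card (carrier A))\<close> coprime_common_divisor_nat by blast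
  then show False using A.ord_eq_1 v by simp
qed

lemma card_A_even: "even (card (carrier K)) \<Longrightarrow> card (carrier A) = card (carrier K) + 1"
  using card_A_cases by blast

text \<open>Otherwise \<open>x\<close> and \<open>y\<close> span an elementary abelian group of
  order \<open>s^2\<close>. Besides the powers of \<open>x\<close> it consists of the nontrivial
  powers of the \<open>s\<close> elements \<open>x [^] i \<otimes> y\<close>, whose
  \<open>j\<close>-th powers fill the coset of \<open>y [^] j\<close>. This is the configuration of
  \<open>coset_partition_exponent\<close>, so \<open>s\<close> would be an exponent of
  \<open>A\<close>.\<close>

lemma commuting_prime_order:
  assumes s: "Factorial_Ring.prime s" and x: "x \<in> carrier K" "ord x = s"
    and y: "y \<in> carrier K" "y [^] s = \<one>" and comm: "x \<otimes> y = y \<otimes> x"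
  shows "y \<in> generate K {x}"
proof (rule ccontr)
  assume nin: "y \<notin> generate K {x}"
  have xne: "x \<noteq> \<one>" using x s by (metis ord_id not_prime_1)
  have nin': "y \<noteq> x [^] (k::int)" for k using nin mem_generate_iff[OF x(1)] by auto
  have "v [^]\<^bsub>A\<^esub> ord x = \<one>\<^bsub>A\<^esub>" if v: "v \<in> carrier A" for v
  proof (rule coset_partition_exponent[where y = "\<lambda>i. x [^] i \<otimes> y" and g = "\<lambda>j. y [^] j" and s = s])
    show "0 < s" using prime_gt_0_nat[OF s] .
    have c1: "(x [^] i) \<otimes> y = y \<otimes> (x [^] i)" for i :: nat
      using commute_nat_pow[of y x i] x y comm by simp
    have pw: "(x [^] i \<otimes> y) [^] j = y [^] j \<otimes> x [^] (i * j)" for i j :: nat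
    proof -
      have "(x [^] i \<otimes> y) [^] j = (x [^] i) [^] j \<otimes> y [^] j"
        using pow_mult_distrib[OF c1] x y by simp
      also have "\<dots> = x [^] (i * j) \<otimes> y [^] j" using x by (simp add: nat_pow_pow)
      also have "\<dots> = y [^] j \<otimes> x [^] (i * j)"
        using commute_nat_pow[of "x [^] (i * j)" y j] commute_nat_pow[of y x "i * j"] x y comm by simp
      finally show ?thesis .
    qed
    fix i assume "i < ord x"
    have "x [^] i \<otimes> y \<noteq> \<one>"
    proof
      assume "x [^] i \<otimes> y = \<one>"
      then have "y = x [^] (- int i)"
        using x y by (metis c1 int_pow_int int_pow_neg inv_equality nat_pow_closed)
      then show False using nin' by blast
    qed
    moreover have "(x [^] i \<otimes> y) [^] s = \<one>"
      unfolding pw using x y pow_eq_id[OF x(1), of "i * s"] by simp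
    ultimately show "x [^] i \<otimes> y \<in> carrier K \<and> x [^] i \<otimes> y \<noteq> \<one> \<and> (x [^] i \<otimes> y) [^] s = \<one>"
      using x y by simp
    fix j assume "0 < j" "j < s"
    show "\<exists>k::int. (x [^] i \<otimes> y) [^] j = y [^] j \<otimes> x [^] k"
      unfolding pw by (metis int_pow_int)
  next
    fix j assume j: "0 < j" "j < s"
    have c1: "(x [^] i) \<otimes> y = y \<otimes> (x [^] i)" for i :: nat
      using commute_nat_pow[of y x i] x y comm by simp
    have pw: "(x [^] i \<otimes> y) [^] j = x [^] (i * j) \<otimes> y [^] j" for i :: nat
      using pow_mult_distrib[OF c1, of i j] x y by (simp add: nat_pow_pow)
    show "inj_on (\<lambda>i. (x [^] i \<otimes> y) [^] j) {..<ord x}"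
    proof (rule inj_onI)
      fix i i' assume ii: "i \<in> {..<ord x}" "i' \<in> {..<ord x}" "(x [^] i \<otimes> y) [^] j = (x [^] i' \<otimes> y) [^] j"
      then have "x [^] (i * j) = x [^] (i' * j)" unfolding pw using x y by simp
      then have "x [^] (int (i * j)) = x [^] (int (i' * j))" unfolding int_pow_int .
      then have "int s dvd int (i' * j) - int (i * j)" using int_pow_eq[OF x(1)] x by simp
      then have "int s dvd (int i' - int i) * int j" by (simp add: left_diff_distrib)
      then have "int s dvd int i' - int i"
        using s j prime_dvd_multD[of "int s" "int i' - int i" "int j"] nat_dvd_not_less[of j s]
        by auto
      then show "i = i'" using ii x dvd_imp_le_int[of "int i' - int i" "int s"] by (cases "i' = i") auto
    qed
  qed (use x xne y v in auto)
  then show False using odd_exponent_trivial[of s] x ord_dvd_group_order[OF x(1)]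
    by (simp add: order_def)
qed

text \<open>Otherwise the conjugates of \<open>g\<close> under powers of \<open>x\<close> are all
  different, and so are their \<open>j\<close>-th powers; as \<open>g\<close> normalises
  \<open>generate K {x}\<close>, these fill the coset of \<open>g [^] j\<close>. Again
  \<open>coset_partition_exponent\<close> gives \<open>A\<close> an exponent dividing |K|.\<close>

lemma prime_order_normalizing:
  assumes r: "Factorial_Ring.prime r" and s: "Factorial_Ring.prime s"
    and x: "x \<in> carrier K" "ord x = r" and g: "g \<in> carrier K" "ord g = s"
    and norm: "cj g x = x [^] (c::int)"
  shows "x \<otimes> g = g \<otimes> x"
proof (rule ccontr)
  assume nc: "x \<otimes> g \<noteq> g \<otimes> x"
  have xne: "x \<noteq> \<one>" using x r by (metis ord_id not_prime_1)
  have gne: "g \<noteq> \<one>" using g s by (metis ord_id not_prime_1)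
  define y where "y i = cj (x [^] (- int i)) g" for i
  have yc: "y i \<in> carrier K" for i unfolding y_def using x g by simp
  have ypow: "y i [^] j = cj (x [^] (- int i)) (g [^] j)" for i j :: nat
    unfolding y_def using cj_nat_pow x g by simp
  have "v [^]\<^bsub>A\<^esub> ord x = \<one>\<^bsub>A\<^esub>" if v: "v \<in> carrier A" for v
  proof (rule coset_partition_exponent[where y = y and g = "\<lambda>j. g [^] j" and s = s])
    show "0 < s" using prime_gt_0_nat[OF s] .
    fix i assume "i < ord x"
    have "y i \<noteq> \<one>"
      unfolding y_def using cj_eq_iff[of "x [^] (- int i)" g \<one>] x g gne by auto
    moreover have "y i [^] s = \<one>"
      unfolding ypow using g x pow_ord_eq_1[OF g(1)] by (simp add: cj_def)
    ultimately show "y i \<in> carrier K \<and> y i \<noteq> \<one> \<and> y i [^] s = \<one>" using yc by simp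
    fix j assume "0 < j" "j < s"
    have nj: "cj (g [^] j) (x [^] i) = x [^] (c ^ j * int i)"
    proof -
      have "cj (g [^] j) (x [^] i) = cj (g [^] j) x [^] i" using cj_nat_pow g x by simp
      also have "\<dots> = (x [^] (c ^ j)) [^] i" using cj_pow_left[OF g(1) x(1) norm] by simp
      also have "\<dots> = x [^] (c ^ j * int i)" using x int_pow_pow[OF x(1), of "c ^ j" "int i"]
        unfolding int_pow_int by simp
      finally show ?thesis .
    qed
    have "y i [^] j = x [^] i \<otimes> g [^] j \<otimes> x [^] (- int i)"
      unfolding ypow cj_def using x g by (simp add: int_pow_neg int_pow_int)
    also have "x [^] i \<otimes> g [^] j = g [^] j \<otimes> x [^] (c ^ j * int i)"
      using nj cj_eq_iff x g by simp
    finally have "y i [^] j = g [^] j \<otimes> x [^] (c ^ j * int i - int i)"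
      using x g int_pow_mult[OF x(1), of "c ^ j * int i" "- int i"] by (simp add: m_assoc)
    then show "\<exists>k::int. y i [^] j = g [^] j \<otimes> x [^] k" by blast
  next
    fix j assume j: "0 < j" "j < s"
    show "inj_on (\<lambda>i. y i [^] j) {..<ord x}"
    proof (rule inj_onI)
      fix i i' assume ii: "i \<in> {..<ord x}" "i' \<in> {..<ord x}" "y i [^] j = y i' [^] j"
      show "i = i'"
      proof (rule ccontr)
        assume ne: "i \<noteq> i'"
        \<comment> \<open>Conjugating both sides by \<open>x [^] i\<close> turns the equality into
          commutation of \<open>g [^] j\<close> with \<open>x [^] d\<close>. As \<open>r\<close>
          does not divide \<open>d\<close> and \<open>s\<close> does not divide \<open>j\<close>,
          Bezout recovers \<open>x\<close> and \<open>g\<close> from these powers.\<close>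
        define d where "d = int i - int i'"
        have "cj (x [^] int i) (y i [^] j) = g [^] j" "cj (x [^] int i) (y i' [^] j) = cj (x [^] d) (g [^] j)"
          unfolding ypow d_def using x g cj_cj int_pow_mult[OF x(1)]
          by (simp_all add: int_pow_mult[symmetric] del: int_pow_int)
        then have comm: "g [^] j \<otimes> x [^] d = x [^] d \<otimes> g [^] j"
          using cj_eq_self_iff x g ii by simp
        have "\<not> int r dvd d" using ne ii x dvd_imp_le_int[of d "int r"] unfolding d_def by auto
        then have "coprime d (int r)" using r prime_imp_coprime[of "int r" d] by (simp add: coprime_commute)
        then obtain k l where "k * d + l * int r = 1" using bezout_int[of d "int r"] by auto
        then have "1 - d * k = int r * l" by (simp add: algebra_simps)
        then have kx: "(x [^] d) [^] k = x" using int_pow_eq[OF x(1), of "d * k" 1] x by (simp add: int_pow_pow)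
        have comm2: "g [^] j \<otimes> x = x \<otimes> g [^] j"
          using commute_int_pow[OF _ _ comm, of k] kx x g by simp
        have "\<not> int s dvd int j" using j by (auto dest: zdvd_imp_le)
        then have "coprime (int j) (int s)" using s prime_imp_coprime[of "int s" "int j"] by (simp add: coprime_commute)
        then obtain k l where "k * int j + l * int s = 1" using bezout_int[of "int j" "int s"] by auto
        then have "1 - int j * k = int s * l" by (simp add: algebra_simps)
        then have "(g [^] int j) [^] k = g"
          using int_pow_eq[OF g(1), of "int j * k" 1] g by (simp add: int_pow_pow del: int_pow_int)
        then have "x \<otimes> g = g \<otimes> x"
          using commute_int_pow[of x "g [^] j" k] comm2 x g by (simp add: int_pow_int)
        then show False using nc by simp
      qed
    qed
  qed (use x xne g v in auto)
  then show False using odd_exponent_trivial[of r] x ord_dvd_group_order[OF x(1)]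
    by (simp add: order_def)
qed

end

section \<open>The order of a point stabiliser\<close>

context group
begin

lemma int_nat_pow: "x \<in> carrier G \<Longrightarrow> (x [^] (i::int)) [^] (n::nat) = x [^] (i * int n)"
  using int_pow_pow[of x i "int n"] by (simp add: int_pow_int)

lemma nat_int_pow: "x \<in> carrier G \<Longrightarrow> (x [^] (n::nat)) [^] (i::int) = x [^] (int n * i)"
  using int_pow_pow[of x "int n" i] by (simp add: int_pow_int)

lemma pow_recover:
  assumes x: "x \<in> carrier G" and "coprime (d::int) (int (ord x))"
  obtains k :: int where "(x [^] d) [^] k = x"
proof -
  obtain k l where "k * d + l * int (ord x) = 1" using bezout_int[of d "int (ord x)"] assms by auto
  then have "1 - d * k = int (ord x) * l" by (simp add: algebra_simps)
  then show thesis using that[of k] int_pow_eq[OF x, of "d * k" 1] x by (simp add: int_pow_pow)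
qed

lemma int_pow_eqI:
  "x \<in> carrier G \<Longrightarrow> int (ord x) dvd n - m \<Longrightarrow> x [^] m = x [^] n"
  using int_pow_eq by simp

lemma mem_generate_self: "x \<in> carrier G \<Longrightarrow> x \<in> generate G {x}"
  by (simp add: generate.incl)

lemma commute_generate:
  assumes "x \<in> carrier G" "y \<in> generate G {x}"
  shows "x \<otimes> y = y \<otimes> x"
  using assms commute_int_pow[of x x] mem_generate_iff by auto

end

lemma prime_coprime_int:
  assumes "Factorial_Ring.prime (r::nat)" "\<not> int r dvd d"
  shows "coprime d (int r)"
  using assms prime_imp_coprime[of "int r" d] by (simp add: coprime_commute)

lemma one_plus_power_mod_sq:
  fixes x :: int
  obtains q where "(1 + x) ^ m = 1 + int m * x + x ^ 2 * q"
proof -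
  have "\<exists>q. (1 + x) ^ m = 1 + int m * x + x ^ 2 * q"
  proof (induction m)
    case (Suc m)
    then obtain q where "(1 + x) ^ m = 1 + int m * x + x ^ 2 * q" by blast
    then have "(1 + x) ^ Suc m = 1 + int (Suc m) * x + x ^ 2 * (int m + q + x * q)"
      by (simp add: algebra_simps power2_eq_square)
    then show ?case by blast
  qed (rule exI[of _ 0], simp)
  then show thesis using that by blast
qed

text \<open>To first order the sum is \<open>s + t * s * (0 + ... + (n - 1))\<close>, and for odd
  \<open>n\<close> the inner sum is \<open>n\<close> times the integer \<open>(n - 1) / 2\<close>, a
  multiple of \<open>s\<close>.\<close>

lemma geometric_sum_mod_sq:
  fixes s t :: int
  assumes "odd n" "s = int n"
  shows "s ^ 2 dvd (\<Sum>j<n. (1 + t * s) ^ j) - s"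
proof -
  define q where "q j = (SOME q. (1 + t * s) ^ j = 1 + int j * (t * s) + (t * s) ^ 2 * q)" for j
  have q: "(1 + t * s) ^ j = 1 + int j * (t * s) + (t * s) ^ 2 * q j" for j
    unfolding q_def by (rule someI_ex) (metis one_plus_power_mod_sq)
  obtain k where k: "n = 2 * k + 1" using assms oddE by blast
  have "(\<Sum>j<n. int j) = s * int k"
  proof -
    have "2 * (\<Sum>j<m. int j) = int m * (int m - 1)" for m
      by (induction m) (auto simp: algebra_simps)
    from this[of n] show ?thesis using k assms(2) by simp
  qed
  then have "(\<Sum>j<n. (1 + t * s) ^ j) = s + s ^ 2 * (t * int k + t ^ 2 * (\<Sum>j<n. q j))"
    unfolding q using assms(2)
    by (simp add: sum.distrib sum_distrib_left[symmetric] sum_distrib_right[symmetric]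
        power_mult_distrib algebra_simps power2_eq_square)
  then show ?thesis by simp
qed

lemma dvd_24I:
  fixes n :: nat
  assumes pos: "n > 0" and primes: "\<And>p. Factorial_Ring.prime p \<Longrightarrow> p dvd n \<Longrightarrow> p = 2 \<or> p = 3"
    and "\<not> 9 dvd n" "\<not> 16 dvd n"
  shows "n dvd 24"
proof -
  obtain m where m: "n = 2 ^ multiplicity 2 n * m" "\<not> 2 dvd m"
    using multiplicity_decompose'[of n 2] pos by auto
  obtain k where k: "m = 3 ^ multiplicity 3 m * k" "\<not> 3 dvd k"
    using multiplicity_decompose'[of m 3] m pos by auto
  let ?a = "multiplicity 2 n" and ?b = "multiplicity 3 m"
  have "k = 1"
  proof (rule ccontr)
    assume "k \<noteq> 1"
    then obtain p where p: "Factorial_Ring.prime p" "p dvd k" using prime_factor_nat by blast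
    then have "p dvd n" using k m by (metis dvd_mult)
    then show False using primes p k m by (metis dvd_mult)
  qed
  moreover have "?b \<le> 1"
  proof (rule ccontr)
    assume "\<not> ?b \<le> 1"
    then have "(3::nat) ^ 2 dvd 3 ^ ?b" by (intro le_imp_power_dvd) simp
    then have "3 ^ 2 dvd m" using k by (metis dvd_mult2)
    then have "9 dvd m" by simp
    then show False using assms m by (metis dvd_mult)
  qed
  moreover have "?a \<le> 3"
  proof (rule ccontr)
    assume "\<not> ?a \<le> 3"
    then have "(2::nat) ^ 4 dvd 2 ^ ?a" by (intro le_imp_power_dvd) simp
    then have "2 ^ 4 dvd n" using m by (metis dvd_mult2)
    then show False using assms by simp
  qed
  ultimately have "n dvd 2 ^ 3 * 3 ^ 1"
    using m k by (metis le_imp_power_dvd mult.right_neutral mult_dvd_mono)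
  then show ?thesis by simp
qed

text \<open>The complement is a quotient of the whole group and inherits its Magnus
  property.\<close>

locale MP_action = half_transitive_action +
  assumes MP_K: "MP K"
begin

lemma ord_pos: "x \<in> carrier K \<Longrightarrow> ord x > 0"
  using ord_ge_1[OF finite_K] by force

lemma ord_div:
  assumes "x \<in> carrier K" "d dvd ord x"
  shows "ord (x [^] (ord x div d)) = d"
proof -
  obtain e where e: "ord x = d * e" using assms by auto
  have "d > 0" "e > 0" using ord_pos[OF assms(1)] e by auto
  then show ?thesis using ord_pow[OF assms(1), of e] e by simp
qed

text \<open>If \<open>u\<close> normalises \<open>\<langle>h\<rangle>\<close> without centralising it, a power of \<open>u\<close> must enter \<open>\<langle>h\<rangle>\<close> immediately,
  since otherwise dividing it by a root in \<open>\<langle>h\<rangle>\<close> gives a second subgroup of order \<open>s\<close>.\<close>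

lemma root_in_cyclic:
  assumes s: "Factorial_Ring.prime s" and h: "h \<in> carrier K" "ord h = s ^ e" "e \<ge> 1"
    and u: "u \<in> carrier K" "u [^] (s ^ f) = \<one>"
    and comm_w: "u \<otimes> h [^] (s ^ (e - 1)) = h [^] (s ^ (e - 1)) \<otimes> u"
    and ncomm: "h \<otimes> u \<noteq> u \<otimes> h" and comm_s: "h \<otimes> u [^] s = u [^] s \<otimes> h"
  obtains l :: int where "u [^] s = h [^] (int s * l)" "\<And>i::int. (u \<otimes> h [^] i) [^] s \<noteq> \<one>"
proof -
  \<comment> \<open>A generator of the subgroup of order \<open>s\<close> in
    \<open>generate K {h}\<close>; by hypothesis \<open>u\<close> centralises it.\<close>
  define w where "w = h [^] (s ^ (e - 1))"
  have sp: "s > 0" using prime_gt_0_nat[OF s] .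
  have wc: "w \<in> carrier K" unfolding w_def using h by simp
  have "s ^ e = s ^ (e - 1) * s" using h(3) by (metis Suc_diff_1 less_le_trans power_Suc2 zero_less_one)
  then have ord_w: "ord w = s"
    unfolding w_def using ord_pow[OF h(1), of "s ^ (e - 1)"] h(2) sp by simp
  have hH: "h [^] (k::int) \<in> generate K {h}" for k using mem_generate_iff[OF h(1)] by blast
  interpret H: subgroup "generate K {h}" K using generate_is_subgroup h by simp
  have comm_uw: "w \<otimes> u = u \<otimes> w" using comm_w unfolding w_def by simp
  have comm_hw: "w \<otimes> h = h \<otimes> w" unfolding w_def using commute_nat_pow[of h h] h by simp
  \<comment> \<open>By \<open>commuting_prime_order\<close> an \<open>s\<close>-th root of the
    identity that commutes with \<open>w\<close> is a power of \<open>w\<close>, so it lies in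
    \<open>generate K {h}\<close>.\<close>
  have root: "g \<in> generate K {h}" if "g \<in> carrier K" "g [^] s = \<one>" "w \<otimes> g = g \<otimes> w" for g
  proof -
    have "g \<in> generate K {w}" using commuting_prime_order[OF s wc ord_w] that by simp
    then obtain k :: int where "g = w [^] k" using mem_generate_iff[OF wc] by blast
    then show ?thesis unfolding w_def using nat_int_pow[OF h(1)] hH by simp
  qed
  have u_nin: "u \<notin> generate K {h}" using commute_generate h ncomm by blast
  define k where "k = (LEAST k. u [^] (s ^ k) \<in> generate K {h})"
  have kin: "u [^] (s ^ k) \<in> generate K {h}"
    unfolding k_def by (rule LeastI[of _ f]) (use u H.one_closed in simp)
  have kmin: "u [^] (s ^ j) \<notin> generate K {h}" if "j < k" for j
    using not_less_Least that unfolding k_def by blast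
  have "k \<noteq> 0" using kin u_nin u by (intro notI) simp
  define y where "y = u [^] (s ^ (k - 1))"
  have yc: "y \<in> carrier K" unfolding y_def using u by simp
  have y_nin: "y \<notin> generate K {h}" unfolding y_def using kmin \<open>k \<noteq> 0\<close> by simp
  have "s ^ (k - 1) * s = s ^ k" using \<open>k \<noteq> 0\<close> by (metis Suc_diff_1 neq0_conv power_Suc2)
  then have ys: "y [^] s = u [^] (s ^ k)" unfolding y_def using u by (simp add: nat_pow_pow)
  then obtain l where l: "y [^] s = h [^] (l::int)" using kin mem_generate_iff[OF h(1)] by auto
  have comm_uys: "u \<otimes> y [^] s = y [^] s \<otimes> u" unfolding ys using commute_nat_pow[of u u] u by simp
  \<comment> \<open>Otherwise \<open>y [^] s\<close> would be a generator of
    \<open>generate K {h}\<close>; \<open>u\<close> commutes with it, hence would commute with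
    \<open>h\<close>.\<close>
  have "int s dvd l"
  proof (rule ccontr)
    assume "\<not> int s dvd l"
    then have cop: "coprime l (int (ord h))" unfolding h(2) using prime_coprime_int[OF s] by simp
    obtain i :: int where "(h [^] l) [^] i = h" using pow_recover[OF h(1) cop] .
    then have "u \<otimes> h = h \<otimes> u"
      using commute_int_pow[OF u(1) _ comm_uys, of i] l yc h(1) by simp
    then show False using ncomm by simp
  qed
  then obtain l' where l': "l = int s * l'" by auto
  \<comment> \<open>If \<open>k > 1\<close>, then \<open>y\<close> is a power of
    \<open>u [^] s\<close> and commutes with \<open>h\<close>. Dividing \<open>y\<close> by
    \<open>h [^] l'\<close> would give an \<open>s\<close>-th root of the identity outside
    \<open>generate K {h}\<close>.\<close>
  have "k = 1"
  proof (rule ccontr)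
    assume "k \<noteq> 1"
    then have "k - 1 = Suc (k - 2)" using \<open>k \<noteq> 0\<close> by simp
    then have "s * s ^ (k - 2) = s ^ (k - 1)" by simp
    then have "y = (u [^] s) [^] (s ^ (k - 2))" unfolding y_def using u by (simp add: nat_pow_pow)
    then have hy: "h \<otimes> y = y \<otimes> h" using commute_nat_pow[OF h(1) _ comm_s] u by simp
    define g where "g = y \<otimes> h [^] (- l')"
    have gc: "g \<in> carrier K" unfolding g_def using yc h by simp
    have yh: "y \<otimes> h [^] (- l') = h [^] (- l') \<otimes> y" using commute_int_pow[OF yc h(1)] hy by simp
    have "g [^] s = y [^] s \<otimes> (h [^] (- l')) [^] s"
      unfolding g_def using pow_mult_distrib[OF yh] yc h by simp
    also have "\<dots> = \<one>"
      unfolding l l' int_nat_pow[OF h(1)] using h int_pow_mult[OF h(1), of "int s * l'" "- l' * int s"]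
      by (simp add: algebra_simps)
    finally have "g [^] s = \<one>" .
    moreover have "w \<otimes> g = g \<otimes> w" unfolding g_def
    proof (rule commute_mult)
      show "w \<otimes> y = y \<otimes> w" unfolding y_def using commute_nat_pow[OF wc u(1) comm_uw] .
      show "w \<otimes> h [^] (- l') = h [^] (- l') \<otimes> w" using commute_int_pow[OF wc h(1) comm_hw] .
    qed (use wc yc h in auto)
    ultimately have "g \<in> generate K {h}" using root gc by blast
    then have "g \<otimes> h [^] l' \<in> generate K {h}" using hH by blast
    moreover have "g \<otimes> h [^] l' = y" unfolding g_def using yc h
      by (simp add: m_assoc int_pow_mult[symmetric])
    ultimately show False using y_nin by simp
  qed
  then have "u [^] s = h [^] (int s * l')" using l l' ys by simp
  \<comment> \<open>\<open>u \<otimes> h [^] i\<close> commutes with \<open>w\<close> and lies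
    outside \<open>generate K {h}\<close>, because \<open>u\<close> does.\<close>
  moreover have "(u \<otimes> h [^] i) [^] s \<noteq> \<one>" for i :: int
  proof
    assume "(u \<otimes> h [^] i) [^] s = \<one>"
    moreover have "w \<otimes> (u \<otimes> h [^] i) = (u \<otimes> h [^] i) \<otimes> w"
      using commute_mult[OF wc u(1) _ comm_uw] commute_int_pow[OF wc h(1) comm_hw] h by simp
    ultimately have "u \<otimes> h [^] i \<in> generate K {h}" using root u h by simp
    then have "(u \<otimes> h [^] i) \<otimes> h [^] (- i) \<in> generate K {h}" using hH by blast
    moreover have "(u \<otimes> h [^] i) \<otimes> h [^] (- i) = u"
      using u h by (simp add: m_assoc int_pow_mult[symmetric])
    ultimately show False using u_nin by simp
  qed
  ultimately show thesis using that by blast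
qed

text \<open>Conjugacy of \<open>h\<close> to \<open>h [^] (1 + s)\<close> up to inversion yields an
  element \<open>u\<close> of \<open>s\<close>-power order acting on \<open>h\<close> as the
  exponent \<open>1 + T s\<close> with \<open>T\<close> prime to \<open>s\<close>. If
  \<open>u [^] s = h [^] (s l)\<close>, then \<open>(u \<otimes> h [^] (- l)) [^] s\<close> is
  trivial, because the geometric sum is \<open>s\<close> modulo \<open>s^2\<close>; this contradicts
  \<open>root_in_cyclic\<close>.\<close>

lemma no_odd_prime_square_order:
  assumes s: "Factorial_Ring.prime s" "odd s" and h: "h \<in> carrier K"
  shows "ord h \<noteq> s ^ 2"
proof
  assume ord_h: "ord h = s ^ 2"
  let ?s = "int s"
  have s2: "int (ord h) = ?s ^ 2" using ord_h by simp
  have "\<not> ?s dvd 1 + ?s" using prime_gt_1_nat[OF s(1)] by (simp add: dvd_add_left_iff)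
  then have "coprime (1 + ?s) (int (ord h))"
    unfolding s2 using prime_coprime_int[OF s(1), of "1 + ?s"] by simp
  then obtain u0 where u0: "u0 \<in> carrier K" "cj u0 h = h [^] (1 + ?s) \<or> cj u0 h = h [^] (- (1 + ?s))"
    using MP_conj_pow[OF MP_K h] by metis
  \<comment> \<open>Squaring removes the sign: \<open>(1 + s)^2 = 1 + (2 + s) s\<close>, and
    \<open>s\<close>, being odd, does not divide \<open>2 + s\<close>.\<close>
  obtain u1 t where u1: "u1 \<in> carrier K" "cj u1 h = h [^] (1 + t * ?s)" "\<not> ?s dvd t"
  proof (cases "cj u0 h = h [^] (1 + ?s)")
    case True
    then show thesis using that[of u0 1] u0 prime_gt_1_nat[OF s(1)] by auto
  next
    case False
    then have "cj (u0 [^] (2::nat)) h = h [^] ((- (1 + ?s)) ^ 2)"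
      using cj_pow_left[OF u0(1) h, of "- (1 + ?s)" 2] u0 by simp
    also have "(- (1 + ?s)) ^ 2 = 1 + (2 + ?s) * ?s" by (simp add: power2_eq_square algebra_simps)
    finally have "cj (u0 [^] (2::nat)) h = h [^] (1 + (2 + ?s) * ?s)" .
    moreover have "\<not> ?s dvd 2 + ?s"
    proof
      assume "?s dvd 2 + ?s"
      then have "?s dvd 2" by (simp add: dvd_add_left_iff)
      then have "s dvd 2" by presburger
      then show False using s by (metis dvd_refl not_prime_1 primes_dvd_imp_eq two_is_prime_nat)
    qed
    ultimately show thesis using that u0 by blast
  qed
  obtain m f where mf: "\<not> s dvd m" "(u1 [^] m) [^] (s ^ f) = \<one>"
    using prime_power_part[OF finite_K u1(1) s(1)] by blast
  define u where "u = u1 [^] m"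
  \<comment> \<open>Modulo \<open>s^2\<close> the \<open>m\<close>-th power of
    \<open>1 + t s\<close> is \<open>1 + m t s\<close>.\<close>
  define T where "T = int m * t"
  have uc: "u \<in> carrier K" unfolding u_def using u1 by simp
  have T: "\<not> ?s dvd T" unfolding T_def
    using prime_dvd_multD[of ?s "int m" t] s(1) mf(1) u1(3) by auto
  have cu: "cj u h = h [^] (1 + T * ?s)"
  proof -
    obtain q where q: "(1 + t * ?s) ^ m = 1 + int m * (t * ?s) + (t * ?s) ^ 2 * q"
      using one_plus_power_mod_sq by blast
    have "cj u h = h [^] ((1 + t * ?s) ^ m)" unfolding u_def using cj_pow_left[OF u1(1) h u1(2)] .
    also have "\<dots> = h [^] (1 + T * ?s)"
      by (rule int_pow_eqI[OF h, symmetric]) (simp add: q T_def s2 power_mult_distrib)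
    finally show ?thesis .
  qed
  have ncomm: "h \<otimes> u \<noteq> u \<otimes> h"
  proof
    assume "h \<otimes> u = u \<otimes> h"
    then have "h [^] (1::int) = h [^] (1 + T * ?s)" using cj_eq_self_iff[OF uc h] cu h by simp
    then have "?s ^ 2 dvd T * ?s" using int_pow_eq[OF h] s2 by simp
    then show False using T s by (simp add: power2_eq_square)
  qed
  have comm_s: "h \<otimes> u [^] s = u [^] s \<otimes> h"
  proof -
    obtain q where q: "(1 + T * ?s) ^ s = 1 + int s * (T * ?s) + (T * ?s) ^ 2 * q"
      using one_plus_power_mod_sq by blast
    have "cj (u [^] s) h = h [^] ((1 + T * ?s) ^ s)" using cj_pow_left[OF uc h cu] .
    also have "\<dots> = h [^] (1::int)"
      by (rule int_pow_eqI[OF h, symmetric])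
         (simp add: q s2 power_mult_distrib power2_eq_square dvd_add algebra_simps)
    finally show ?thesis using cj_eq_self_iff[of "u [^] s" h] uc h by simp
  qed
  have comm_w: "u \<otimes> h [^] (s ^ (2 - 1)) = h [^] (s ^ (2 - 1)) \<otimes> u"
  proof -
    have "cj u (h [^] s) = (h [^] (1 + T * ?s)) [^] s" using cj_nat_pow[OF uc h] cu by simp
    also have "\<dots> = h [^] ?s" unfolding int_nat_pow[OF h]
      by (rule int_pow_eqI[OF h, symmetric]) (simp add: s2 power2_eq_square algebra_simps)
    finally show ?thesis using cj_eq_self_iff[of u "h [^] s"] uc h by (simp add: int_pow_int)
  qed
  obtain l where l: "u [^] s = h [^] (?s * l)" "\<And>i::int. (u \<otimes> h [^] i) [^] s \<noteq> \<one>"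
    using root_in_cyclic[OF s(1) h ord_h _ uc _ comm_w ncomm comm_s] mf(2) unfolding u_def by auto
  let ?S = "\<Sum>j<s. (1 + T * ?s) ^ j"
  have "(u \<otimes> h [^] (- l)) [^] s = h [^] (?s * l) \<otimes> h [^] (- l * ?S)"
    using twisted_power[OF uc h cu] l(1) by simp
  also have "\<dots> = h [^] (?s * l - l * ?S)"
    using int_pow_mult[OF h, of "?s * l" "- l * ?S"] by simp
  also have "\<dots> = h [^] (0::int)"
  proof (rule int_pow_eqI[OF h])
    have "?s ^ 2 dvd l * (?S - ?s)" using geometric_sum_mod_sq[OF s(2) refl, of T] by (rule dvd_mult)
    then show "int (ord h) dvd 0 - (?s * l - l * ?S)" unfolding s2 by (simp add: algebra_simps)
  qed
  finally show False using l(2)[of "- l"] by simp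
qed

text \<open>Up to sign, 5 is the only unit modulo 8 besides 1, so \<open>h\<close> would be
  conjugate to its power with exponent \<open>c = 5\<close> or \<open>c = - 5\<close>. Since
  \<open>(u \<otimes> h [^] i) [^] 2 = h [^] (2 l + i (1 + c))\<close>, the choice
  \<open>i = l\<close> makes this trivial for 5. For -5, \<open>u\<close> centralises its own square
  \<open>h [^] (2 l)\<close>, which makes \<open>l\<close> even, and \<open>i = l / 2\<close> does
  the same. Both contradict \<open>root_in_cyclic\<close>.\<close>

lemma no_order_8:
  assumes h: "h \<in> carrier K"
  shows "ord h \<noteq> 8"
proof
  assume ord_h: "ord h = 8"
  have "coprime (5::int) (int (ord h))" unfolding ord_h
  proof (rule coprimeI)
    fix c :: int assume "c dvd 5" "c dvd int 8"
    then have "c dvd 2 * int 8 - 3 * 5" by (intro dvd_diff dvd_mult)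
    then show "is_unit c" by simp
  qed
  then obtain u0 where u0: "u0 \<in> carrier K" "cj u0 h = h [^] (5::int) \<or> cj u0 h = h [^] (- 5 :: int)"
    using MP_conj_pow[OF MP_K h] by metis
  then obtain c :: int where c: "c = 5 \<or> c = - 5" "cj u0 h = h [^] c" by blast
  obtain m f :: nat where mf: "\<not> 2 dvd m" "(u0 [^] m) [^] ((2::nat) ^ f) = \<one>"
    using prime_power_part[OF finite_K u0(1) two_is_prime_nat] by blast
  define u where "u = u0 [^] m"
  have uc: "u \<in> carrier K" unfolding u_def using u0 by simp
  have c2: "8 dvd c ^ 2 - 1" using c(1) by auto
  \<comment> \<open>\<open>m\<close> is odd and \<open>c^2\<close> is 1 modulo 8, so the exponent
    \<open>c\<close> survives the passage from \<open>u0\<close> to \<open>u\<close>.\<close>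
  have cu: "cj u h = h [^] c"
  proof -
    obtain a where a: "m = 2 * a + 1" using mf(1) oddE by blast
    have "(c ^ 2) ^ a - 1 = (c ^ 2 - 1) * (\<Sum>i<a. (c ^ 2) ^ i)" by (rule power_diff_1_eq)
    then have "8 dvd (c ^ 2) ^ a - 1" using c2 by simp
    moreover have "c ^ m - c = c * ((c ^ 2) ^ a - 1)" by (simp add: a power_mult[symmetric] algebra_simps)
    ultimately have "8 dvd c ^ m - c" by simp
    then have "8 dvd c - c ^ m" by (simp add: dvd_diff_commute)
    then have "h [^] (c ^ m) = h [^] c" by (intro int_pow_eqI[OF h]) (simp add: ord_h)
    then show ?thesis unfolding u_def using cj_pow_left[OF u0(1) h c(2)] by simp
  qed
  have ncomm: "h \<otimes> u \<noteq> u \<otimes> h"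
  proof
    assume "h \<otimes> u = u \<otimes> h"
    then have "h [^] (1::int) = h [^] c" using cj_eq_self_iff[OF uc h] cu h by simp
    then show False using int_pow_eq[OF h, of 1 c] ord_h c by auto
  qed
  have comm_s: "h \<otimes> u [^] (2::nat) = u [^] (2::nat) \<otimes> h"
  proof -
    have "cj (u [^] (2::nat)) h = h [^] (c ^ 2)" using cj_pow_left[OF uc h cu] .
    also have "\<dots> = h [^] (1::int)"
      by (rule int_pow_eqI[OF h, symmetric]) (use c2 ord_h in simp)
    finally show ?thesis using cj_eq_self_iff[of "u [^] (2::nat)" h] uc h by simp
  qed
  have comm_w: "u \<otimes> h [^] ((2::nat) ^ (3 - 1)) = h [^] ((2::nat) ^ (3 - 1)) \<otimes> u"
  proof -
    have "cj u (h [^] (4::int)) = (h [^] c) [^] (4::int)" using cj_int_pow[OF uc h] cu by simp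
    also have "\<dots> = h [^] (4::int)" unfolding int_pow_pow[OF h]
      by (rule int_pow_eqI[OF h, symmetric]) (use ord_h c in auto)
    finally show ?thesis using cj_eq_self_iff[of u "h [^] (4::int)"] uc h
      using int_pow_int[of K h 4] by simp
  qed
  obtain l :: int where l: "u [^] (2::nat) = h [^] (2 * l)" "\<And>i::int. (u \<otimes> h [^] i) [^] (2::nat) \<noteq> \<one>"
    using root_in_cyclic[OF two_is_prime_nat h, of 3, OF _ _ uc _ comm_w ncomm comm_s] mf(2) ord_h
    unfolding u_def by auto
  have sq: "(u \<otimes> h [^] i) [^] (2::nat) = h [^] (2 * l + i * (1 + c))" for i :: int
    using twisted_power[OF uc h cu, of i 2] l(1) int_pow_mult[OF h]
    by (simp add: numeral_2_eq_2)
  have one: "h [^] k = \<one>" if "8 dvd k" for k :: int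
    using int_pow_eq_id[OF h] ord_h that by simp
  from c(1) show False
  proof
    assume "c = 5"
    then show False using l(2)[of l] sq[of l] one[of "2 * l + l * (1 + c)"] by simp
  next
    assume c5: "c = - 5"
    have "cj u (u [^] (2::nat)) = u [^] (2::nat)"
      using cj_eq_self_iff[of u "u [^] (2::nat)"] commute_nat_pow[of u u 2] uc by simp
    then have "h [^] (c * (2 * l)) = h [^] (2 * l)"
      unfolding l(1) using cj_int_pow[OF uc h] cu int_pow_pow[OF h] by simp
    then have "8 dvd 2 * l - c * (2 * l)" using int_pow_eq[OF h] ord_h by simp
    then have "8 dvd 12 * l" using c5 by simp
    then have "even l" by presburger
    then obtain k where k: "l = 2 * k" by blast
    then show False using l(2)[of k] sq[of k] one[of "2 * l + k * (1 + c)"] c5 by simp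
  qed
qed

text \<open>Let \<open>u\<close> conjugate \<open>x\<close> to its square up to inversion, and let
  \<open>d\<close> be the order of the automorphism that it induces on the powers of
  \<open>x\<close>. Powers of \<open>u\<close> of prime order centralise \<open>x\<close>, and
  \<open>ord u\<close> is divisible neither by the square of an odd prime nor by 8; hence
  \<open>d\<close> divides 2. So 4 is 1 modulo \<open>r\<close>.\<close>

lemma odd_prime_order_eq_3:
  assumes r: "Factorial_Ring.prime r" "odd r" and x: "x \<in> carrier K" "ord x = r"
  shows "r = 3"
proof -
  have "\<not> int r dvd 2"
  proof
    assume "int r dvd 2"
    then have "r dvd 2" by presburger
    then show False using r by (metis dvd_refl not_prime_1 primes_dvd_imp_eq two_is_prime_nat)
  qed
  then obtain u where u: "u \<in> carrier K" "cj u x = x [^] (2::int) \<or> cj u x = x [^] (- 2 :: int)"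
    using MP_conj_pow[OF MP_K x(1), of 2] prime_coprime_int[OF r(1)] x by metis
  then obtain c :: int where c: "c = 2 \<or> c = - 2" "cj u x = x [^] c" by blast
  define P where "P k \<longleftrightarrow> cj (u [^] k) x = x" for k :: nat
  have shift: "P (a + b) \<longleftrightarrow> P b" if "P a" for a b
    using cj_cj[of "u [^] a" "u [^] b" x] that u x unfolding P_def by (simp add: nat_pow_mult)
  have P0: "P 0" unfolding P_def using x by simp
  have Pord: "P (ord u)" unfolding P_def using u x by simp
  define d where "d = (LEAST k. k > 0 \<and> P k)"
  have d: "d > 0" "P d"
    using LeastI[of "\<lambda>k. k > 0 \<and> P k" "ord u"] Pord ord_pos[OF u(1)] unfolding d_def by auto
  have dmin: "\<not> (k > 0 \<and> P k)" if "k < d" for k using not_less_Least that unfolding d_def by blast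
  have d_dvd: "d dvd k" if "P k" for k
  proof -
    have "P (n * d)" for n by (induction n) (use P0 shift[OF d(2)] in auto)
    then have "P (k mod d)" using shift[of "k div d * d" "k mod d"] that by simp
    then show ?thesis using dmin[of "k mod d"] d(1) by (auto simp: mod_eq_0_iff_dvd)
  qed
  have d_ord: "d dvd ord u" using d_dvd Pord .
  \<comment> \<open>\<open>u [^] (ord u div s)\<close> has order \<open>s\<close> and centralises
    \<open>x\<close>, so \<open>d\<close> divides \<open>ord u div s\<close>; but \<open>s\<close>
    no longer divides this quotient.\<close>
  have no_odd: "s = 2" if s: "Factorial_Ring.prime s" "s dvd d" for s
  proof (rule ccontr)
    assume "s \<noteq> 2"
    then have "odd s" using s(1) primes_dvd_imp_eq two_is_prime_nat by blast
    have so: "s dvd ord u" using s d_ord dvd_trans by blast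
    have ns: "\<not> s ^ 2 dvd ord u"
      using ord_div[OF u(1), of "s ^ 2"] no_odd_prime_square_order[OF s(1) \<open>odd s\<close>] u by auto
    let ?g = "u [^] (ord u div s)"
    have "x \<otimes> ?g = ?g \<otimes> x"
      using prime_order_normalizing[OF r(1) s(1) x _ ord_div[OF u(1) so]] cj_pow_left[OF u(1) x(1) c(2)] u
      by auto
    then have "P (ord u div s)" unfolding P_def using cj_eq_self_iff u x by simp
    then have "s dvd ord u div s" using d_dvd s dvd_trans by blast
    then show False using ns so by (metis dvd_div_mult_self mult_dvd_mono dvd_refl power2_eq_square)
  qed
  \<comment> \<open>The power of \<open>u\<close> of order 2 is central, so \<open>d\<close> divides
    \<open>ord u div 2\<close>; with 4 dividing \<open>d\<close>, 8 would divide
    \<open>ord u\<close>.\<close>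
  have no4: "\<not> 4 dvd d"
  proof
    assume 4: "4 dvd d"
    then have "4 dvd ord u" using d_ord dvd_trans by blast
    then have "2 dvd ord u" by presburger
    let ?g = "u [^] (ord u div 2)"
    have og: "ord ?g = 2" using ord_div[OF u(1) \<open>2 dvd ord u\<close>] .
    then have "?g \<noteq> \<one>" by (metis ord_id numeral_eq_one_iff semiring_norm(85))
    moreover have "?g [^] (2::nat) = \<one>" using u pow_ord_eq_1[of ?g] og by simp
    ultimately have "x \<otimes> ?g = ?g \<otimes> x" using involution_central[of ?g x] u x by (simp add: numeral_2_eq_2)
    then have "P (ord u div 2)" unfolding P_def using cj_eq_self_iff u x by simp
    then have "4 dvd ord u div 2" using d_dvd 4 dvd_trans by blast
    then have "8 dvd ord u" using \<open>2 dvd ord u\<close> by presburger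
    then show False using ord_div[OF u(1), of 8] no_order_8[of "u [^] (ord u div 8)"] u(1) by simp
  qed
  have "d = 1 \<or> d = 2"
  proof (cases "even d")
    case True
    then obtain e where e: "d = 2 * e" by auto
    have "e = 1"
    proof (rule ccontr)
      assume "e \<noteq> 1"
      then obtain s where "Factorial_Ring.prime s" "s dvd e" using prime_factor_nat by blast
      then have "2 dvd e" using no_odd[of s] e by auto
      then show False using no4 e by auto
    qed
    then show ?thesis using e by simp
  next
    case False
    then have "d = 1" using prime_factor_nat[of d] no_odd by blast
    then show ?thesis by simp
  qed
  then have "P 2" using d(2) shift[of 1 1] by (auto simp: numeral_2_eq_2)
  then have "x [^] (1::int) = x [^] (c ^ 2)" unfolding P_def using cj_pow_left[OF u(1) x(1) c(2)] x by simp
  then have "int r dvd c ^ 2 - 1" using int_pow_eq[OF x(1), of 1 "c ^ 2"] x(2) by blast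
  then have "int r dvd 3" using c(1) by auto
  then have "r dvd 3" by presburger
  then show ?thesis using r(1) primes_dvd_imp_eq[of r 3] by simp
qed

end

section \<open>Subgroups of exponent 4\<close>

context fpf_action
begin

text \<open>The unique involution is \<open>z = x \<otimes> x\<close>; it is central, and every
  square in \<open>S\<close> is \<open>\<one>\<close> or \<open>z\<close>. For the square of
  \<open>x \<otimes> y\<close> this leaves only \<open>x\<close> and its inverse
  \<open>x \<otimes> z\<close> as conjugate of \<open>x\<close>. If \<open>x\<close> and
  \<open>y\<close> commute and \<open>y\<close> also squares to \<open>z\<close>, then
  \<open>x \<otimes> y\<close> squares to \<open>\<one>\<close>, so it is \<open>\<one>\<close> or
  \<open>z\<close> and \<open>y\<close> is a power of \<open>x\<close>.\<close>

lemma conj_of_order_4: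
  assumes S: "subgroup S K" and exp4: "\<And>g. g \<in> S \<Longrightarrow> g [^] (4::nat) = \<one>"
    and x: "x \<in> S" "x \<otimes> x \<noteq> \<one>" and y: "y \<in> S"
  shows "cj y x = x \<or> cj y x = x \<otimes> (x \<otimes> x)"
    and "x \<otimes> y = y \<otimes> x \<Longrightarrow> y \<in> {\<one>, x \<otimes> x, x, x \<otimes> (x \<otimes> x)}"
proof -
  interpret S: subgroup S K by fact
  have sq4: "g \<otimes> g \<otimes> (g \<otimes> g) = \<one>" if "g \<in> S" for g
  proof -
    have "g \<in> carrier K" using that S.subset by blast
    then show ?thesis using exp4[OF that] by (simp add: eval_nat_numeral m_assoc)
  qed
  define z where "z = x \<otimes> x"
  have c: "x \<in> carrier K" "y \<in> carrier K" "z \<in> carrier K" using x y S.subset unfolding z_def by auto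
  have z: "z \<noteq> \<one>" "z \<otimes> z = \<one>" unfolding z_def using x sq4 by auto
  have sq: "g \<otimes> g = \<one> \<or> g \<otimes> g = z" if "g \<in> S" for g
    using involution_unique[OF c(3) z, of "g \<otimes> g"] sq4[OF that] that S.subset by auto
  have one_or_z: "g = \<one> \<or> g = z" if "g \<in> carrier K" "g \<otimes> g = \<one>" for g
    using involution_unique[OF c(3) z, of g] that by blast
  have zcomm: "z \<otimes> g = g \<otimes> z" if "g \<in> carrier K" for g using involution_central c z that by blast
  have xz: "x \<otimes> (x \<otimes> z) = \<one>" using c z unfolding z_def by (simp add: m_assoc)
  have solve: "t = x \<or> t = x \<otimes> z" if t: "t \<in> carrier K" "x \<otimes> t = \<one> \<or> x \<otimes> t = z" for t
  proof -
    from t(2) have "x \<otimes> t = x \<otimes> (x \<otimes> z) \<or> x \<otimes> t = x \<otimes> x" using xz z_def by simp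
    then show ?thesis using t(1) c by auto
  qed
  have "cj y x = x \<or> cj y x = x \<otimes> z"
  proof -
    define t where "t = cj y x"
    have tc: "t \<in> carrier K" unfolding t_def using c by simp
    have xy: "x \<otimes> y = y \<otimes> t" unfolding t_def using cj_eq_iff[OF c(2,1), of "cj y x"] c by simp
    have "x \<otimes> y \<in> S" using x y by simp
    then have q: "x \<otimes> y \<otimes> (x \<otimes> y) = \<one> \<or> x \<otimes> y \<otimes> (x \<otimes> y) = z" by (rule sq)
    have "x \<otimes> y \<otimes> (x \<otimes> y) = x \<otimes> y \<otimes> (y \<otimes> t)" using arg_cong[OF xy] .
    also have "\<dots> = x \<otimes> (y \<otimes> y) \<otimes> t" using c tc by (simp add: m_assoc)
    also have "\<dots> = (y \<otimes> y) \<otimes> (x \<otimes> t)"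
    proof -
      have "x \<otimes> (y \<otimes> y) = (y \<otimes> y) \<otimes> x" using sq[OF y] zcomm[of x] c by auto
      then show ?thesis using m_assoc[of "y \<otimes> y" x t] c tc by simp
    qed
    finally have "(y \<otimes> y) \<otimes> (x \<otimes> t) = \<one> \<or> (y \<otimes> y) \<otimes> (x \<otimes> t) = z" using q by simp
    then have "x \<otimes> t = \<one> \<or> x \<otimes> t = z"
    proof -
      have "w = \<one> \<or> w = z" if "w \<in> carrier K" "(y \<otimes> y) \<otimes> w = \<one> \<or> (y \<otimes> y) \<otimes> w = z" for w
      proof (cases "y \<otimes> y = \<one>")
        case False
        then have "z \<otimes> w = z \<otimes> z \<or> z \<otimes> w = z \<otimes> \<one>" using that sq[OF y] z c by auto
        then show ?thesis using that(1) c by auto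
      qed (use that in simp)
      then show ?thesis using \<open>(y \<otimes> y) \<otimes> (x \<otimes> t) = \<one> \<or> (y \<otimes> y) \<otimes> (x \<otimes> t) = z\<close> c tc by simp
    qed
    then show ?thesis using solve tc unfolding t_def by blast
  qed
  then show "cj y x = x \<or> cj y x = x \<otimes> (x \<otimes> x)" unfolding z_def .
  assume xy: "x \<otimes> y = y \<otimes> x"
  have "y = \<one> \<or> y = z \<or> y = x \<or> y = x \<otimes> z"
  proof (cases "y \<otimes> y = \<one>")
    case True
    then show ?thesis using one_or_z c by blast
  next
    case False
    then have yy: "y \<otimes> y = z" using sq[OF y] by blast
    have "x \<otimes> y \<otimes> (x \<otimes> y) = x \<otimes> (y \<otimes> x) \<otimes> y" using c by (simp add: m_assoc)
    also have "\<dots> = (x \<otimes> x) \<otimes> (y \<otimes> y)" unfolding xy[symmetric] using c by (simp add: m_assoc)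
    also have "\<dots> = \<one>" unfolding yy using z z_def by simp
    finally have "x \<otimes> y \<otimes> (x \<otimes> y) = \<one>" .
    then have "x \<otimes> y = \<one> \<or> x \<otimes> y = z" using one_or_z[of "x \<otimes> y"] c by simp
    then show ?thesis using solve[OF c(2)] by blast
  qed
  then show "y \<in> {\<one>, x \<otimes> x, x, x \<otimes> (x \<otimes> x)}" unfolding z_def by blast
qed

text \<open>An element \<open>x\<close> of order 4 commutes only with its own four powers and has at
  most two conjugates, so \<open>S\<close> is covered by these powers and one coset of them. Without
  such an element the unique involution leaves at most two elements.\<close>

lemma card_exponent_4_subgroup:
  assumes S: "subgroup S K" and exp4: "\<And>g. g \<in> S \<Longrightarrow> g [^] (4::nat) = \<one>"
  shows "card S \<le> 8"
proof (cases "\<exists>x\<in>S. x \<otimes> x \<noteq> \<one>")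
  case False
  interpret S: subgroup S K by fact
  show ?thesis
  proof (cases "S \<subseteq> {\<one>}")
    case True
    then show ?thesis using card_mono[of "{\<one>}" S] by simp
  next
    case nt: False
    then obtain z where z: "z \<in> S" "z \<noteq> \<one>" by blast
    have "S \<subseteq> {\<one>, z}"
      using involution_unique[of z] z False S.subset by blast
    then have "card S \<le> card {\<one>, z}" by (intro card_mono) auto
    also have "\<dots> \<le> 2" by (simp add: card_insert_if)
    finally show ?thesis by simp
  qed
next
  case True
  interpret S: subgroup S K by fact
  obtain x where x: "x \<in> S" "x \<otimes> x \<noteq> \<one>" using True by blast
  have xc: "x \<in> carrier K" using x S.subset by blast
  let ?C = "{\<one>, x \<otimes> x, x, x \<otimes> (x \<otimes> x)}"
  have cC: "card ?C \<le> 4" by (simp add: card_insert_if)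
  obtain y0 where y0: "y0 \<in> carrier K" "S \<subseteq> ?C \<union> (\<lambda>c. c \<otimes> y0) ` ?C"
  proof (cases "\<exists>y\<in>S. x \<otimes> y \<noteq> y \<otimes> x")
    case False
    then have "S \<subseteq> ?C" using conj_of_order_4(2)[OF S exp4 x] by blast
    then show thesis using that[of \<one>] by blast
  next
    case True
    then obtain y0 where y0: "y0 \<in> S" "x \<otimes> y0 \<noteq> y0 \<otimes> x" by blast
    have y0c: "y0 \<in> carrier K" using y0 S.subset by blast
    have conj: "cj y x = x \<otimes> (x \<otimes> x)" if "y \<in> S" "x \<otimes> y \<noteq> y \<otimes> x" for y
      using conj_of_order_4(1)[OF S exp4 x that(1)] cj_eq_self_iff[of y x] that S.subset xc by blast
    have "S \<subseteq> ?C \<union> (\<lambda>c. c \<otimes> y0) ` ?C"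
    proof
      fix y assume y: "y \<in> S"
      have yc: "y \<in> carrier K" using y S.subset by blast
      show "y \<in> ?C \<union> (\<lambda>c. c \<otimes> y0) ` ?C"
      proof (cases "x \<otimes> y = y \<otimes> x")
        case True
        then show ?thesis using conj_of_order_4(2)[OF S exp4 x y] by blast
      next
        case False
        have "cj (inv y0) (cj y x) = x"
          using conj[OF y False] conj[OF y0] cj_cj[OF y0c _ xc, of "inv y0"] y0c xc by simp
        then have "cj (y \<otimes> inv y0) x = x" using cj_cj[OF yc _ xc, of "inv y0"] y0c by simp
        then have "x \<otimes> (y \<otimes> inv y0) = (y \<otimes> inv y0) \<otimes> x"
          using cj_eq_self_iff[of "y \<otimes> inv y0" x] yc y0c xc by simp
        then have "y \<otimes> inv y0 \<in> ?C" using conj_of_order_4(2)[OF S exp4 x, of "y \<otimes> inv y0"] y y0 by blast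
        moreover have "y = (y \<otimes> inv y0) \<otimes> y0" using yc y0c by (simp add: m_assoc)
        ultimately show ?thesis by blast
      qed
    qed
    then show thesis using that y0c by blast
  qed
  have "card S \<le> card (?C \<union> (\<lambda>c. c \<otimes> y0) ` ?C)" by (rule card_mono[OF _ y0(2)]) simp
  also have "\<dots> \<le> card ?C + card ((\<lambda>c. c \<otimes> y0) ` ?C)" by (rule card_Un_le)
  also have "\<dots> \<le> card ?C + card ?C" by (intro add_left_mono card_image_le) simp
  finally show ?thesis using cC by linarith
qed

end

section \<open>The order of the complement divides 24\<close>

context MP_action
begin

lemma card_pos: "card (carrier K) > 0"
  using finite_K one_closed by (auto simp: card_gt_0_iff)

lemma finite_subgroup: "subgroup S K \<Longrightarrow> finite S"
  using finite_subset[OF subgroup.subset finite_K] by blast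

text \<open>A subgroup of order 9 has exponent 3, as there are no elements of order 9, and
  \<open>x\<close>, \<open>y\<close> spanning it cannot commute. The nine products
  \<open>x [^] i \<otimes> y [^] j\<close> are distinct and exhaust it, so
  \<open>y \<otimes> x\<close> is one of them. Each possibility either puts \<open>y\<close> among
  the powers of \<open>x\<close> or makes \<open>x\<close> and \<open>y\<close> commute.\<close>

lemma not_9_dvd_card: "\<not> 9 dvd card (carrier K)"
proof
  assume "9 dvd card (carrier K)"
  then obtain m where "order K = 3 ^ 2 * m" unfolding order_def by auto
  then obtain S where S: "subgroup S K" "card S = 9"
    using sylow_thm[OF _ is_group _ finite_K, of 3 2 m] by auto
  interpret S: subgroup S K by (rule S)
  have cube: "g [^] (3::nat) = \<one>" if g: "g \<in> S" for g
  proof -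
    have gc: "g \<in> carrier K" using g S.subset by blast
    have "ord g dvd 3 ^ 2"
      using subgroup_pow_card[OF S(1) finite_subgroup[OF S(1)] g] S(2) pow_eq_id[OF gc, of 9] by simp
    then obtain i where i: "i \<le> 2" "ord g = 3 ^ i"
      using divides_primepow_nat[of 3 "ord g" 2] by auto
    moreover have "ord g \<noteq> 3 ^ 2" using no_odd_prime_square_order[of 3 g] gc by simp
    ultimately have "i \<le> 1" by (metis le_antisym not_less_eq_eq numeral_2_eq_2 One_nat_def)
    then have "ord g dvd 3" using i(2) by (cases i) auto
    then show ?thesis using pow_eq_id[OF gc] by blast
  qed
  have ord3: "ord g = 3" if "g \<in> S" "g \<noteq> \<one>" for g
    using ord_eq_prime[of g 3] cube that S.subset by auto
  have "\<not> S \<subseteq> {\<one>}" using card_mono[of "{\<one>}" S] S(2) by auto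
  then obtain x where x: "x \<in> S" "x \<noteq> \<one>" by blast
  have xc: "x \<in> carrier K" using x S.subset by blast
  have cX: "card (generate K {x}) = 3" using generate_pow_card[OF xc] ord3 x by simp
  have fX: "finite (generate K {x})" using finite_subgroup generate_is_subgroup xc by simp
  have "\<not> S \<subseteq> generate K {x}" using card_mono[OF fX, of S] cX S(2) by auto
  then obtain y where y: "y \<in> S" "y \<notin> generate K {x}" by blast
  have yc: "y \<in> carrier K" using y S.subset by blast
  have yne: "y \<noteq> \<one>" using y(2) generate.one[of K "{x}"] by blast
  have x3: "x [^] (3::nat) = \<one>" and y3: "y [^] (3::nat) = \<one>" using cube x y by auto
  have nXk: "y \<noteq> x [^] (k::int)" for k using y mem_generate_iff[OF xc] by blast
  have ncomm: "x \<otimes> y \<noteq> y \<otimes> x"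
    using commuting_prime_order[of 3 x y] xc yc ord3 x y y3 by auto
  let ?f = "\<lambda>(i::nat, j::nat). x [^] i \<otimes> y [^] j"
  have inj: "inj_on ?f ({..<3} \<times> {..<3})"
  proof (rule inj_onI, clarify)
    fix i j i' j' :: nat
    assume b: "i < 3" "j < 3" "i' < 3" "j' < 3" and e: "x [^] i \<otimes> y [^] j = x [^] i' \<otimes> y [^] j'"
    have "x [^] int i \<otimes> y [^] int j = x [^] int i' \<otimes> y [^] int j'" using e by (simp add: int_pow_int)
    then have "x [^] (- int i') \<otimes> (x [^] int i \<otimes> y [^] int j) \<otimes> y [^] (- int j')
        = x [^] (- int i') \<otimes> (x [^] int i' \<otimes> y [^] int j') \<otimes> y [^] (- int j')" by simp
    moreover have "x [^] (- int i') \<otimes> (x [^] a \<otimes> y [^] b) \<otimes> y [^] (- int j')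
        = x [^] (a - int i') \<otimes> y [^] (b - int j')" for a b :: int
      using int_pow_mult[OF xc, of "- int i'" a] int_pow_mult[OF yc, of b "- int j'"] xc yc
      by (simp add: m_assoc)
    ultimately have e2: "x [^] (int i - int i') \<otimes> y [^] (int j - int j') = \<one>" by simp
    have j: "j = j'"
    proof (rule ccontr)
      assume "j \<noteq> j'"
      then have "\<not> int 3 dvd int j - int j'" using b by presburger
      then have cop: "coprime (int j - int j') (int (ord y))" using prime_coprime_int[of 3] ord3 y yne by simp
      obtain k :: int where k: "(y [^] (int j - int j')) [^] k = y" using pow_recover[OF yc cop] .
      have "y [^] (int j - int j') = inv (x [^] (int i - int i'))"
        using e2 xc yc by (metis int_pow_closed inv_equality inv_inv inv_closed)
      then have "y [^] (int j - int j') = x [^] (- (int i - int i'))" using int_pow_neg xc by metis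
      then show False using k nXk int_pow_pow[OF xc] by metis
    qed
    then have "x [^] (int i - int i') = \<one>" using e2 xc by simp
    then have "int 3 dvd int i - int i'" using int_pow_eq_id[OF xc] ord3[OF x] by simp
    then show "i = i' \<and> j = j'" using b j by presburger
  qed
  have "?f ` ({..<3} \<times> {..<3}) = S"
  proof (rule card_subset_eq)
    show "finite S" using finite_subgroup S(1) .
    show "card (?f ` ({..<3} \<times> {..<3})) = card S" using inj S(2) by (simp add: card_image)
    show "?f ` ({..<3} \<times> {..<3}) \<subseteq> S"
      using x y by (auto simp: nat_pow_consistent[symmetric] intro!: S.m_closed)
        (metis S(1) int_pow_int subgroup_int_pow_closed)+
  qed
  then have "y \<otimes> x \<in> ?f ` ({..<3} \<times> {..<3})" using x y by simp
  then obtain i j :: nat where ij: "i < 3" "j < 3" "y \<otimes> x = x [^] i \<otimes> y [^] j" by auto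
  have j012: "j = 0 \<or> j = 1 \<or> j = 2" and i012: "i = 0 \<or> i = 1 \<or> i = 2" using ij by auto
  from j012 show False
  proof (elim disjE)
    assume "j = 0"
    then have "y \<otimes> x = x [^] i" using ij xc by simp
    then have "y = x [^] (int i - 1)"
      using int_pow_diff[OF xc, of "int i" 1] inv_solve_right[of y "x [^] i" x] xc yc
      by (simp add: int_pow_int)
    then show False using nXk by blast
  next
    assume "j = 1"
    then have yx: "y \<otimes> x = x [^] i \<otimes> y" using ij yc by simp
    have "cj (inv y) x = y \<otimes> x \<otimes> inv y" using xc yc by (simp add: cj_def)
    also have "\<dots> = x [^] int i" unfolding yx using xc yc by (simp add: m_assoc int_pow_int)
    finally have "x \<otimes> inv y = inv y \<otimes> x"
      using prime_order_normalizing[of 3 3 x "inv y" "int i"] ord3 x y yne xc yc by simp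
    then have "x \<otimes> y = y \<otimes> x"
      using commute_int_pow[of x "inv y" "- 1"] xc yc by (simp add: int_pow_neg)
    then show False using ncomm by simp
  next
    assume j: "j = 2"
    from i012 show False
    proof (elim disjE)
      assume "i = 0"
      then have "y \<otimes> x = y \<otimes> y" using ij j yc by (simp add: numeral_2_eq_2)
      then have "x = y" using xc yc by simp
      then show False using ncomm by simp
    next
      assume "i = 1"
      then have "y \<otimes> x = x \<otimes> y [^] (2::int)" using ij j xc int_pow_int[of K y 2] by simp
      then have "cj x y = y [^] (2::int)" using cj_eq_iff xc yc by simp
      then have "y \<otimes> x = x \<otimes> y" using prime_order_normalizing[of 3 3 y x 2] ord3 x y yne xc yc by simp
      then show False using ncomm by simp
    next
      \<comment> \<open>Replacing one factor of \<open>(y \<otimes> x)^2\<close> by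
        \<open>x^2 y^2\<close> cancels everything; exponent 3 then forces
        \<open>y \<otimes> x = \<one>\<close>.\<close>
      assume i: "i = 2"
      have x21: "x \<otimes> x [^] (2::nat) = \<one>" using x3 nat_pow_Suc2[OF xc, of 2] by (simp add: numeral_3_eq_3 numeral_2_eq_2)
      have y12: "y \<otimes> y [^] (2::nat) = \<one>" using y3 nat_pow_Suc2[OF yc, of 2] by (simp add: numeral_3_eq_3 numeral_2_eq_2)
      have yx2: "y \<otimes> x = x [^] (2::nat) \<otimes> y [^] (2::nat)" using ij i j by simp
      have "y \<otimes> x \<otimes> (y \<otimes> x) = y \<otimes> x \<otimes> (x [^] (2::nat) \<otimes> y [^] (2::nat))"
        by (simp only: yx2[symmetric])
      also have "\<dots> = y \<otimes> (x \<otimes> x [^] (2::nat)) \<otimes> y [^] (2::nat)"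
        using xc yc by (simp add: m_assoc)
      also have "\<dots> = \<one>" unfolding x21 using y12 yc by simp
      finally have sq: "(y \<otimes> x) [^] (2::nat) = \<one>" using xc yc by (simp add: numeral_2_eq_2)
      have "(y \<otimes> x) [^] (3::nat) = \<one>" using cube x y by simp
      then have "y \<otimes> x = \<one>" using sq xc yc by (simp add: numeral_3_eq_3 numeral_2_eq_2)
      then have "y = x [^] (- 1 :: int)" using xc yc by (simp add: int_pow_neg inv_equality)
      then show False using nXk by blast
    qed
  qed
qed

lemma exponent_4_of_power_2:
  assumes S: "subgroup S K" "card S = 2 ^ k" and g: "g \<in> S"
  shows "g [^] (4::nat) = \<one>"
proof -
  have gc: "g \<in> carrier K" using g S subgroup.mem_carrier by metis
  have "ord g dvd 2 ^ k"
    using subgroup_pow_card[OF S(1) finite_subgroup[OF S(1)] g] S(2) pow_eq_id[OF gc] by simp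
  then obtain i where i: "i \<le> k" "ord g = 2 ^ i"
    using divides_primepow_nat[of 2 "ord g" k] by auto
  have "i < 3"
  proof (rule ccontr)
    assume "\<not> i < 3"
    then have "(2::nat) ^ 3 dvd 2 ^ i" by (intro le_imp_power_dvd) simp
    then have "8 dvd ord g" using i by simp
    then show False using ord_div[OF gc, of 8] no_order_8[of "g [^] (ord g div 8)"] gc by simp
  qed
  then have "(2::nat) ^ i dvd 2 ^ 2" by (intro le_imp_power_dvd) simp
  then show ?thesis using i pow_eq_id[OF gc, of 4] by simp
qed

lemma card_K_dvd_24: "card (carrier K) dvd 24"
proof (rule dvd_24I[OF card_pos _ not_9_dvd_card])
  fix p assume p: "Factorial_Ring.prime p" "p dvd card (carrier K)"
  then obtain x where x: "x \<in> carrier K" "ord x = p" using cauchy[OF finite_K p(1)] unfolding order_def by auto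
  show "p = 2 \<or> p = 3"
    using odd_prime_order_eq_3[OF p(1) _ x] p(1) primes_dvd_imp_eq[OF two_is_prime_nat p(1)] by blast
next
  show "\<not> 16 dvd card (carrier K)"
  proof
    assume "16 dvd card (carrier K)"
    then obtain m where "order K = 2 ^ 4 * m" unfolding order_def by auto
    then obtain S where S: "subgroup S K" "card S = 2 ^ 4"
      using sylow_thm[OF _ is_group _ finite_K, of 2 4 m] by auto
    then show False using card_exponent_4_subgroup[OF S(1)] exponent_4_of_power_2[OF S] by simp
  qed
qed

end

section \<open>The possible pairs of orders\<close>

context fpf_action
begin

lemma generator_of_prime_card:
  assumes "Factorial_Ring.prime (card (carrier A))" and v: "v \<in> carrier A" "v \<noteq> \<one>\<^bsub>A\<^esub>"
  shows "A.ord v = card (carrier A)" and "carrier A = generate A {v}"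
proof -
  have "A.ord v dvd card (carrier A)" using A.ord_dvd_group_order[OF v(1)] by (simp add: order_def)
  then show o: "A.ord v = card (carrier A)"
    using assms prime_nat_iff A.ord_eq_1[OF v(1)] by blast
  show "carrier A = generate A {v}"
    by (rule card_subset_eq[symmetric])
       (use finite_A A.generate_in_carrier[of "{v}"] v A.generate_pow_card[OF v(1)] o in auto)
qed

text \<open>Endomorphisms of a cyclic group are power maps and commute with each other; the action
  is faithful.\<close>

lemma commute_of_prime_card:
  assumes p: "Factorial_Ring.prime (card (carrier A))" and gh: "g \<in> carrier K" "h \<in> carrier K"
  shows "g \<otimes> h = h \<otimes> g"
proof -
  obtain v where v: "v \<in> carrier A" "v \<noteq> \<one>\<^bsub>A\<^esub>" using ex_nontriv by blast
  have gen: "\<exists>k::int. u = v [^]\<^bsub>A\<^esub> k" if "u \<in> carrier A" for u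
    using generator_of_prime_card(2)[OF p v] A.mem_generate_iff[OF v(1)] that by blast
  obtain k l :: int where "\<phi> g v = v [^]\<^bsub>A\<^esub> k" "\<phi> h v = v [^]\<^bsub>A\<^esub> l"
    using gen gh v by (meson act_closed)
  then have "\<phi> (g \<otimes> h) v = \<phi> (h \<otimes> g) v"
    using gh v act_mult act_int_pow by (simp add: A.int_pow_pow mult.commute)
  then show ?thesis using act_inj[OF _ _ v] gh by blast
qed

text \<open>The summand 2 accounts for the identity and the only possible involution, the elements
  with trivial square.\<close>

lemma ex_square_nontrivial:
  assumes S: "subgroup S K" and F: "finite F" "card F + 2 < card S"
  obtains g where "g \<in> S" "g \<otimes> g \<noteq> \<one>" "g \<notin> F"
proof -
  have "\<exists>z. {g \<in> carrier K. g \<otimes> g = \<one>} \<subseteq> {\<one>, z}"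
    using involution_unique by blast
  then obtain z where z: "{g \<in> carrier K. g \<otimes> g = \<one>} \<subseteq> {\<one>, z}" by blast
  have "\<not> S \<subseteq> F \<union> {\<one>, z}"
  proof
    assume "S \<subseteq> F \<union> {\<one>, z}"
    then have "card S \<le> card (F \<union> {\<one>, z})" using F by (intro card_mono) auto
    also have "\<dots> \<le> card F + card {\<one>, z}" by (rule card_Un_le)
    also have "\<dots> \<le> card F + 2" by (simp add: card_insert_if)
    finally show False using F by simp
  qed
  then show thesis using that z subgroup.subset[OF S] by blast
qed

lemma ex_involution:
  assumes "even (card (carrier K))"
  obtains z where "z \<in> carrier K" "z \<noteq> \<one>" "z \<otimes> z = \<one>"
  using cauchy[OF finite_K two_is_prime_nat] assms by (auto simp: order_def numeral_2_eq_2)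

end

context half_transitive_action
begin

lemma exponent_A:
  assumes "Factorial_Ring.prime p" "p dvd card (carrier A)" and v: "v \<in> carrier A"
  shows "v [^]\<^bsub>A\<^esub> (p::nat) = \<one>\<^bsub>A\<^esub>"
proof (cases "v = \<one>\<^bsub>A\<^esub>")
  case False
  obtain e where e: "e \<in> carrier A" "e \<noteq> \<one>\<^bsub>A\<^esub>" "e [^]\<^bsub>A\<^esub> p = \<one>\<^bsub>A\<^esub>"
    using A.cauchy[OF finite_A] assms by (auto simp: order_def)
  obtain g where g: "g \<in> carrier K" "v = \<phi> g e \<or> v = \<phi> g (inv\<^bsub>A\<^esub> e)" using trans[OF v False e(1,2)] by blast
  have "\<phi> g e [^]\<^bsub>A\<^esub> p = \<one>\<^bsub>A\<^esub>"
    using group_hom.hom_nat_pow[OF act_group_hom[OF g(1)] e(1), of p] e(3)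
      group_hom.hom_one[OF act_group_hom[OF g(1)]] by simp
  then show ?thesis using g e act_inv A.nat_pow_inv[of "\<phi> g e" p] by auto
qed simp

end

context MP_action
begin

text \<open>Here |A| = 13 is prime, so \<open>K\<close> is abelian and conjugate elements are equal.
  An element of order 3 times one of order 4 has order 12, and 5 is a unit modulo 12 other than 1
  and -1: the fifth power has the same normal closure without being the element or its
  inverse.\<close>

lemma card_K_neq_12: "card (carrier K) \<noteq> 12"
proof
  assume c12: "card (carrier K) = 12"
  then have "card (carrier A) = 13" using card_A_even by simp
  then have comm: "g \<otimes> h = h \<otimes> g" if "g \<in> carrier K" "h \<in> carrier K" for g h
    using commute_of_prime_card that by simp
  obtain S where S: "subgroup S K" "card S = 2 ^ 2"
    using sylow_thm[OF two_is_prime_nat is_group _ finite_K, of 2 3] c12 by (auto simp: order_def)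
  obtain g where g: "g \<in> S" "g \<otimes> g \<noteq> \<one>" using ex_square_nontrivial[OF S(1), of "{}"] S(2) by auto
  have gc: "g \<in> carrier K" using g S subgroup.mem_carrier by metis
  have g4: "g [^] (4::nat) = \<one>" using exponent_4_of_power_2[OF S g(1)] .
  obtain m where m: "m \<in> carrier K" "ord m = 3" "m \<noteq> \<one>" "m [^] (3::nat) = \<one>"
    using cauchy[OF finite_K, of 3] c12 by (auto simp: order_def)
  define x where "x = m \<otimes> g"
  have xc: "x \<in> carrier K" unfolding x_def using m gc by simp
  have xp: "x [^] (n::nat) = m [^] n \<otimes> g [^] n" for n
    unfolding x_def using pow_mult_distrib[OF comm] m gc by simp
  have "ord x dvd 12" using ord_dvd_group_order[OF xc] c12 by (simp add: order_def)
  then have d12: "int (ord x) dvd 12" by presburger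
  have "coprime 5 (int (ord x))"
  proof (rule coprimeI)
    fix c :: int assume "c dvd 5" "c dvd int (ord x)"
    then have "c dvd 5 * 5 - 2 * 12" using d12 by (meson dvd_diff dvd_mult dvd_trans)
    then show "is_unit c" by simp
  qed
  then obtain u where "u \<in> carrier K" "cj u x = x [^] (5::int) \<or> cj u x = x [^] (- 5 :: int)"
    using MP_conj_pow[OF MP_K xc] by metis
  then have "x [^] (1::int) = x [^] (5::int) \<or> x [^] (1::int) = x [^] (- 5 :: int)"
    using cj_eq_self_iff[of u x] comm[of x u] xc by auto
  then have "int (ord x) dvd 4 \<or> int (ord x) dvd - 6"
    using int_pow_eq[OF xc, of 1 5] int_pow_eq[OF xc, of 1 "- 5"] by auto
  then have "int (ord x) dvd 4 \<or> int (ord x) dvd 6" by simp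
  then have "ord x dvd 4 \<or> ord x dvd 6" by presburger
  then have "m [^] (4::nat) \<otimes> g [^] (4::nat) = \<one> \<or> m [^] (6::nat) \<otimes> g [^] (6::nat) = \<one>"
    using pow_eq_id[OF xc] xp by metis
  then show False
  proof
    assume "m [^] (4::nat) \<otimes> g [^] (4::nat) = \<one>"
    then have "m [^] (4::nat) = \<one>" using g4 m by simp
    then show False using pow_eq_id[OF m(1), of 4] m by simp
  next
    assume *: "m [^] (6::nat) \<otimes> g [^] (6::nat) = \<one>"
    have "m [^] (6::nat) = \<one>" using pow_eq_id[OF m(1), of 6] m by simp
    then have "g [^] (6::nat) = \<one>" using * gc by simp
    then have "g [^] (4 + 2 :: nat) = \<one>" by simp
    then have "g [^] (2::nat) = \<one>" using nat_pow_mult[OF gc, of 4 2] g4 gc by simp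
    then show False using g(2) gc by (simp add: numeral_2_eq_2)
  qed
qed

text \<open>Written additively, \<open>g^2 = - 1\<close> on a group of exponent 5, so
  \<open>(g - 2)(g + 2) = 0\<close>. If the eigenspace \<open>E\<close> of 2 is trivial,
  \<open>g\<close> is \<open>- 2\<close>. Otherwise \<open>m\<close> preserves \<open>E\<close>; an
  eigenvalue of \<open>m\<close> would be a cube root of unity modulo 5, hence 1, which
  \<open>fpf\<close> forbids. So \<open>E\<close> is larger than a line and fills
  \<open>A\<close>.\<close>

lemma scalar_of_card_25:
  assumes cA: "card (carrier A) = 25" and m: "m \<in> carrier K" "ord m = 3"
    and g: "g \<in> carrier K" "g \<otimes> g \<noteq> \<one>" "g [^] (4::nat) = \<one>" and comm: "m \<otimes> g = g \<otimes> m"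
  obtains k :: int where "\<And>v. v \<in> carrier A \<Longrightarrow> \<phi> g v = v [^]\<^bsub>A\<^esub> k"
proof -
  have "(g \<otimes> g) \<otimes> (g \<otimes> g) = \<one>" using g by (simp add: eval_nat_numeral m_assoc)
  then have gg: "\<phi> g (\<phi> g v) = inv\<^bsub>A\<^esub> v" if "v \<in> carrier A" for v
    using involution_inverts[of "g \<otimes> g" v] act_mult[of g g v] g that by simp
  have mne: "m \<noteq> \<one>" using m(2) by auto
  have v5: "v [^]\<^bsub>A\<^esub> (a::int) = v [^]\<^bsub>A\<^esub> b" if "v \<in> carrier A" "5 dvd b - a" for v a b
  proof -
    have "v [^]\<^bsub>A\<^esub> (5::nat) = \<one>\<^bsub>A\<^esub>" using exponent_A[of 5 v] cA that by simp
    then have "A.ord v dvd 5" using A.pow_eq_id that by blast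
    then have "int (A.ord v) dvd 5" by presburger
    then show ?thesis using A.int_pow_eqI[OF that(1)] that(2) dvd_trans by blast
  qed
  define E where "E = {v \<in> carrier A. \<phi> g v = v [^]\<^bsub>A\<^esub> (2::int)}"
  have E: "subgroup E A"
  proof (rule A.subgroupI)
    show "E \<subseteq> carrier A" "E \<noteq> {}"
      unfolding E_def using group_hom.hom_one[OF act_group_hom[OF g(1)]] by auto
    show "inv\<^bsub>A\<^esub> v \<in> E" if "v \<in> E" for v
      using that act_inv[OF g(1)] A.int_pow_inv unfolding E_def by auto
    show "u \<otimes>\<^bsub>A\<^esub> v \<in> E" if "u \<in> E" "v \<in> E" for u v
      using that group_hom.hom_mult[OF act_group_hom[OF g(1)]] A.int_pow_distrib unfolding E_def by auto
  qed
  show thesis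
  proof (cases "E \<subseteq> {\<one>\<^bsub>A\<^esub>}")
    case True
    have "\<phi> g v = v [^]\<^bsub>A\<^esub> (- 2 :: int)" if v: "v \<in> carrier A" for v
    proof -
      \<comment> \<open>The image of \<open>v\<close> under \<open>g + 2\<close>, which lies in the
        eigenspace of 2; in the computation -1 is read as 4 modulo 5.\<close>
      define w where "w = \<phi> g v \<otimes>\<^bsub>A\<^esub> v [^]\<^bsub>A\<^esub> (2::int)"
      have "\<phi> g w = \<phi> g (\<phi> g v) \<otimes>\<^bsub>A\<^esub> \<phi> g v [^]\<^bsub>A\<^esub> (2::int)"
        unfolding w_def using group_hom.hom_mult[OF act_group_hom[OF g(1)]] act_int_pow g v by simp
      also have "\<dots> = v [^]\<^bsub>A\<^esub> (- 1 :: int) \<otimes>\<^bsub>A\<^esub> \<phi> g v [^]\<^bsub>A\<^esub> (2::int)"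
        using gg[OF v] v by (simp add: A.int_pow_neg)
      also have "v [^]\<^bsub>A\<^esub> (- 1 :: int) = v [^]\<^bsub>A\<^esub> (4::int)" by (rule v5[OF v]) simp
      also have "v [^]\<^bsub>A\<^esub> (4::int) \<otimes>\<^bsub>A\<^esub> \<phi> g v [^]\<^bsub>A\<^esub> (2::int) = w [^]\<^bsub>A\<^esub> (2::int)"
        unfolding w_def using A.int_pow_distrib[of "\<phi> g v" "v [^]\<^bsub>A\<^esub> (2::int)" 2] g v A.m_comm
        by (simp add: A.int_pow_pow)
      finally have "w \<in> E" unfolding E_def w_def using g v by simp
      then have "w = \<one>\<^bsub>A\<^esub>" using True by blast
      then have "\<phi> g v = inv\<^bsub>A\<^esub> (v [^]\<^bsub>A\<^esub> (2::int))"
        unfolding w_def using g v A.inv_equality by (metis A.int_pow_closed act_closed A.m_comm A.inv_inv A.inv_closed)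
      then show ?thesis using A.int_pow_neg[OF v, of 2] by simp
    qed
    then show thesis using that by blast
  next
    case False
    then obtain e where e: "e \<in> E" "e \<noteq> \<one>\<^bsub>A\<^esub>" by blast
    have ec: "e \<in> carrier A" using e E_def by blast
    define f where "f = \<phi> m e"
    have fc: "f \<in> carrier A" unfolding f_def using m ec by simp
    have fE: "f \<in> E"
    proof -
      have "\<phi> g f = \<phi> m (\<phi> g e)" unfolding f_def
        using act_mult[OF g(1) m(1) ec] act_mult[OF m(1) g(1) ec] comm by simp
      also have "\<dots> = f [^]\<^bsub>A\<^esub> (2::int)" unfolding f_def using e act_int_pow m ec unfolding E_def by simp
      finally show ?thesis unfolding E_def using fc by simp
    qed
    have "f \<notin> generate A {e}"
    proof
      assume "f \<in> generate A {e}"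
      then obtain c :: int where c: "f = e [^]\<^bsub>A\<^esub> c" using A.mem_generate_iff[OF ec] by blast
      have pw: "\<phi> (m [^] (n::nat)) e = e [^]\<^bsub>A\<^esub> (c ^ n)" for n
      proof (induction n)
        case (Suc n)
        have "\<phi> (m [^] Suc n) e = \<phi> (m [^] n) (\<phi> m e)" using act_mult m ec by simp
        also have "\<dots> = \<phi> (m [^] n) e [^]\<^bsub>A\<^esub> c" using c act_int_pow m ec unfolding f_def by simp
        also have "\<dots> = e [^]\<^bsub>A\<^esub> (c ^ Suc n)" using Suc ec by (simp add: A.int_pow_pow mult.commute)
        finally show ?case .
      qed (use act_one ec in simp)
      have oe: "A.ord e = 5"
        using A.ord_eq_prime[of e 5] exponent_A[of 5 e] cA e ec by simp
      have "m [^] (3::nat) = \<one>" using pow_ord_eq_1[OF m(1)] m(2) by simp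
      then have "e [^]\<^bsub>A\<^esub> (1::int) = e [^]\<^bsub>A\<^esub> (c ^ 3)" using pw[of 3] act_one ec by simp
      then have "5 dvd c ^ 3 - 1" using A.int_pow_eq[OF ec, of 1 "c ^ 3"] oe by simp
      then have "5 dvd c - 1"
      proof -
        assume a: "5 dvd c ^ 3 - 1"
        obtain q r where q: "c = 5 * q + r" "0 \<le> r" "r < 5"
          by (metis div_mult_mod_eq mult.commute pos_mod_bound pos_mod_sign zero_less_numeral)
        have "c ^ 3 - 1 = 5 * (25 * q ^ 3 + 15 * q ^ 2 * r + 3 * q * r ^ 2) + (r ^ 3 - 1)"
          unfolding q(1) by (simp add: algebra_simps power2_eq_square power3_eq_cube)
        then have "r ^ 3 - 1 = (c ^ 3 - 1) - 5 * (25 * q ^ 3 + 15 * q ^ 2 * r + 3 * q * r ^ 2)" by simp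
        then have "5 dvd r ^ 3 - 1" using dvd_diff[OF a dvd_triv_left] by metis
        moreover have "r = 0 \<or> r = 1 \<or> r = 2 \<or> r = 3 \<or> r = 4" using q by presburger
        ultimately have "r = 1" by auto
        then show ?thesis using q by simp
      qed
      then have "f = e" using v5[OF ec, of c 1] v5[OF ec, of 1 c] c ec by (simp add: dvd_diff_commute)
      then show False using fpf[OF m(1) mne ec] e unfolding f_def by simp
    qed
    moreover have "generate A {e} \<subseteq> E" using A.generate_subgroup_incl[of "{e}" E] e E by simp
    ultimately have "generate A {e} \<subset> E" using fE by blast
    then have "card (generate A {e}) < card E"
      using finite_subset[OF subgroup.subset[OF E] finite_A] by (intro psubset_card_mono)
    then have "card E > 5"
      using A.generate_pow_card[OF ec] A.ord_eq_prime[of e 5] exponent_A[of 5 e] cA e ec by simp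
    moreover have "card E dvd 5 ^ 2" using A.subgroup_card_dvd[OF E finite_A] cA by (simp add: order_def)
    then obtain i where "i \<le> 2" "card E = 5 ^ i" using divides_primepow_nat[of 5 "card E" 2] by auto
    moreover have "i = 0 \<or> i = 1 \<or> i = 2" using \<open>i \<le> 2\<close> by auto
    ultimately have "card E = 25" by auto
    then have "E = carrier A" using card_subset_eq[OF finite_A subgroup.subset[OF E]] cA by simp
    then show thesis using that[of 2] unfolding E_def by blast
  qed
qed

text \<open>If the normal closure \<open>Y\<close> of \<open>m\<close> contained the central
  involution \<open>z\<close>, then \<open>m \<otimes> z\<close>, whose fourth power is
  \<open>m\<close>, would have the same normal closure. But its cube is \<open>z\<close>, so it is
  not conjugate to \<open>m\<close> or its inverse. Hence \<open>Y\<close> has odd order, and an odd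
  divisor of 24 is at most 3.\<close>

lemma order_3_normal:
  assumes even: "even (card (carrier K))" and m: "m \<in> carrier K" "ord m = 3" and u: "u \<in> carrier K"
  shows "cj u m \<in> generate K {m}"
proof -
  have m3: "m [^] (3::nat) = \<one>" using pow_ord_eq_1[OF m(1)] m(2) by simp
  obtain z where z: "z \<in> carrier K" "z \<noteq> \<one>" "z \<otimes> z = \<one>" using ex_involution[OF even] .
  define Y where "Y = normal_closure K m"
  have YN: "Y \<lhd> K" unfolding Y_def using normal_closure_normal m by simp
  interpret Y: normal Y K by (rule YN)
  have mY: "m \<in> Y" unfolding Y_def using normal_closure_mem m by simp
  have "z \<notin> Y"
  proof
    assume zY: "z \<in> Y"
    define x where "x = m \<otimes> z"
    have xc: "x \<in> carrier K" unfolding x_def using m z by simp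
    have xp: "x [^] (n::nat) = m [^] n \<otimes> z [^] n" for n
      unfolding x_def using pow_mult_distrib[of m z] involution_central[OF z m(1)] m z by simp
    have z3: "z [^] (3::nat) = z" "z [^] (4::nat) = \<one>" using z by (simp_all add: eval_nat_numeral)
    have m4: "m [^] (4::nat) = m" using m3 m by (simp add: eval_nat_numeral)
    have nx: "x [^] (3::nat) = z" "x [^] (4::nat) = m" using xp z3 m3 m4 m z by simp_all
    have "normal_closure K x = normal_closure K m"
    proof (rule normal_closure_eqI[OF xc m(1)])
      show "x \<in> normal_closure K m" using mY zY unfolding x_def Y_def[symmetric] by simp
      have "subgroup (normal_closure K x) K" using normal_closure_normal[OF xc] normal_imp_subgroup by blast
      then have "x [^] (4::int) \<in> normal_closure K x"
        using subgroup_int_pow_closed normal_closure_mem[OF xc] by blast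
      then show "m \<in> normal_closure K x" using nx(2) int_pow_int[of K x 4] by simp
    qed
    then have "conj_in K m x \<or> conj_in K (inv m) x" using MP_K xc m(1) unfolding MP_def by blast
    then obtain g y where g: "g \<in> carrier K" "x = cj g y" "y = m \<or> y = inv m"
      unfolding conj_in_def cj_def by blast
    have y: "y \<in> carrier K" "y [^] (3::nat) = \<one>" using g(3) m m3 nat_pow_inv by auto
    then have "x [^] (3::nat) = \<one>" using cj_nat_pow[OF g(1) y(1), of 3] group_hom.hom_one[OF cj_group_hom[OF g(1)]] g(2) y(2)
      by simp
    then show False using nx z by simp
  qed
  then have "odd (card Y)"
    using subgroup_cauchy[OF Y.subgroup_axioms finite_subgroup[OF Y.subgroup_axioms] two_is_prime_nat]
      involution_unique[OF z] Y.subset by (metis numeral_2_eq_2 nat_pow_Suc nat_pow_0 l_one subsetD)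
  moreover have "card Y dvd 8 * 3"
    using subgroup_card_dvd[OF Y.subgroup_axioms finite_K] card_K_dvd_24 dvd_trans by (simp add: order_def)
  moreover have "coprime (card Y) (2 ^ 3)"
    using \<open>odd (card Y)\<close> by (simp only: coprime_power_right_iff coprime_right_2_iff_odd) simp
  ultimately have "card Y dvd 3" using coprime_dvd_mult_right_iff[of "card Y" 8 3] by simp
  then have "card Y \<le> 3" by (simp add: dvd_imp_le)
  moreover have "generate K {m} \<subseteq> Y" using generate_subgroup_incl[of "{m}" Y] mY Y.subgroup_axioms by simp
  moreover have "card (generate K {m}) = 3" using generate_pow_card[OF m(1)] m(2) by simp
  ultimately have "generate K {m} = Y"
    using card_seteq[OF finite_subgroup[OF Y.subgroup_axioms]] by simp
  then show ?thesis using Y.inv_op_closed1[OF u mY] unfolding cj_def by simp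
qed

text \<open>Elements of the Sylow 2-subgroup \<open>S\<close> fix or invert \<open>m\<close>, so one
  of \<open>g\<close>, \<open>h\<close>, \<open>g \<otimes> h\<close>, all of order 4, centralises
  \<open>m\<close>. By \<open>scalar_of_card_25\<close> it acts as a scalar and is central in
  \<open>K\<close>, while by \<open>conj_of_order_4\<close> it commutes with at most four of the
  eight elements of \<open>S\<close>.\<close>

lemma card_K_neq_24: "card (carrier K) \<noteq> 24"
proof
  assume c24: "card (carrier K) = 24"
  then have cA: "card (carrier A) = 25" using card_A_even by simp
  obtain S where S: "subgroup S K" "card S = 2 ^ 3"
    using sylow_thm[OF two_is_prime_nat is_group _ finite_K, of 3 3] c24 by (auto simp: order_def)
  interpret S: subgroup S K by (rule S)
  have exp4: "g [^] (4::nat) = \<one>" if "g \<in> S" for g using exponent_4_of_power_2[OF S that] .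
  obtain m where m: "m \<in> carrier K" "ord m = 3" "m \<noteq> \<one>" "m [^] (3::nat) = \<one>"
    using cauchy[OF finite_K, of 3] c24 by (auto simp: order_def)
  obtain g where g: "g \<in> S" "g \<otimes> g \<noteq> \<one>" using ex_square_nontrivial[OF S(1), of "{}"] S(2) by auto
  obtain h where h: "h \<in> S" "h \<otimes> h \<noteq> \<one>" "h \<notin> {g, inv g}"
  proof (rule ex_square_nontrivial[OF S(1), of "{g, inv g}"])
    show "card {g, inv g} + 2 < card S" using S(2) by (simp add: card_insert_if)
  qed auto
  have gc: "g \<in> carrier K" "h \<in> carrier K" using g h by auto
  have conj: "cj u m = m [^] (2::int)" if u: "u \<in> carrier K" "m \<otimes> u \<noteq> u \<otimes> m" for u
  proof -
    obtain k :: int where k: "cj u m = m [^] k"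
      using order_3_normal[OF _ m(1,2) u(1)] mem_generate_iff[OF m(1)] c24 by auto
    have "k mod 3 = 0 \<or> k mod 3 = 1 \<or> k mod 3 = 2" by presburger
    then show ?thesis
    proof (elim disjE)
      assume "k mod 3 = 0"
      then have "cj u m = \<one>" using k int_pow_eqI[OF m(1), of 0 k] m(2) by (simp add: mod_eq_0_iff_dvd)
      then show ?thesis using cj_eq_iff[of u m \<one>] u m by simp
    next
      assume "k mod 3 = 1"
      then have "cj u m = m" using k int_pow_eqI[OF m(1), of 1 k] m(1,2) by (simp add: mod_eq_dvd_iff[symmetric])
      then show ?thesis using cj_eq_self_iff u m by simp
    next
      assume "k mod 3 = 2"
      then show ?thesis using k int_pow_eqI[OF m(1), of 2 k] m(1,2) by (simp add: mod_eq_dvd_iff[symmetric])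
    qed
  qed
  obtain g0 where g0: "g0 \<in> S" "g0 \<otimes> g0 \<noteq> \<one>" "m \<otimes> g0 = g0 \<otimes> m"
  proof (cases "m \<otimes> g = g \<otimes> m \<or> m \<otimes> h = h \<otimes> m")
    case True
    then show thesis using that g h by blast
  next
    case False
    have "cj (g \<otimes> h) m = cj h (cj g m)" using cj_cj[OF gc m(1)] by simp
    also have "\<dots> = m [^] (4::int)" using conj gc False m cj_int_pow by (simp add: int_pow_pow)
    also have "\<dots> = m [^] (1::int)" by (rule int_pow_eqI[OF m(1), symmetric]) (simp add: m(2))
    finally have "m \<otimes> (g \<otimes> h) = (g \<otimes> h) \<otimes> m" using cj_eq_self_iff[of "g \<otimes> h" m] gc m by simp
    \<comment> \<open>As \<open>h\<close> is neither \<open>g\<close> nor its inverse,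
      \<open>g \<otimes> h\<close> is neither the unique involution \<open>g \<otimes> g\<close> nor
      the identity.\<close>
    moreover have "(g \<otimes> h) \<otimes> (g \<otimes> h) \<noteq> \<one>"
    proof
      assume sq: "(g \<otimes> h) \<otimes> (g \<otimes> h) = \<one>"
      have gg: "(g \<otimes> g) \<otimes> (g \<otimes> g) = \<one>" using exp4[OF g(1)] gc by (simp add: eval_nat_numeral m_assoc)
      show False
      proof (cases "g \<otimes> h = \<one>")
        case True
        then have "h = inv g" using gc by (metis inv_equality inv_inv inv_closed)
        then show False using h by simp
      next
        case False
        then have "g \<otimes> h = g \<otimes> g" using involution_unique[OF _ g(2) gg, of "g \<otimes> h"] sq gc by simp
        then show False using gc h by simp
      qed
    qed
    ultimately show thesis using that[of "g \<otimes> h"] g h by simp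
  qed
  have g0c: "g0 \<in> carrier K" using g0 by auto
  obtain k :: int where k: "\<And>v. v \<in> carrier A \<Longrightarrow> \<phi> g0 v = v [^]\<^bsub>A\<^esub> k"
    using scalar_of_card_25[OF cA m(1,2) g0c g0(2) exp4[OF g0(1)] g0(3)] by blast
  have central: "g0 \<otimes> u = u \<otimes> g0" if u: "u \<in> carrier K" for u
    by (rule act_eqI) (use u g0c act_mult k act_int_pow in auto)
  \<comment> \<open>Of the four elements of \<open>S\<close> that can commute with
    \<open>g0\<close>, two are excluded here by name and the other two by having trivial
    square.\<close>
  obtain h' where h': "h' \<in> S" "h' \<otimes> h' \<noteq> \<one>" "h' \<notin> {g0, g0 \<otimes> (g0 \<otimes> g0)}"
  proof (rule ex_square_nontrivial[OF S(1), of "{g0, g0 \<otimes> (g0 \<otimes> g0)}"])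
    show "card {g0, g0 \<otimes> (g0 \<otimes> g0)} + 2 < card S" using S(2) by (simp add: card_insert_if)
  qed auto
  have "h' \<in> {\<one>, g0 \<otimes> g0, g0, g0 \<otimes> (g0 \<otimes> g0)}"
    using conj_of_order_4(2)[OF S(1) exp4 g0(1,2) h'(1)] central h' by auto
  moreover have "(g0 \<otimes> g0) \<otimes> (g0 \<otimes> g0) = \<one>" using exp4[OF g0(1)] g0c by (simp add: eval_nat_numeral m_assoc)
  ultimately show False using h' by auto
qed

text \<open>Among the six orders left for \<open>K\<close>, only the odd ones 1 and 3 admit the
  second alternative of \<open>card_A_cases\<close>, which adds \<open>(3, 1)\<close> and
  \<open>(7, 3)\<close>.\<close>

theorem card_pairs:
  "(card (carrier A), card (carrier K))
    \<in> {(2, 1), (3, 1), (3, 2), (4, 3), (7, 3), (5, 4), (7, 6), (9, 8)}"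
proof -
  have div: "n \<in> {1, 2, 3, 4, 6, 8, 12, 24}" if "n dvd 24" for n :: nat
  proof -
    have "n < 25" using dvd_imp_le[OF that] by simp
    then have "n = 0 \<or> n = 1 \<or> n = 2 \<or> n = 3 \<or> n = 4 \<or> n = 5 \<or> n = 6 \<or> n = 7 \<or> n = 8 \<or> n = 9 \<or> n = 10 \<or> n = 11 \<or> n = 12 \<or> n = 13 \<or> n = 14 \<or> n = 15 \<or> n = 16 \<or> n = 17 \<or> n = 18 \<or> n = 19 \<or> n = 20 \<or> n = 21 \<or> n = 22 \<or> n = 23 \<or> n = 24"
      by presburger
    then show ?thesis using that by (elim disjE) simp_all
  qed
  have "card (carrier K) \<in> {1, 2, 3, 4, 6, 8}"
    using div[OF card_K_dvd_24] card_K_neq_12 card_K_neq_24 by blast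
  then show ?thesis
    using card_A_cases by (elim insertE) (simp_all, linarith?)
qed

end

section \<open>Groups whose cyclic subgroups are normal\<close>

context group
begin

lemma normal_closure_eq_generate:
  assumes x: "x \<in> carrier G" and n: "\<And>u. u \<in> carrier G \<Longrightarrow> cj u x \<in> generate G {x}"
  shows "normal_closure G x = generate G {x}"
proof
  show "normal_closure G x \<subseteq> generate G {x}"
    unfolding normal_closure_def
    by (rule generate_subgroup_incl) (use n x generate_is_subgroup[of "{x}"] in \<open>auto simp: cj_def\<close>)
  show "generate G {x} \<subseteq> normal_closure G x"
    by (rule generate_subgroup_incl)
       (use normal_closure_mem[OF x] normal_closure_normal[OF x] normal_imp_subgroup in auto)
qed

text \<open>If an order divides 4 or 6, then 1 and -1 are the only units modulo it.\<close>

lemma eq_or_inv_of_generate_eq: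
  assumes x: "x \<in> carrier G" and y: "y \<in> carrier G" and eq: "generate G {x} = generate G {y}"
    and exp: "x [^] (4::nat) = \<one> \<or> x [^] (6::nat) = \<one>"
  shows "y = x \<or> y = inv x"
proof -
  obtain k :: int where k: "y = x [^] k" using mem_generate_self[OF y] eq mem_generate_iff[OF x] by blast
  obtain l :: int where l: "x = y [^] l" using mem_generate_self[OF x] eq mem_generate_iff[OF y] by blast
  define n where "n = int (ord x)"
  have "x [^] (k * l) = x" using l k int_pow_pow[OF x, of k l] by metis
  then have "x [^] (1::int) = x [^] (k * l)" using x by simp
  then have kl: "n dvd k * l - 1" unfolding n_def using int_pow_eq[OF x] by blast
  have odd: "odd k" if "even n"
  proof
    assume "even k"
    then have "even (k * l)" by simp
    moreover have "even (k * l - 1)" using kl that dvd_trans by blast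
    ultimately show False by simp
  qed
  have n3: "\<not> 3 dvd k" if "3 dvd n"
  proof
    assume "3 dvd k"
    then have "3 dvd k * l" by simp
    moreover have "3 dvd k * l - 1" using kl that dvd_trans by blast
    ultimately have "3 dvd k * l - (k * l - 1)" by (rule dvd_diff)
    then show False by simp
  qed
  have "ord x dvd 4 \<or> ord x dvd 6" using exp pow_eq_id[OF x] by blast
  then have "ord x dvd 4 \<or> ord x dvd 6" "ord x \<le> 6" "ord x > 0"
    using dvd_imp_le[of "ord x" 4] dvd_imp_le[of "ord x" 6] by (auto intro: dvd_pos_nat[rotated])
  then have "n = 1 \<or> n = 2 \<or> n = 3 \<or> n = 4 \<or> n = 6"
  proof -
    have "ord x = 1 \<or> ord x = 2 \<or> ord x = 3 \<or> ord x = 4 \<or> ord x = 5 \<or> ord x = 6"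
      using \<open>ord x \<le> 6\<close> \<open>ord x > 0\<close> by presburger
    then show ?thesis unfolding n_def using \<open>ord x dvd 4 \<or> ord x dvd 6\<close> by auto
  qed
  then have "n dvd k - 1 \<or> n dvd k + 1"
  proof (elim disjE)
    assume "n = 4" then show ?thesis using odd by simp presburger
  next
    assume "n = 6" then show ?thesis using odd n3 by simp presburger
  next
    assume "n = 3" then show ?thesis using n3 by simp presburger
  next
    assume "n = 2" then show ?thesis using odd by simp
  qed simp
  then show ?thesis
  proof
    assume "n dvd k - 1"
    then have "x [^] (1::int) = x [^] k" unfolding n_def by (rule int_pow_eqI[OF x])
    then show ?thesis using k x by simp
  next
    assume "n dvd k + 1"
    then have "x [^] (- 1 :: int) = x [^] k" unfolding n_def by (intro int_pow_eqI[OF x]) simp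
    then show ?thesis using k x by (simp add: int_pow_neg)
  qed
qed

lemma MP_of_commutative:
  assumes comm: "\<And>x y. x \<in> carrier G \<Longrightarrow> y \<in> carrier G \<Longrightarrow> x \<otimes> y = y \<otimes> x"
    and exp: "\<And>x. x \<in> carrier G \<Longrightarrow> x [^] (4::nat) = \<one> \<or> x [^] (6::nat) = \<one>"
  shows "MP G"
  unfolding MP_def
proof (intro ballI impI)
  fix x y assume xy: "x \<in> carrier G" "y \<in> carrier G" "normal_closure G x = normal_closure G y"
  have "normal_closure G u = generate G {u}" if "u \<in> carrier G" for u
    by (rule normal_closure_eq_generate) (use that comm cj_eq_self_iff mem_generate_self in auto)
  then have "generate G {y} = generate G {x}" using xy by simp
  then have "x = y \<or> x = inv y" using eq_or_inv_of_generate_eq[OF xy(2,1)] exp[OF xy(2)] by blast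
  then show "conj_in G y x \<or> conj_in G (inv y) x" using conj_in_refl xy by auto
qed

end

context fpf_action
begin

text \<open>This is the quaternion group. Its cyclic subgroups are normal, so equal normal closures
  mean equal or inverse elements. An element of order 4 commutes with at most four elements, so some
  \<open>u\<close> does not commute with it and conjugates it to its inverse.\<close>

lemma SMP_of_card_8:
  assumes c8: "card (carrier K) = 8" and exp4: "\<And>g. g \<in> carrier K \<Longrightarrow> g [^] (4::nat) = \<one>"
  shows "SMP K"
  unfolding SMP_def
proof (intro ballI impI)
  have conj4: "cj u w = w \<or> cj u w = w \<otimes> (w \<otimes> w)"
    "w \<otimes> u = u \<otimes> w \<Longrightarrow> u \<in> {\<one>, w \<otimes> w, w, w \<otimes> (w \<otimes> w)}"
    if "w \<in> carrier K" "w \<otimes> w \<noteq> \<one>" "u \<in> carrier K" for w u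
    using conj_of_order_4[OF subgroup_self _ that] exp4 by blast+
  fix x y assume xy: "x \<in> carrier K" "y \<in> carrier K" "normal_closure K x = normal_closure K y"
  have "cj u w \<in> generate K {w}" if w: "w \<in> carrier K" and u: "u \<in> carrier K" for u w
  proof (cases "w \<otimes> w = \<one>")
    case True
    then have "cj u w = w"
      using involution_central[of w u] cj_eq_self_iff[of u w] w u by (cases "w = \<one>") auto
    then show ?thesis using mem_generate_self w by simp
  next
    case False
    have "w \<otimes> (w \<otimes> w) = w [^] (3::int)" using w int_pow_int[of K w 3] by (simp add: eval_nat_numeral m_assoc)
    then have "w \<otimes> (w \<otimes> w) \<in> generate K {w}" using mem_generate_iff[OF w] by blast
    then show ?thesis using conj4(1)[OF w False u] mem_generate_self[OF w] by auto
  qed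
  then have gen: "normal_closure K w = generate K {w}" if "w \<in> carrier K" for w
    using normal_closure_eq_generate that by blast
  have "x = y \<or> x = inv y"
    using eq_or_inv_of_generate_eq[OF xy(2,1)] gen xy exp4 by simp
  then show "conj_in K y x"
  proof
    assume "x = y" then show ?thesis using conj_in_refl xy by simp
  next
    assume inv: "x = inv y"
    show ?thesis
    proof (cases "y \<otimes> y = \<one>")
      case True
      then have "x = y" using inv xy inv_equality by simp
      then show ?thesis using conj_in_refl xy by simp
    next
      case False
      have "\<exists>u\<in>carrier K. y \<otimes> u \<noteq> u \<otimes> y"
      proof (rule ccontr)
        assume "\<not> ?thesis"
        then have "carrier K \<subseteq> {\<one>, y \<otimes> y, y, y \<otimes> (y \<otimes> y)}" using conj4(2)[OF xy(2) False] by blast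
        then have "card (carrier K) \<le> card {\<one>, y \<otimes> y, y, y \<otimes> (y \<otimes> y)}" by (intro card_mono) auto
        also have "\<dots> \<le> 4" by (simp add: card_insert_if)
        finally show False using c8 by simp
      qed
      then obtain u where u: "u \<in> carrier K" "y \<otimes> u \<noteq> u \<otimes> y" by blast
      have "cj u y = y \<otimes> (y \<otimes> y)" using conj4(1)[OF xy(2) False u(1)] cj_eq_self_iff[of u y] u xy by blast
      also have "\<dots> = inv y"
        using exp4[OF xy(2)] xy(2) by (intro inv_equality[symmetric]) (simp_all add: eval_nat_numeral m_assoc)
      finally show ?thesis unfolding conj_in_def cj_def using u inv by metis
    qed
  qed
qed

end

section \<open>Uniqueness of the actions\<close>

text \<open>The exponent chosen by \<open>SOME\<close> is determined only modulo the order of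
  \<open>v\<close>, which is also the order of \<open>w\<close>.\<close>

lemma (in comm_group) power_map_iso:
  assumes B: "comm_group B" and v: "v \<in> carrier G" "carrier G = generate G {v}"
    and w: "w \<in> carrier B" "carrier B = generate B {w}" and o: "ord v = group.ord B w"
  obtains \<beta> where "\<beta> \<in> iso G B" "\<And>k::int. \<beta> (v [^] k) = w [^]\<^bsub>B\<^esub> k"
proof -
  interpret B: comm_group B by fact
  have ex: "\<exists>k::int. u = v [^] k" if "u \<in> carrier G" for u using that mem_generate_iff[OF v(1)] v(2) by blast
  have exB: "\<exists>k::int. u = w [^]\<^bsub>B\<^esub> k" if "u \<in> carrier B" for u
    using that B.mem_generate_iff[OF w(1)] w(2) by blast
  define \<beta> where "\<beta> u = w [^]\<^bsub>B\<^esub> (SOME k::int. u = v [^] k)" for u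
  have \<beta>: "\<beta> (v [^] k) = w [^]\<^bsub>B\<^esub> k" for k :: int
  proof -
    define l where "l = (SOME l::int. v [^] k = v [^] l)"
    have "v [^] k = v [^] l" unfolding l_def by (rule someI[of _ k]) simp
    then have "int (ord v) dvd l - k" using int_pow_eq[OF v(1)] by blast
    then have "w [^]\<^bsub>B\<^esub> k = w [^]\<^bsub>B\<^esub> l" using B.int_pow_eqI[OF w(1)] o by simp
    then show ?thesis unfolding \<beta>_def l_def by simp
  qed
  have "\<beta> \<in> iso G B"
  proof (rule isoI)
    show "\<beta> \<in> hom G B"
    proof (rule homI)
      show "\<beta> x \<in> carrier B" if "x \<in> carrier G" for x unfolding \<beta>_def using w(1) by (rule B.int_pow_closed)
      show "\<beta> (x \<otimes> y) = \<beta> x \<otimes>\<^bsub>B\<^esub> \<beta> y" if "x \<in> carrier G" "y \<in> carrier G" for x y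
      proof -
        obtain k l :: int where kl: "x = v [^] k" "y = v [^] l" using ex \<open>x \<in> carrier G\<close> \<open>y \<in> carrier G\<close> by blast
        then have "x \<otimes> y = v [^] (k + l)" using int_pow_mult[OF v(1)] by simp
        then show ?thesis using \<beta> kl B.int_pow_mult[OF w(1)] by simp
      qed
    qed
    show "bij_betw \<beta> (carrier G) (carrier B)"
      unfolding bij_betw_def
    proof
      show "inj_on \<beta> (carrier G)"
      proof (rule inj_onI)
        fix x y assume xy: "x \<in> carrier G" "y \<in> carrier G" "\<beta> x = \<beta> y"
        obtain k l :: int where kl: "x = v [^] k" "y = v [^] l" using ex xy by blast
        then have "w [^]\<^bsub>B\<^esub> k = w [^]\<^bsub>B\<^esub> l" using \<beta> xy by simp
        then have "int (B.ord w) dvd l - k" using B.int_pow_eq[OF w(1)] by blast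
        then show "x = y" using kl int_pow_eqI[OF v(1), of l k] o by simp
      qed
      show "\<beta> ` carrier G = carrier B"
      proof
        show "\<beta> ` carrier G \<subseteq> carrier B" unfolding \<beta>_def using w by auto
        show "carrier B \<subseteq> \<beta> ` carrier G"
        proof
          fix u assume "u \<in> carrier B"
          then obtain k :: int where "u = w [^]\<^bsub>B\<^esub> k" using exB by blast
          then show "u \<in> \<beta> ` carrier G" using \<beta>[of k] v(1) by (metis imageI int_pow_closed)
        qed
      qed
    qed
  qed
  then show thesis using that \<beta> by blast
qed

text \<open>For faithful actions of groups of equal order this already makes \<open>K\<close> and \<open>K'\<close> isomorphic.\<close>

definition equivariant_iso where
  "equivariant_iso K A \<phi> K' A' \<phi>' \<beta> \<longleftrightarrow> \<beta> \<in> iso A A' \<and>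
     (\<forall>g\<in>carrier K. \<exists>g'\<in>carrier K'. \<forall>v\<in>carrier A. \<beta> (\<phi> g v) = \<phi>' g' (\<beta> v))"

context fpf_action
begin

text \<open>Being a subgroup, the implementable elements have to be exhibited only on generators or
  on more than half of \<open>K\<close>.\<close>

lemma implementable_subgroup:
  assumes "fpf_action K' A' \<phi>'" and \<beta>: "\<beta> \<in> iso A A'"
  shows "subgroup {g \<in> carrier K. \<exists>g'\<in>carrier K'. \<forall>v\<in>carrier A. \<beta> (\<phi> g v) = \<phi>' g' (\<beta> v)} K"
    (is "subgroup ?T K")
proof -
  interpret B: fpf_action K' A' \<phi>' by fact
  have \<beta>c: "\<beta> v \<in> carrier A'" if "v \<in> carrier A" for v using \<beta> that unfolding iso_def bij_betw_def by auto
  show ?thesis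
  proof (rule subgroupI)
    show "?T \<subseteq> carrier K" by blast
    have "\<forall>v\<in>carrier A. \<beta> (\<phi> \<one> v) = \<phi>' \<one>\<^bsub>K'\<^esub> (\<beta> v)" using act_one B.act_one \<beta>c by simp
    then have "\<one> \<in> ?T" using B.one_closed one_closed by blast
    then show "?T \<noteq> {}" by blast
  next
    fix g assume "g \<in> ?T"
    then obtain g' where g: "g \<in> carrier K" "g' \<in> carrier K'" "\<And>v. v \<in> carrier A \<Longrightarrow> \<beta> (\<phi> g v) = \<phi>' g' (\<beta> v)"
      by blast
    have "\<beta> (\<phi> (inv g) v) = \<phi>' (inv\<^bsub>K'\<^esub> g') (\<beta> v)" if v: "v \<in> carrier A" for v
    proof -
      have "\<beta> v = \<phi>' g' (\<beta> (\<phi> (inv g) v))"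
        using g(3)[of "\<phi> (inv g) v"] act_inv_cancel[of "inv g" v] g(1) v by simp
      then show ?thesis using B.act_inv_cancel[OF g(2), of "\<beta> (\<phi> (inv g) v)"] \<beta>c g(1) v by simp
    qed
    then show "inv g \<in> ?T" using g by blast
    fix h assume "h \<in> ?T"
    then obtain h' where h: "h \<in> carrier K" "h' \<in> carrier K'" "\<And>v. v \<in> carrier A \<Longrightarrow> \<beta> (\<phi> h v) = \<phi>' h' (\<beta> v)"
      by blast
    have "\<beta> (\<phi> (g \<otimes> h) v) = \<phi>' (g' \<otimes>\<^bsub>K'\<^esub> h') (\<beta> v)" if v: "v \<in> carrier A" for v
      using act_mult[OF g(1) h(1) v] B.act_mult[OF g(2) h(2)] \<beta>c g(3) h(1,3) v by simp
    then show "g \<otimes> h \<in> ?T" using g h by blast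
  qed
qed

text \<open>By Lagrange it suffices to implement more than half of \<open>K\<close>.\<close>

lemma equivariant_isoI:
  assumes B: "fpf_action K' A' \<phi>'" and \<beta>: "\<beta> \<in> iso A A'"
    and F: "F \<subseteq> carrier K" "card (carrier K) < 2 * card F"
    and impl: "\<And>g. g \<in> F \<Longrightarrow> \<exists>g'\<in>carrier K'. \<forall>v\<in>carrier A. \<beta> (\<phi> g v) = \<phi>' g' (\<beta> v)"
  shows "equivariant_iso K A \<phi> K' A' \<phi>' \<beta>"
proof -
  let ?T = "{g \<in> carrier K. \<exists>g'\<in>carrier K'. \<forall>v\<in>carrier A. \<beta> (\<phi> g v) = \<phi>' g' (\<beta> v)}"
  have T: "subgroup ?T K" using implementable_subgroup[OF B \<beta>] .
  have "F \<subseteq> ?T" using F(1) impl by blast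
  then have "card F \<le> card ?T" using finite_K by (intro card_mono) auto
  obtain k where k: "card (carrier K) = card ?T * k"
    using subgroup_card_dvd[OF T finite_K] unfolding order_def by (auto elim: dvdE)
  have "k < 2"
  proof (rule ccontr)
    assume "\<not> k < 2"
    then have "card ?T * 2 \<le> card (carrier K)" unfolding k by (intro mult_left_mono) auto
    then show False using F(2) \<open>card F \<le> card ?T\<close> by simp
  qed
  moreover have "k \<noteq> 0"
  proof
    assume "k = 0"
    then have "card (carrier K) = 0" using k by simp
    then show False using finite_K one_closed by auto
  qed
  ultimately have "k = 1" by simp
  then have "card ?T = card (carrier K)" using k by simp
  then have "?T = carrier K" using finite_K by (intro card_subset_eq) auto
  then show ?thesis unfolding equivariant_iso_def using \<beta> by blast
qed

lemma act_power_on_generator: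
  assumes g: "g \<in> carrier K" and v: "v \<in> carrier A" and c: "\<phi> g v = v [^]\<^bsub>A\<^esub> (a::int)"
  shows "\<phi> (g [^] (n::nat)) v = v [^]\<^bsub>A\<^esub> (a ^ n)"
proof (induction n)
  case (Suc n)
  have "\<phi> (g [^] Suc n) v = \<phi> (g [^] n) v [^]\<^bsub>A\<^esub> a"
    using act_mult[of "g [^] n" g v] g v c act_int_pow[of "g [^] n" v a] by simp
  then show ?case using Suc v by (simp add: A.int_pow_pow mult.commute)
qed (use act_one v in simp)

text \<open>The orbit of \<open>v\<close> is regular, so it already has as many elements as there
  are nontrivial ones.\<close>

lemma surj_on_nontrivial:
  assumes "card (carrier A) = card (carrier K) + 1" and v: "v \<in> carrier A" "v \<noteq> \<one>\<^bsub>A\<^esub>"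
    and u: "u \<in> carrier A" "u \<noteq> \<one>\<^bsub>A\<^esub>"
  obtains g where "g \<in> carrier K" "\<phi> g v = u"
proof -
  have "(\<lambda>g. \<phi> g v) ` carrier K = carrier A - {\<one>\<^bsub>A\<^esub>}"
  proof (rule card_subset_eq)
    show "(\<lambda>g. \<phi> g v) ` carrier K \<subseteq> carrier A - {\<one>\<^bsub>A\<^esub>}" using v act_eq_one_iff by auto
    have "inj_on (\<lambda>g. \<phi> g v) (carrier K)" using act_inj v by (auto intro!: inj_onI)
    then show "card ((\<lambda>g. \<phi> g v) ` carrier K) = card (carrier A - {\<one>\<^bsub>A\<^esub>})"
      using assms(1) finite_A by (simp add: card_image card_Diff_singleton)
  qed (use finite_A in simp)
  then have "u \<in> (\<lambda>g. \<phi> g v) ` carrier K" using u by simp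
  then show thesis using that by (elim imageE) simp
qed

end

lemma cube_mod_7:
  fixes a :: int
  assumes "7 dvd a ^ 3 - 1"
  shows "7 dvd a - 1 \<or> 7 dvd a - 2 \<or> 7 dvd a - 4"
proof -
  define q r where "q = a div 7" and "r = a mod 7"
  have a: "a = 7 * q + r" unfolding q_def r_def by simp
  have "r ^ 3 - 1 = (a ^ 3 - 1) - 7 * (49 * q ^ 3 + 21 * q ^ 2 * r + 3 * q * r ^ 2)"
    unfolding a by (simp add: algebra_simps power2_eq_square power3_eq_cube)
  then have "7 dvd r ^ 3 - 1" using dvd_diff[OF assms dvd_triv_left] by metis
  moreover have "r = 0 \<or> r = 1 \<or> r = 2 \<or> r = 3 \<or> r = 4 \<or> r = 5 \<or> r = 6"
    unfolding q_def r_def by presburger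
  ultimately have "r = 1 \<or> r = 2 \<or> r = 4" by auto
  then show ?thesis using a by auto
qed

text \<open>\<open>\<beta>\<close> takes a generator to a generator, so \<open>K'\<close> has to
  contain an element with the same exponent \<open>a\<close> as \<open>g\<close>. For trivial
  \<open>K\<close> the exponent is 1; if \<open>K'\<close> is sharply transitive, every nontrivial
  power occurs; for \<open>(7, 3)\<close> both groups act by the cube roots of unity 1, 2, 4 modulo
  7.\<close>

lemma equivariant_iso_prime:
  assumes "fpf_action K A \<phi>" "fpf_action K' A' \<phi>'"
    and p: "Factorial_Ring.prime (card (carrier A))" "card (carrier A') = card (carrier A)"
    and k: "card (carrier K') = card (carrier K)"
    and c: "card (carrier K) = 1 \<or> card (carrier A) = card (carrier K) + 1 \<or>
      card (carrier A) = 7 \<and> card (carrier K) = 3"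
  shows "\<exists>\<beta>. equivariant_iso K A \<phi> K' A' \<phi>' \<beta>"
proof -
  interpret V: fpf_action K A \<phi> by fact
  interpret W: fpf_action K' A' \<phi>' by fact
  obtain v where v: "v \<in> carrier A" "v \<noteq> \<one>\<^bsub>A\<^esub>" using V.ex_nontriv by blast
  obtain w where w: "w \<in> carrier A'" "w \<noteq> \<one>\<^bsub>A'\<^esub>" using W.ex_nontriv by blast
  note gv = V.generator_of_prime_card[OF p(1) v]
  have gw: "W.A.ord w = card (carrier A)" "carrier A' = generate A' {w}"
    using W.generator_of_prime_card[OF _ w] p by simp_all
  have vk: "\<exists>k::int. u = v [^]\<^bsub>A\<^esub> k" if "u \<in> carrier A" for u
    using that V.A.mem_generate_iff[OF v(1), of u] unfolding gv(2)[symmetric] by simp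
  have wk: "\<exists>k::int. u = w [^]\<^bsub>A'\<^esub> k" if "u \<in> carrier A'" for u
    using that W.A.mem_generate_iff[OF w(1), of u] unfolding gw(2)[symmetric] by simp
  obtain \<beta> where \<beta>: "\<beta> \<in> iso A A'" "\<And>k::int. \<beta> (v [^]\<^bsub>A\<^esub> k) = w [^]\<^bsub>A'\<^esub> k"
    using V.A.power_map_iso[OF W.A.comm_group_axioms v(1) gv(2) w(1) gw(2)] gv(1) gw(1) by metis
  have "equivariant_iso K A \<phi> K' A' \<phi>' \<beta>"
    unfolding equivariant_iso_def
  proof (intro conjI ballI \<beta>(1))
    fix g assume g: "g \<in> carrier K"
    obtain a :: int where a: "\<phi> g v = v [^]\<^bsub>A\<^esub> a"
      using vk[OF V.act_closed[OF g v(1)]] by blast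
    have wa: "w [^]\<^bsub>A'\<^esub> b = w [^]\<^bsub>A'\<^esub> a" if "int (card (carrier A)) dvd b - a" for b
      using W.A.int_pow_eqI[OF w(1), of b a] gw(1) that by simp
    have pow_g: "int (card (carrier A)) dvd a ^ n - 1" if "g [^]\<^bsub>K\<^esub> n = \<one>\<^bsub>K\<^esub>" for n :: nat
    proof -
      have "v [^]\<^bsub>A\<^esub> (1::int) = v [^]\<^bsub>A\<^esub> (a ^ n)"
        using V.act_power_on_generator[OF g v(1) a, of n] that V.act_one v by simp
      then show ?thesis using V.A.int_pow_eq[OF v(1)] gv(1) by simp
    qed
    have "\<exists>g'\<in>carrier K'. \<phi>' g' w = w [^]\<^bsub>A'\<^esub> a"
      using c
    proof (elim disjE conjE)
      assume "card (carrier K) = 1"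
      then obtain x where "carrier K = {x}" by (rule card_1_singletonE)
      then have "g \<in> {x}" "\<one>\<^bsub>K\<^esub> \<in> {x}" using g V.one_closed by blast+
      then have "g = \<one>\<^bsub>K\<^esub>" by simp
      then have "int (card (carrier A)) dvd a - 1" using pow_g[of 1] by simp
      then have "int (card (carrier A)) dvd 1 - a" using dvd_diff_commute by blast
      then have "\<phi>' \<one>\<^bsub>K'\<^esub> w = w [^]\<^bsub>A'\<^esub> a" using wa[of 1] W.act_one w by simp
      then show ?thesis using W.one_closed by blast
    next
      assume "card (carrier A) = card (carrier K) + 1"
      moreover have "w [^]\<^bsub>A'\<^esub> a \<noteq> \<one>\<^bsub>A'\<^esub>"
      proof
        assume "w [^]\<^bsub>A'\<^esub> a = \<one>\<^bsub>A'\<^esub>"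
        then have "int (V.A.ord v) dvd a" using W.A.int_pow_eq_id[OF w(1)] gw(1) gv(1) by simp
        then have "\<phi> g v = \<one>\<^bsub>A\<^esub>" using V.A.int_pow_eq_id[OF v(1)] a by simp
        then show False using V.act_eq_one_iff[OF g v(1)] v by simp
      qed
      ultimately show ?thesis using W.surj_on_nontrivial[OF _ w, of "w [^]\<^bsub>A'\<^esub> a"] p k w by auto
    next
      assume 73: "card (carrier A) = 7" "card (carrier K) = 3"
      have "7 dvd a ^ 3 - 1" using pow_g[of 3] V.pow_order_eq_1[OF g] 73 by (simp add: order_def)
      then have a124: "7 dvd a - 1 \<or> 7 dvd a - 2 \<or> 7 dvd a - 4" by (rule cube_mod_7)
      \<comment> \<open>A nontrivial \<open>h\<close> acts with an exponent congruent to 2 or 4, and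
        the powers of either run through 1, 2 and 4 modulo 7.\<close>
      obtain h where h: "h \<in> carrier K'" "h \<noteq> \<one>\<^bsub>K'\<^esub>"
        using k 73(2) card_mono[of "{\<one>\<^bsub>K'\<^esub>}" "carrier K'"] by auto
      obtain b :: int where b: "\<phi>' h w = w [^]\<^bsub>A'\<^esub> b"
        using wk[OF W.act_closed[OF h(1) w(1)]] by blast
      have pw: "\<phi>' (h [^]\<^bsub>K'\<^esub> n) w = w [^]\<^bsub>A'\<^esub> (b ^ n)" for n :: nat
        using W.act_power_on_generator[OF h(1) w(1) b] .
      have "w [^]\<^bsub>A'\<^esub> (1::int) = w [^]\<^bsub>A'\<^esub> (b ^ 3)"
        using pw[of 3] W.pow_order_eq_1[OF h(1)] k 73(2) W.act_one w by (simp add: order_def)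
      then have "7 dvd b ^ 3 - 1" using W.A.int_pow_eq[OF w(1), of 1 "b ^ 3"] gw(1) 73(1) by simp
      then have "7 dvd b - 1 \<or> 7 dvd b - 2 \<or> 7 dvd b - 4" by (rule cube_mod_7)
      moreover have "\<not> 7 dvd b - 1"
      proof
        assume "7 dvd b - 1"
        then have "\<phi>' h w = w" using b W.A.int_pow_eqI[OF w(1), of b 1] gw(1) 73(1) w by simp
        then show False using W.fpf[OF h w(1)] w by simp
      qed
      ultimately have b24: "7 dvd b - 2 \<or> 7 dvd b - 4" by blast
      have "\<exists>n::nat. 7 dvd b ^ n - a"
      proof -
        have "7 dvd b ^ 0 - a \<or> 7 dvd b ^ 1 - a \<or> 7 dvd b ^ 2 - a"
        proof (cases "7 dvd b - 2")
          case True
          have "b ^ 2 - 4 = (b - 2) * (b + 2)" by (simp add: algebra_simps power2_eq_square)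
          then have "7 dvd b ^ 2 - 4" using True by simp
          then show ?thesis using a124 True by simp presburger
        next
          case False
          then have 4: "7 dvd b - 4" using b24 by blast
          have "b ^ 2 - 16 = (b - 4) * (b + 4)" by (simp add: algebra_simps power2_eq_square)
          then have "7 dvd b ^ 2 - 16" using 4 by simp
          then show ?thesis using a124 4 by simp presburger
        qed
        then show ?thesis by blast
      qed
      then obtain n :: nat where "7 dvd b ^ n - a" by blast
      then have "\<phi>' (h [^]\<^bsub>K'\<^esub> n) w = w [^]\<^bsub>A'\<^esub> a" using pw wa[of "b ^ n"] 73(1) by simp
      then show ?thesis using h by blast
    qed
    then obtain g' where g': "g' \<in> carrier K'" "\<phi>' g' w = w [^]\<^bsub>A'\<^esub> a" by blast
    have "\<beta> (\<phi> g u) = \<phi>' g' (\<beta> u)" if u: "u \<in> carrier A" for u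
    proof -
      obtain m :: int where "u = v [^]\<^bsub>A\<^esub> m" using vk[OF u] by blast
      then show ?thesis using V.act_int_pow[OF g v(1)] a \<beta>(2) W.act_int_pow[OF g'(1) w(1)] g'(2)
          V.A.int_pow_pow[OF v(1)] W.A.int_pow_pow[OF w(1)] by simp
    qed
    then show "\<exists>g'\<in>carrier K'. \<forall>u\<in>carrier A. \<beta> (\<phi> g u) = \<phi>' g' (\<beta> u)" using g'(1) by blast
  qed
  then show ?thesis by blast
qed

section \<open>Normal forms of the actions of type (4, 3) and (9, 8)\<close>

context fpf_action
begin

text \<open>A nontrivial \<open>g\<close> permutes the three nontrivial elements of \<open>A\<close>
  cyclically. One of them is an involution by Cauchy, and \<open>K\<close> is transitive on them, so
  \<open>A\<close> is the Klein four-group.\<close>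

lemma structure_4_3:
  assumes cA: "card (carrier A) = 4" and cK: "card (carrier K) = 3"
  obtains g a b c where "g \<in> carrier K" "g \<noteq> \<one>" "carrier A = {\<one>\<^bsub>A\<^esub>, a, b, c}"
    "distinct [\<one>\<^bsub>A\<^esub>, a, b, c]" "\<phi> g a = b" "\<phi> g b = c" "\<phi> g c = a"
    "a \<otimes>\<^bsub>A\<^esub> b = c" "b \<otimes>\<^bsub>A\<^esub> c = a" "a \<otimes>\<^bsub>A\<^esub> c = b"
    "a \<otimes>\<^bsub>A\<^esub> a = \<one>\<^bsub>A\<^esub>" "b \<otimes>\<^bsub>A\<^esub> b = \<one>\<^bsub>A\<^esub>" "c \<otimes>\<^bsub>A\<^esub> c = \<one>\<^bsub>A\<^esub>"
proof -
  obtain g where g: "g \<in> carrier K" "g \<noteq> \<one>"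
    using cK card_mono[of "{\<one>}" "carrier K"] by auto
  have g3: "g \<otimes> (g \<otimes> g) = \<one>"
    using pow_order_eq_1[OF g(1)] cK g by (simp add: order_def eval_nat_numeral m_assoc)
  obtain a where a: "a \<in> carrier A" "a \<noteq> \<one>\<^bsub>A\<^esub>" using ex_nontriv by blast
  define b where "b = \<phi> g a"
  define c where "c = \<phi> g b"
  have bc: "b \<in> carrier A" "b \<noteq> \<one>\<^bsub>A\<^esub>" "c \<in> carrier A" "c \<noteq> \<one>\<^bsub>A\<^esub>"
    unfolding b_def c_def using g a act_eq_one_iff by auto
  have gc: "\<phi> g c = a"
    unfolding c_def b_def using g a g3 act_mult[of g "g \<otimes> g" a] act_mult[of g g a] act_one by simp
  have ne: "a \<noteq> b" "b \<noteq> c" "c \<noteq> a"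
    using fpf[OF g] a bc gc unfolding b_def c_def by metis+
  have A: "carrier A = {\<one>\<^bsub>A\<^esub>, a, b, c}"
    by (rule card_subset_eq[symmetric]) (use finite_A a bc ne cA in auto)
  have sq: "x \<otimes>\<^bsub>A\<^esub> x = \<one>\<^bsub>A\<^esub>" if x: "x \<in> carrier A" for x
  proof (rule ccontr)
    assume n: "x \<otimes>\<^bsub>A\<^esub> x \<noteq> \<one>\<^bsub>A\<^esub>"
    then have xne: "x \<noteq> \<one>\<^bsub>A\<^esub>" by auto
    obtain e where e: "e \<in> carrier A" "e \<noteq> \<one>\<^bsub>A\<^esub>" "e \<otimes>\<^bsub>A\<^esub> e = \<one>\<^bsub>A\<^esub>"
    proof -
      have "2 dvd order A" using cA by (simp add: order_def)
      from A.cauchy[OF finite_A two_is_prime_nat this] that show thesis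
        by (metis A.nat_pow_0 A.nat_pow_Suc A.l_one numeral_2_eq_2)
    qed
    have "card (carrier A) = card (carrier K) + 1" using cA cK by simp
    then obtain h where h: "h \<in> carrier K" "\<phi> h e = x" using surj_on_nontrivial e x xne by metis
    then have "x \<otimes>\<^bsub>A\<^esub> x = \<phi> h (e \<otimes>\<^bsub>A\<^esub> e)"
      using group_hom.hom_mult[OF act_group_hom[OF h(1)] e(1) e(1)] by simp
    also have "\<dots> = \<one>\<^bsub>A\<^esub>" using e group_hom.hom_one[OF act_group_hom[OF h(1)]] by simp
    finally show False using n by simp
  qed
  have third: "x \<otimes>\<^bsub>A\<^esub> y = w" if "carrier A = {\<one>\<^bsub>A\<^esub>, x, y, w}" "x \<noteq> \<one>\<^bsub>A\<^esub>" "y \<noteq> \<one>\<^bsub>A\<^esub>" "x \<noteq> y" for x y w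
  proof -
    have xy: "x \<in> carrier A" "y \<in> carrier A" using that(1) by auto
    have "x \<otimes>\<^bsub>A\<^esub> y \<noteq> x" "x \<otimes>\<^bsub>A\<^esub> y \<noteq> y" using that xy by simp_all
    moreover have "x \<otimes>\<^bsub>A\<^esub> y \<noteq> \<one>\<^bsub>A\<^esub>"
    proof
      assume "x \<otimes>\<^bsub>A\<^esub> y = \<one>\<^bsub>A\<^esub>"
      then have "x \<otimes>\<^bsub>A\<^esub> y = x \<otimes>\<^bsub>A\<^esub> x" using sq xy by simp
      then show False using xy that(4) by simp
    qed
    moreover have "x \<otimes>\<^bsub>A\<^esub> y \<in> {\<one>\<^bsub>A\<^esub>, x, y, w}" using xy that(1) A.m_closed by blast
    ultimately show ?thesis by blast
  qed
  show thesis
  proof (rule that[OF g A])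
    show "a \<otimes>\<^bsub>A\<^esub> b = c" by (rule third) (use A a bc ne in auto)
    show "b \<otimes>\<^bsub>A\<^esub> c = a" by (rule third) (use A a bc ne in auto)
    show "a \<otimes>\<^bsub>A\<^esub> c = b" by (rule third) (use A a bc ne in auto)
  qed (use a bc ne gc sq b_def c_def in auto)
qed

text \<open>\<open>v, w\<close> form a basis of \<open>A\<close> over \<open>\<int>/3\<close>, and \<open>i\<close>, \<open>j\<close> act by the matrices generating \<open>Q\<^sub>8\<close> in \<open>M(9)\<close>.\<close>

lemma structure_9_8:
  assumes cA: "card (carrier A) = 9" and cK: "card (carrier K) = 8"
    and exp4: "\<And>g. g \<in> carrier K \<Longrightarrow> g [^] (4::nat) = \<one>"
  obtains i j v w where "i \<in> carrier K" "j \<in> carrier K" "i \<otimes> i \<noteq> \<one>" "j \<notin> {\<one>, i, i \<otimes> i, i \<otimes> (i \<otimes> i)}"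
    "v \<in> carrier A" "w \<in> carrier A" "A.ord v = 3" "A.ord w = 3" "w \<notin> generate A {v}"
    "\<phi> i v = w" "\<phi> i w = inv\<^bsub>A\<^esub> v" "\<phi> j v = v \<otimes>\<^bsub>A\<^esub> w" "\<phi> j w = v \<otimes>\<^bsub>A\<^esub> inv\<^bsub>A\<^esub> w"
proof -
  have c98: "card (carrier A) = card (carrier K) + 1" using cA cK by simp
  obtain i where i: "i \<in> carrier K" "i \<otimes> i \<noteq> \<one>"
    using ex_square_nontrivial[OF subgroup_self, of "{}"] cK by auto
  \<comment> \<open>The square of \<open>i\<close> is the involution and acts as -1. Since -1 is not
    a square modulo 3, the vectors \<open>v\<close> and \<open>\<phi> i v\<close> will be
    independent.\<close>
  define z where "z = i \<otimes> i"
  have z: "z \<in> carrier K" "z \<noteq> \<one>" "z \<otimes> z = \<one>"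
    unfolding z_def using i exp4[OF i(1)] by (simp_all add: eval_nat_numeral m_assoc)
  have zinv: "\<phi> z u = inv\<^bsub>A\<^esub> u" if "u \<in> carrier A" for u using involution_inverts[OF z that] .
  obtain e where e: "e \<in> carrier A" "e \<noteq> \<one>\<^bsub>A\<^esub>" "e [^]\<^bsub>A\<^esub> (3::nat) = \<one>\<^bsub>A\<^esub>"
    using A.cauchy[OF finite_A, of 3] cA by (auto simp: order_def)
  have cube: "u [^]\<^bsub>A\<^esub> (3::nat) = \<one>\<^bsub>A\<^esub>" if u: "u \<in> carrier A" "u \<noteq> \<one>\<^bsub>A\<^esub>" for u
  proof -
    obtain h where h: "h \<in> carrier K" "\<phi> h e = u" using surj_on_nontrivial[OF c98 e(1,2) u] by blast
    then have "u [^]\<^bsub>A\<^esub> (3::nat) = \<phi> h (e [^]\<^bsub>A\<^esub> (3::nat))"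
      using group_hom.hom_nat_pow[OF act_group_hom[OF h(1)] e(1)] by simp
    also have "\<dots> = \<one>\<^bsub>A\<^esub>" using e group_hom.hom_one[OF act_group_hom[OF h(1)]] by simp
    finally show ?thesis .
  qed
  define v where "v = e"
  have v: "v \<in> carrier A" "v \<noteq> \<one>\<^bsub>A\<^esub>" unfolding v_def using e by auto
  define w where "w = \<phi> i v"
  have w: "w \<in> carrier A" "w \<noteq> \<one>\<^bsub>A\<^esub>" unfolding w_def using i v act_eq_one_iff by auto
  have ords: "A.ord v = 3" "A.ord w = 3" using A.ord_eq_prime[of _ 3] cube v w by auto
  have iw: "\<phi> i w = inv\<^bsub>A\<^esub> v" unfolding w_def using act_mult[of i i v] i v zinv z_def by simp
  have iinv: "\<phi> i (inv\<^bsub>A\<^esub> v) = inv\<^bsub>A\<^esub> w" using group_hom.hom_inv[OF act_group_hom[OF i(1)] v(1)] w_def by simp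
  have vv: "u \<otimes>\<^bsub>A\<^esub> u = inv\<^bsub>A\<^esub> u" if "u \<in> carrier A" "u \<noteq> \<one>\<^bsub>A\<^esub>" for u
    using cube[OF that] that by (intro A.inv_equality[symmetric]) (simp_all add: eval_nat_numeral A.m_assoc)
  have ine: "i \<noteq> \<one>" using i by auto
  have wnv: "w \<noteq> v" using fpf[OF i(1) ine v(1)] v w_def by auto
  have wniv: "w \<noteq> inv\<^bsub>A\<^esub> v"
  proof
    assume *: "w = inv\<^bsub>A\<^esub> v"
    then have "inv\<^bsub>A\<^esub> v = inv\<^bsub>A\<^esub> w" using iw iinv by simp
    then show False using * v w wnv by (metis A.inv_inv)
  qed
  have wn: "w \<notin> generate A {v}"
  proof
    assume "w \<in> generate A {v}"
    then obtain k :: int where k: "w = v [^]\<^bsub>A\<^esub> k" using A.mem_generate_iff[OF v(1)] by blast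
    have "k mod 3 = 0 \<or> k mod 3 = 1 \<or> k mod 3 = 2" by presburger
    then have "3 dvd 0 - k \<or> 3 dvd 1 - k \<or> 3 dvd - 1 - k" by presburger
    then have "v [^]\<^bsub>A\<^esub> k = v [^]\<^bsub>A\<^esub> (0::int) \<or> v [^]\<^bsub>A\<^esub> k = v [^]\<^bsub>A\<^esub> (1::int) \<or> v [^]\<^bsub>A\<^esub> k = v [^]\<^bsub>A\<^esub> (- 1 :: int)"
      using A.int_pow_eqI[OF v(1), of 0 k] A.int_pow_eqI[OF v(1), of 1 k] A.int_pow_eqI[OF v(1), of "- 1" k]
        ords(1) by auto
    then show False using k w wnv wniv v by (auto simp: A.int_pow_neg)
  qed
  have vw: "v \<otimes>\<^bsub>A\<^esub> w \<in> carrier A" "v \<otimes>\<^bsub>A\<^esub> w \<noteq> \<one>\<^bsub>A\<^esub>"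
    using v w wniv A.inv_equality[of w v] A.m_comm[of v w] by auto
  \<comment> \<open>Sharp transitivity allows the image of \<open>v\<close> to be prescribed; this
    is the first column of the matrix \<open>Q8j\<close>.\<close>
  obtain j where j: "j \<in> carrier K" "\<phi> j v = v \<otimes>\<^bsub>A\<^esub> w" using surj_on_nontrivial[OF c98 v vw] by blast
  have j1: "j \<noteq> \<one>" using j act_one v w by auto
  have jz: "j \<noteq> z"
  proof
    assume "j = z"
    then have "inv\<^bsub>A\<^esub> v = v \<otimes>\<^bsub>A\<^esub> w" using j zinv v by simp
    then have "v \<otimes>\<^bsub>A\<^esub> v = v \<otimes>\<^bsub>A\<^esub> w" using vv[OF v] by simp
    then show False using v w wnv by simp
  qed
  have ji: "j \<noteq> i"
  proof
    assume "j = i"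
    then have "v \<otimes>\<^bsub>A\<^esub> w = w" using j w_def by simp
    then show False using v w by simp
  qed
  have jiz: "j \<noteq> i \<otimes> z"
  proof
    assume "j = i \<otimes> z"
    then have "v \<otimes>\<^bsub>A\<^esub> w = inv\<^bsub>A\<^esub> w" using j act_mult[OF i(1) z(1) v(1)] zinv[OF v(1)] iinv by simp
    then have "v \<otimes>\<^bsub>A\<^esub> w = w \<otimes>\<^bsub>A\<^esub> w" using vv[OF w] by simp
    then show False using v w wnv by simp
  qed
  have jn: "j \<notin> {\<one>, i \<otimes> i, i, i \<otimes> (i \<otimes> i)}" using j1 jz ji jiz unfolding z_def by blast
  have conj: "cj j i = i \<or> cj j i = i \<otimes> (i \<otimes> i)" "i \<otimes> j = j \<otimes> i \<Longrightarrow> j \<in> {\<one>, i \<otimes> i, i, i \<otimes> (i \<otimes> i)}"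
    using conj_of_order_4[OF subgroup_self _ i j(1)] exp4 by blast+
  \<comment> \<open>\<open>j\<close> is no power of \<open>i\<close>, so it inverts
    \<open>i\<close>. The resulting relation \<open>i j = j i^-1\<close>, applied to
    \<open>v\<close>, determines the image of \<open>w\<close>, the second column.\<close>
  have "cj j i \<noteq> i" using conj(2) jn cj_eq_self_iff[OF j(1) i(1)] by blast
  then have "i \<otimes> j = j \<otimes> (i \<otimes> z)" using conj(1) cj_eq_iff[OF j(1) i(1)] i z_def by simp
  then have "\<phi> i (\<phi> j v) = \<phi> j (\<phi> i (\<phi> z v))"
    using act_mult[OF i(1) j(1) v(1)] act_mult[OF j(1) _ v(1), of "i \<otimes> z"] act_mult[OF i(1) z(1) v(1)] i z by simp
  then have "w \<otimes>\<^bsub>A\<^esub> inv\<^bsub>A\<^esub> v = \<phi> j (inv\<^bsub>A\<^esub> w)"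
    using j zinv[OF v(1)] iinv group_hom.hom_mult[OF act_group_hom[OF i(1)] v(1) w(1)] w_def iw by simp
  also have "\<dots> = inv\<^bsub>A\<^esub> (\<phi> j w)" using group_hom.hom_inv[OF act_group_hom[OF j(1)] w(1)] .
  finally have "\<phi> j w = inv\<^bsub>A\<^esub> (w \<otimes>\<^bsub>A\<^esub> inv\<^bsub>A\<^esub> v)" using j w by (metis A.inv_inv act_closed)
  also have "\<dots> = v \<otimes>\<^bsub>A\<^esub> inv\<^bsub>A\<^esub> w" using v w by (simp add: A.inv_mult_group)
  finally have jw: "\<phi> j w = v \<otimes>\<^bsub>A\<^esub> inv\<^bsub>A\<^esub> w" .
  show thesis
    by (rule that[of i j v w]) (use i j jn v w ords wn iw jw w_def in auto)
qed

end

text \<open>The normal forms have identical tables, from which \<open>\<beta>\<close> is read off;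
  \<open>\<one>\<close> and \<open>g\<close> are already more than half of the three elements of
  \<open>K\<close>.\<close>

lemma equivariant_iso_4_3:
  assumes "fpf_action K A \<phi>" "fpf_action K' A' \<phi>'"
    and "card (carrier A) = 4" "card (carrier K) = 3" "card (carrier A') = 4" "card (carrier K') = 3"
  shows "\<exists>\<beta>. equivariant_iso K A \<phi> K' A' \<phi>' \<beta>"
proof -
  interpret V: fpf_action K A \<phi> by fact
  interpret W: fpf_action K' A' \<phi>' by fact
  obtain g a b c where V: "g \<in> carrier K" "g \<noteq> \<one>\<^bsub>K\<^esub>" "carrier A = {\<one>\<^bsub>A\<^esub>, a, b, c}"
    "distinct [\<one>\<^bsub>A\<^esub>, a, b, c]" "\<phi> g a = b" "\<phi> g b = c" "\<phi> g c = a"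
    "a \<otimes>\<^bsub>A\<^esub> b = c" "b \<otimes>\<^bsub>A\<^esub> c = a" "a \<otimes>\<^bsub>A\<^esub> c = b"
    "a \<otimes>\<^bsub>A\<^esub> a = \<one>\<^bsub>A\<^esub>" "b \<otimes>\<^bsub>A\<^esub> b = \<one>\<^bsub>A\<^esub>" "c \<otimes>\<^bsub>A\<^esub> c = \<one>\<^bsub>A\<^esub>"
    using V.structure_4_3 assms(3,4) by metis
  obtain g' a' b' c' where W: "g' \<in> carrier K'" "g' \<noteq> \<one>\<^bsub>K'\<^esub>" "carrier A' = {\<one>\<^bsub>A'\<^esub>, a', b', c'}"
    "distinct [\<one>\<^bsub>A'\<^esub>, a', b', c']" "\<phi>' g' a' = b'" "\<phi>' g' b' = c'" "\<phi>' g' c' = a'"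
    "a' \<otimes>\<^bsub>A'\<^esub> b' = c'" "b' \<otimes>\<^bsub>A'\<^esub> c' = a'" "a' \<otimes>\<^bsub>A'\<^esub> c' = b'"
    "a' \<otimes>\<^bsub>A'\<^esub> a' = \<one>\<^bsub>A'\<^esub>" "b' \<otimes>\<^bsub>A'\<^esub> b' = \<one>\<^bsub>A'\<^esub>" "c' \<otimes>\<^bsub>A'\<^esub> c' = \<one>\<^bsub>A'\<^esub>"
    using W.structure_4_3 assms(5,6) by metis
  have in_A: "a \<in> carrier A" "b \<in> carrier A" "c \<in> carrier A" unfolding V(3) by auto
  have in_A': "a' \<in> carrier A'" "b' \<in> carrier A'" "c' \<in> carrier A'" unfolding W(3) by auto
  have cV: "b \<otimes>\<^bsub>A\<^esub> a = c" "c \<otimes>\<^bsub>A\<^esub> b = a" "c \<otimes>\<^bsub>A\<^esub> a = b"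
    using V.A.m_comm in_A V(8-10) by metis+
  have cW: "b' \<otimes>\<^bsub>A'\<^esub> a' = c'" "c' \<otimes>\<^bsub>A'\<^esub> b' = a'" "c' \<otimes>\<^bsub>A'\<^esub> a' = b'"
    using W.A.m_comm in_A' W(8-10) by metis+
  define \<beta> where "\<beta> x = (if x = \<one>\<^bsub>A\<^esub> then \<one>\<^bsub>A'\<^esub> else if x = a then a' else if x = b then b' else c')" for x
  have \<beta>v: "\<beta> \<one>\<^bsub>A\<^esub> = \<one>\<^bsub>A'\<^esub>" "\<beta> a = a'" "\<beta> b = b'" "\<beta> c = c'" unfolding \<beta>_def using V(4) by auto
  have "\<beta> \<in> iso A A'"
  proof (rule isoI)
    show "\<beta> \<in> hom A A'"
    proof (rule homI)
      show "\<beta> x \<in> carrier A'" if "x \<in> carrier A" for x using that \<beta>v unfolding V(3) W(3) by auto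
      fix x y assume "x \<in> carrier A" "y \<in> carrier A"
      then have "x \<in> {\<one>\<^bsub>A\<^esub>, a, b, c}" "y \<in> {\<one>\<^bsub>A\<^esub>, a, b, c}" unfolding V(3) .
      then show "\<beta> (x \<otimes>\<^bsub>A\<^esub> y) = \<beta> x \<otimes>\<^bsub>A'\<^esub> \<beta> y"
        using in_A in_A' by (elim insertE emptyE) (simp_all add: \<beta>v V(8-13) W(8-13) cV cW)
    qed
    have "inj_on \<beta> (carrier A)" unfolding V(3) using \<beta>v W(4) by (auto simp: inj_on_def)
    moreover have "\<beta> ` carrier A = carrier A'" unfolding V(3) W(3) using \<beta>v by simp
    ultimately show "bij_betw \<beta> (carrier A) (carrier A')" unfolding bij_betw_def by blast
  qed
  moreover have "\<forall>v\<in>carrier A. \<beta> (\<phi> g v) = \<phi>' g' (\<beta> v)"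
    unfolding V(3) using \<beta>v V W group_hom.hom_one[OF V.act_group_hom[OF V(1)]] group_hom.hom_one[OF W.act_group_hom[OF W(1)]]
    by simp
  moreover have "\<forall>v\<in>carrier A. \<beta> (\<phi> \<one>\<^bsub>K\<^esub> v) = \<phi>' \<one>\<^bsub>K'\<^esub> (\<beta> v)"
    using V.act_one W.act_one calculation(1) unfolding iso_def hom_def by (simp add: Pi_iff)
  ultimately have "equivariant_iso K A \<phi> K' A' \<phi>' \<beta>"
    using V.equivariant_isoI[OF W.fpf_action_axioms, of \<beta> "{\<one>\<^bsub>K\<^esub>, g}"] V(1,2) W(1) assms(4)
      V.one_closed W.one_closed by auto
  then show ?thesis by blast
qed

lemma (in comm_group) rank_two_powers:
  assumes fin: "finite (carrier G)" "card (carrier G) = 9" and v: "v \<in> carrier G" "ord v = 3"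
    and w: "w \<in> carrier G" "ord w = 3" "w \<notin> generate G {v}"
  shows "\<And>u. u \<in> carrier G \<Longrightarrow> \<exists>(x::int) (y::int). u = v [^] x \<otimes> w [^] y"
    and "\<And>(x::int) (y::int) (x'::int) (y'::int). v [^] x \<otimes> w [^] y = v [^] x' \<otimes> w [^] y' \<longleftrightarrow> 3 dvd x' - x \<and> 3 dvd y' - y"
proof -
  show *: "v [^] x \<otimes> w [^] y = v [^] x' \<otimes> w [^] y' \<longleftrightarrow> 3 dvd x' - x \<and> 3 dvd y' - y" for x y x' y' :: int
  proof
    assume "3 dvd x' - x \<and> 3 dvd y' - y"
    then show "v [^] x \<otimes> w [^] y = v [^] x' \<otimes> w [^] y'"
      using int_pow_eqI[OF v(1), of x' x] int_pow_eqI[OF w(1), of y' y] v(2) w(2) by simp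
  next
    assume e: "v [^] x \<otimes> w [^] y = v [^] x' \<otimes> w [^] y'"
    have "w [^] (y' - y) = v [^] (x - x')"
    proof -
      have "v [^] (- x') \<otimes> (v [^] x \<otimes> w [^] y) \<otimes> w [^] (- y) = v [^] (- x') \<otimes> (v [^] x' \<otimes> w [^] y') \<otimes> w [^] (- y)"
        using e by simp
      moreover have "v [^] (- x') \<otimes> (v [^] a \<otimes> w [^] b) \<otimes> w [^] (- y) = v [^] (a - x') \<otimes> w [^] (b - y)" for a b :: int
        using int_pow_mult[OF v(1), of "- x'" a] int_pow_mult[OF w(1), of b "- y"] v(1) w(1) by (simp add: m_assoc)
      ultimately show ?thesis using v(1) w(1) by simp
    qed
    have y: "3 dvd y' - y"
    proof (rule ccontr)
      assume n: "\<not> 3 dvd y' - y"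
      have cop: "coprime (y' - y) (int (ord w))" using prime_coprime_int[of 3 "y' - y"] n w(2) by simp
      obtain k :: int where "(w [^] (y' - y)) [^] k = w" using pow_recover[OF w(1) cop] .
      then have "w = v [^] ((x - x') * k)" using \<open>w [^] (y' - y) = v [^] (x - x')\<close> int_pow_pow[OF v(1)] by simp
      then show False using w(3) mem_generate_iff[OF v(1)] by blast
    qed
    then have "w [^] (y' - y) = \<one>" using int_pow_eq_id[OF w(1)] w(2) by simp
    then have "3 dvd x - x'" using \<open>w [^] (y' - y) = v [^] (x - x')\<close> int_pow_eq_id[OF v(1), of "x - x'"] v(2) by simp
    then show "3 dvd x' - x \<and> 3 dvd y' - y" using y dvd_diff_commute by blast
  qed
  let ?f = "\<lambda>(x::int, y::int). v [^] x \<otimes> w [^] y"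
  have "inj_on ?f ({0..<3} \<times> {0..<3})"
  proof (rule inj_onI, clarify)
    fix x y x' y' :: int
    assume "x \<in> {0..<3}" "y \<in> {0..<3}" "x' \<in> {0..<3}" "y' \<in> {0..<3}" "v [^] x \<otimes> w [^] y = v [^] x' \<otimes> w [^] y'"
    then show "x = x' \<and> y = y'" unfolding * by simp presburger
  qed
  then have "card (?f ` ({0..<3} \<times> {0..<3})) = 9" by (simp add: card_image)
  then have "?f ` ({0..<3} \<times> {0..<3}) = carrier G"
    by (intro card_subset_eq) (use fin v w in auto)
  then show "\<exists>(x::int) (y::int). u = v [^] x \<otimes> w [^] y" if "u \<in> carrier G" for u
  proof -
    have "u \<in> ?f ` ({0..<3} \<times> {0..<3})" using that \<open>?f ` ({0..<3} \<times> {0..<3}) = carrier G\<close> by simp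
    then show ?thesis by auto
  qed
qed

text \<open>In coordinates for the bases \<open>v, w\<close> and \<open>v', w'\<close>, both
  \<open>i\<close> and \<open>i'\<close> send \<open>(x, y)\<close> to \<open>(- y, x)\<close>, and
  both \<open>j\<close> and \<open>j'\<close> send it to \<open>(x + y, x - y)\<close>. So the map
  that keeps coordinates is equivariant for them.\<close>

lemma equivariant_iso_9_8:
  assumes "fpf_action K A \<phi>" "fpf_action K' A' \<phi>'"
    and "card (carrier A) = 9" "card (carrier K) = 8" "card (carrier A') = 9" "card (carrier K') = 8"
    and "\<And>g. g \<in> carrier K \<Longrightarrow> g [^]\<^bsub>K\<^esub> (4::nat) = \<one>\<^bsub>K\<^esub>"
    and "\<And>g. g \<in> carrier K' \<Longrightarrow> g [^]\<^bsub>K'\<^esub> (4::nat) = \<one>\<^bsub>K'\<^esub>"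
  shows "\<exists>\<beta>. equivariant_iso K A \<phi> K' A' \<phi>' \<beta>"
proof -
  interpret V: fpf_action K A \<phi> by fact
  interpret W: fpf_action K' A' \<phi>' by fact
  obtain i j v w where V: "i \<in> carrier K" "j \<in> carrier K" "i \<otimes>\<^bsub>K\<^esub> i \<noteq> \<one>\<^bsub>K\<^esub>"
    "j \<notin> {\<one>\<^bsub>K\<^esub>, i, i \<otimes>\<^bsub>K\<^esub> i, i \<otimes>\<^bsub>K\<^esub> (i \<otimes>\<^bsub>K\<^esub> i)}"
    "v \<in> carrier A" "w \<in> carrier A" "V.A.ord v = 3" "V.A.ord w = 3" "w \<notin> generate A {v}"
    "\<phi> i v = w" "\<phi> i w = inv\<^bsub>A\<^esub> v" "\<phi> j v = v \<otimes>\<^bsub>A\<^esub> w" "\<phi> j w = v \<otimes>\<^bsub>A\<^esub> inv\<^bsub>A\<^esub> w"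
    using V.structure_9_8[OF assms(3,4,7)] by blast
  obtain i' j' v' w' where W: "i' \<in> carrier K'" "j' \<in> carrier K'" "i' \<otimes>\<^bsub>K'\<^esub> i' \<noteq> \<one>\<^bsub>K'\<^esub>"
    "j' \<notin> {\<one>\<^bsub>K'\<^esub>, i', i' \<otimes>\<^bsub>K'\<^esub> i', i' \<otimes>\<^bsub>K'\<^esub> (i' \<otimes>\<^bsub>K'\<^esub> i')}"
    "v' \<in> carrier A'" "w' \<in> carrier A'" "W.A.ord v' = 3" "W.A.ord w' = 3" "w' \<notin> generate A' {v'}"
    "\<phi>' i' v' = w'" "\<phi>' i' w' = inv\<^bsub>A'\<^esub> v'" "\<phi>' j' v' = v' \<otimes>\<^bsub>A'\<^esub> w'" "\<phi>' j' w' = v' \<otimes>\<^bsub>A'\<^esub> inv\<^bsub>A'\<^esub> w'"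
    using W.structure_9_8[OF assms(5,6,8)] by blast
  define P where "P x y = v [^]\<^bsub>A\<^esub> (x::int) \<otimes>\<^bsub>A\<^esub> w [^]\<^bsub>A\<^esub> (y::int)" for x y
  define Q where "Q x y = v' [^]\<^bsub>A'\<^esub> (x::int) \<otimes>\<^bsub>A'\<^esub> w' [^]\<^bsub>A'\<^esub> (y::int)" for x y
  have P_ex: "\<exists>x y. u = P x y" if "u \<in> carrier A" for u
    unfolding P_def using V.A.rank_two_powers(1)[OF V.finite_A assms(3) V(5,7,6,8,9) that] .
  have P_eq: "P x y = P x' y' \<longleftrightarrow> 3 dvd x' - x \<and> 3 dvd y' - y" for x y x' y'
    unfolding P_def using V.A.rank_two_powers(2)[OF V.finite_A assms(3) V(5,7,6,8,9)] .
  have Q_ex: "\<exists>x y. u = Q x y" if "u \<in> carrier A'" for u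
    unfolding Q_def using W.A.rank_two_powers(1)[OF W.finite_A assms(5) W(5,7,6,8,9) that] .
  have Q_eq: "Q x y = Q x' y' \<longleftrightarrow> 3 dvd x' - x \<and> 3 dvd y' - y" for x y x' y'
    unfolding Q_def using W.A.rank_two_powers(2)[OF W.finite_A assms(5) W(5,7,6,8,9)] .
  have Pc: "P x y \<in> carrier A" and Qc: "Q x y \<in> carrier A'" for x y
    unfolding P_def Q_def using V(5,6) W(5,6) by auto
  have P_mult: "P x y \<otimes>\<^bsub>A\<^esub> P x' y' = P (x + x') (y + y')" for x y x' y'
    unfolding P_def using V(5,6) V.A.int_pow_mult by (simp add: V.A.m_ac)
  have Q_mult: "Q x y \<otimes>\<^bsub>A'\<^esub> Q x' y' = Q (x + x') (y + y')" for x y x' y'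
    unfolding Q_def using W(5,6) W.A.int_pow_mult by (simp add: W.A.m_ac)
  have P_i: "\<phi> i (P x y) = P (- y) x" for x y
    unfolding P_def using V group_hom.hom_mult[OF V.act_group_hom[OF V(1)]] V.act_int_pow[OF V(1)]
    by (simp add: V.A.int_pow_inv V.A.int_pow_neg V.A.m_comm)
  have Q_i: "\<phi>' i' (Q x y) = Q (- y) x" for x y
    unfolding Q_def using W group_hom.hom_mult[OF W.act_group_hom[OF W(1)]] W.act_int_pow[OF W(1)]
    by (simp add: W.A.int_pow_inv W.A.int_pow_neg W.A.m_comm)
  have P_j: "\<phi> j (P x y) = P (x + y) (x - y)" for x y
  proof -
    have "\<phi> j (P x y) = (v \<otimes>\<^bsub>A\<^esub> w) [^]\<^bsub>A\<^esub> x \<otimes>\<^bsub>A\<^esub> (v \<otimes>\<^bsub>A\<^esub> inv\<^bsub>A\<^esub> w) [^]\<^bsub>A\<^esub> y"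
      unfolding P_def using V group_hom.hom_mult[OF V.act_group_hom[OF V(2)]] V.act_int_pow[OF V(2)] by simp
    also have "\<dots> = P x x \<otimes>\<^bsub>A\<^esub> P y (- y)"
      unfolding P_def using V(5,6) by (simp add: V.A.int_pow_distrib V.A.int_pow_inv V.A.int_pow_neg)
    finally show ?thesis using P_mult by simp
  qed
  have Q_j: "\<phi>' j' (Q x y) = Q (x + y) (x - y)" for x y
  proof -
    have "\<phi>' j' (Q x y) = (v' \<otimes>\<^bsub>A'\<^esub> w') [^]\<^bsub>A'\<^esub> x \<otimes>\<^bsub>A'\<^esub> (v' \<otimes>\<^bsub>A'\<^esub> inv\<^bsub>A'\<^esub> w') [^]\<^bsub>A'\<^esub> y"
      unfolding Q_def using W group_hom.hom_mult[OF W.act_group_hom[OF W(2)]] W.act_int_pow[OF W(2)] by simp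
    also have "\<dots> = Q x x \<otimes>\<^bsub>A'\<^esub> Q y (- y)"
      unfolding Q_def using W(5,6) by (simp add: W.A.int_pow_distrib W.A.int_pow_inv W.A.int_pow_neg)
    finally show ?thesis using Q_mult by simp
  qed
  define \<beta> where "\<beta> u = (let p = (SOME p. u = P (fst p) (snd p)) in Q (fst p) (snd p))" for u
  have \<beta>P: "\<beta> (P x y) = Q x y" for x y
  proof -
    define p where "p = (SOME p. P x y = P (fst p) (snd p))"
    have "P x y = P (fst p) (snd p)" unfolding p_def by (rule someI[of _ "(x, y)"]) simp
    then have "Q x y = Q (fst p) (snd p)" using P_eq Q_eq by simp
    then show ?thesis unfolding \<beta>_def Let_def p_def by simp
  qed
  have \<beta>: "\<beta> \<in> iso A A'"
  proof (rule isoI)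
    show "\<beta> \<in> hom A A'"
    proof (rule homI)
      show "\<beta> x \<in> carrier A'" if "x \<in> carrier A" for x using P_ex[OF that] \<beta>P Qc by auto
      fix x y assume "x \<in> carrier A" "y \<in> carrier A"
      then obtain a b c d where "x = P a b" "y = P c d" using P_ex by metis
      then show "\<beta> (x \<otimes>\<^bsub>A\<^esub> y) = \<beta> x \<otimes>\<^bsub>A'\<^esub> \<beta> y" by (simp add: P_mult Q_mult \<beta>P)
    qed
    have "inj_on \<beta> (carrier A)"
    proof (rule inj_onI)
      fix x y assume xy: "x \<in> carrier A" "y \<in> carrier A" "\<beta> x = \<beta> y"
      then obtain a b c d where "x = P a b" "y = P c d" using P_ex by metis
      then show "x = y" using xy(3) by (simp add: \<beta>P Q_eq P_eq)
    qed
    moreover have "\<beta> ` carrier A = carrier A'"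
    proof
      show "\<beta> ` carrier A \<subseteq> carrier A'" using P_ex \<beta>P Qc by fastforce
      show "carrier A' \<subseteq> \<beta> ` carrier A"
      proof
        fix u assume "u \<in> carrier A'"
        then obtain x y where "u = Q x y" using Q_ex by metis
        then have "u = \<beta> (P x y)" using \<beta>P by simp
        then show "u \<in> \<beta> ` carrier A" using Pc by blast
      qed
    qed
    ultimately show "bij_betw \<beta> (carrier A) (carrier A')" unfolding bij_betw_def by blast
  qed
  let ?T = "{g \<in> carrier K. \<exists>g'\<in>carrier K'. \<forall>v\<in>carrier A. \<beta> (\<phi> g v) = \<phi>' g' (\<beta> v)}"
  have T: "subgroup ?T K" by (rule V.implementable_subgroup[OF W.fpf_action_axioms \<beta>])
  have "\<beta> (\<phi> i u) = \<phi>' i' (\<beta> u)" "\<beta> (\<phi> j u) = \<phi>' j' (\<beta> u)" if "u \<in> carrier A" for u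
    using P_ex[OF that] by (auto simp: \<beta>P P_i P_j Q_i Q_j)
  then have iT: "i \<in> ?T" and jT: "j \<in> ?T" using V(1,2) W(1,2) by blast+
  \<comment> \<open>The four powers of \<open>i\<close> together with \<open>j\<close>: five of the
    eight elements, enough for \<open>equivariant_isoI\<close>.\<close>
  define F where "F = {\<one>\<^bsub>K\<^esub>, i, i \<otimes>\<^bsub>K\<^esub> i, i \<otimes>\<^bsub>K\<^esub> (i \<otimes>\<^bsub>K\<^esub> i), j}"
  have i2: "i \<otimes>\<^bsub>K\<^esub> i \<in> ?T" by (rule subgroup.m_closed[OF T iT iT])
  have i3: "i \<otimes>\<^bsub>K\<^esub> (i \<otimes>\<^bsub>K\<^esub> i) \<in> ?T" by (rule subgroup.m_closed[OF T iT i2])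
  have FT: "F \<subseteq> ?T"
    unfolding F_def by (simp only: insert_subset empty_subsetI subgroup.one_closed[OF T] iT i2 i3 jT simp_thms)
  have "card F = 5"
  proof -
    define q where "q = i \<otimes>\<^bsub>K\<^esub> i"
    have q: "q \<in> carrier K" "q \<noteq> \<one>\<^bsub>K\<^esub>" unfolding q_def using V(1,3) by simp_all
    have n1: "i \<noteq> \<one>\<^bsub>K\<^esub>" using V(3) V.l_one[OF V(1)] by metis
    have n2: "q \<noteq> i" using n1 V(1) V.l_cancel_one[OF V(1,1)] unfolding q_def by blast
    have n3: "i \<otimes>\<^bsub>K\<^esub> q \<noteq> i" using q V.l_cancel_one[OF V(1) q(1)] by blast
    have n4: "i \<otimes>\<^bsub>K\<^esub> q \<noteq> q" using n1 V.r_cancel_one[OF q(1) V(1)] by blast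
    have n5: "i \<otimes>\<^bsub>K\<^esub> q \<noteq> \<one>\<^bsub>K\<^esub>"
    proof
      assume e: "i \<otimes>\<^bsub>K\<^esub> q = \<one>\<^bsub>K\<^esub>"
      have "(i \<otimes>\<^bsub>K\<^esub> q) \<otimes>\<^bsub>K\<^esub> i = \<one>\<^bsub>K\<^esub>"
        unfolding q_def using assms(7)[OF V(1)] V(1) by (simp add: eval_nat_numeral V.m_assoc)
      then show False unfolding e using n1 V(1) by simp
    qed
    have "distinct [\<one>\<^bsub>K\<^esub>, i, q, i \<otimes>\<^bsub>K\<^esub> q, j]"
      using q(2) n1 n2 n3 n4 n5 V(4) unfolding q_def[symmetric] by (auto dest: sym)
    moreover have "F = set [\<one>\<^bsub>K\<^esub>, i, q, i \<otimes>\<^bsub>K\<^esub> q, j]" unfolding F_def q_def by simp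
    ultimately show ?thesis using distinct_card by fastforce
  qed
  then have "equivariant_iso K A \<phi> K' A' \<phi>' \<beta>"
    using V.equivariant_isoI[OF W.fpf_action_axioms \<beta>, of F] FT assms(4) by auto
  then show ?thesis by blast
qed

text \<open>Converse of \<open>card_A_cases\<close>, for use in the models; counting regular orbits
  suffices. In the second case an element taking \<open>v\<close> to its inverse has trivial square,
  so it is trivial because |K| is odd, and then \<open>v\<close> would have order 2 in a group of
  odd order.\<close>

lemma (in fpf_action) half_transitive_of_card:
  assumes "card (carrier A) = card (carrier K) + 1 \<or>
    odd (card (carrier K)) \<and> card (carrier A) = 2 * card (carrier K) + 1"
  shows "half_transitive_action K A \<phi>"
proof unfold_locales
  fix u v assume u: "u \<in> carrier A" "u \<noteq> \<one>\<^bsub>A\<^esub>" and v: "v \<in> carrier A" "v \<noteq> \<one>\<^bsub>A\<^esub>"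
  define O1 where "O1 = (\<lambda>g. \<phi> g v) ` carrier K"
  define O2 where "O2 = (\<lambda>g. \<phi> g (inv\<^bsub>A\<^esub> v)) ` carrier K"
  have vi: "inv\<^bsub>A\<^esub> v \<in> carrier A" "inv\<^bsub>A\<^esub> v \<noteq> \<one>\<^bsub>A\<^esub>" using v by auto
  have cO: "card O1 = card (carrier K)" "card O2 = card (carrier K)"
    unfolding O1_def O2_def using act_inj[OF _ _ v] act_inj[OF _ _ vi]
    by (auto intro!: card_image inj_onI)
  have sub: "O1 \<union> O2 \<subseteq> carrier A - {\<one>\<^bsub>A\<^esub>}"
    unfolding O1_def O2_def using v vi act_eq_one_iff by auto
  have cA: "card (carrier A - {\<one>\<^bsub>A\<^esub>}) = card (carrier A) - 1"
    using finite_A by (simp add: card_Diff_singleton)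
  have "O1 \<union> O2 = carrier A - {\<one>\<^bsub>A\<^esub>}"
  proof (cases "card (carrier A) = card (carrier K) + 1")
    case True
    have "O1 = carrier A - {\<one>\<^bsub>A\<^esub>}"
      by (rule card_subset_eq) (use finite_A sub cO cA True in auto)
    then show ?thesis using sub by blast
  next
    case False
    then have odd: "odd (card (carrier K))" and c: "card (carrier A) = 2 * card (carrier K) + 1"
      using assms by auto
    have "O1 \<inter> O2 = {}"
    proof (rule ccontr)
      assume "O1 \<inter> O2 \<noteq> {}"
      then obtain g h where gh: "g \<in> carrier K" "h \<in> carrier K" "\<phi> g v = \<phi> h (inv\<^bsub>A\<^esub> v)"
        unfolding O1_def O2_def by auto
      define k where "k = inv h \<otimes> g"
      have kc: "k \<in> carrier K" unfolding k_def using gh by simp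
      have k: "\<phi> k v = inv\<^bsub>A\<^esub> v"
        unfolding k_def using act_mult[of "inv h" g v] act_inv_cancel[of h "inv\<^bsub>A\<^esub> v"] gh v by simp
      have "\<phi> (k \<otimes> k) v = v"
        using act_mult[OF kc kc v(1)] k group_hom.hom_inv[OF act_group_hom[OF kc] v(1)] v by simp
      then have "k \<otimes> k = \<one>" using fpf[of "k \<otimes> k" v] kc v by blast
      then have "k [^] (2::nat) = \<one>" using kc by (simp add: numeral_2_eq_2)
      then have "ord k dvd 2" using pow_eq_id[OF kc] by blast
      moreover have "odd (ord k)"
        using ord_dvd_group_order[OF kc] odd dvd_trans unfolding order_def by blast
      ultimately have "ord k = 1" by (metis dvd_refl primes_dvd_imp_eq prime_nat_iff two_is_prime_nat)
      then have "k = \<one>" using ord_eq_1[OF kc] by blast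
      then have "v = inv\<^bsub>A\<^esub> v" using k act_one v by simp
      then have "v \<otimes>\<^bsub>A\<^esub> v = \<one>\<^bsub>A\<^esub>" using v by (metis A.r_inv)
      then have "v [^]\<^bsub>A\<^esub> (2::nat) = \<one>\<^bsub>A\<^esub>" using v by (simp add: numeral_2_eq_2)
      then have "A.ord v dvd 2" using A.pow_eq_id[OF v(1)] by blast
      moreover have "A.ord v dvd 2 * card (carrier K) + 1"
        using A.ord_dvd_group_order[OF v(1)] c unfolding order_def by simp
      ultimately have "A.ord v dvd 1" by (metis dvd_add_right_iff dvd_mult2)
      then show False using A.ord_eq_1[OF v(1)] v by simp
    qed
    then have "card (O1 \<union> O2) = 2 * card (carrier K)"
      using cO finite_K by (simp add: card_Un_disjoint O1_def O2_def)
    then show ?thesis using finite_A sub cA c by (intro card_subset_eq) auto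
  qed
  then have "u \<in> O1 \<union> O2" using u by blast
  then show "\<exists>g\<in>carrier K. u = \<phi> g v \<or> u = \<phi> g (inv\<^bsub>A\<^esub> v)" unfolding O1_def O2_def by blast
qed

section \<open>Split extensions with fixed-point-free complement\<close>

lemma (in group) product_unique:
  assumes N: "subgroup N G" and M: "subgroup M G" and cap: "N \<inter> M = {\<one>}"
    and mem: "n \<in> N" "n' \<in> N" "m \<in> M" "m' \<in> M" "n \<otimes> m = n' \<otimes> m'"
  shows "n = n'" "m = m'"
proof -
  interpret N: subgroup N G by (rule N)
  interpret M: subgroup M G by (rule M)
  have c: "n \<in> carrier G" "n' \<in> carrier G" "m \<in> carrier G" "m' \<in> carrier G" using mem by auto
  have "inv n' \<otimes> n \<otimes> m = inv n' \<otimes> (n' \<otimes> m')" using mem(5) c by (simp add: m_assoc)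
  also have "\<dots> = m'" using c by (simp add: m_assoc[symmetric])
  finally have "inv n' \<otimes> n \<otimes> m \<otimes> inv m = m' \<otimes> inv m" by simp
  then have e: "inv n' \<otimes> n = m' \<otimes> inv m" using c by (simp add: m_assoc)
  have "inv n' \<otimes> n \<in> N" using mem by simp
  moreover have "m' \<otimes> inv m \<in> M" using mem by simp
  ultimately have "inv n' \<otimes> n = \<one>" using e cap by auto
  moreover have "n' \<otimes> (inv n' \<otimes> n) = n" using c by (simp add: m_assoc[symmetric])
  ultimately show n: "n = n'" using c by simp
  then show "m = m'" using mem(5) c by simp
qed

text \<open>A Frobenius group with abelian kernel \<open>N\<close> and complement \<open>M\<close>,
  given internally. Trivial \<open>M\<close> is allowed; the groups of order 2 and 3 are of this
  kind.\<close>

locale affine_split = group H for H (structure) +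
  fixes N M :: "'a set"
  assumes fin: "finite (carrier H)" and normal: "N \<lhd> H" and sub: "subgroup M H"
    and commN: "\<And>x y. x \<in> N \<Longrightarrow> y \<in> N \<Longrightarrow> x \<otimes> y = y \<otimes> x"
    and cap: "N \<inter> M = {\<one>}" and decomp: "\<And>h. h \<in> carrier H \<Longrightarrow> \<exists>n\<in>N. \<exists>m\<in>M. h = n \<otimes> m"
    and nontriv: "N \<noteq> {\<one>}"
    and fpf_M: "\<And>m v. m \<in> M \<Longrightarrow> m \<noteq> \<one> \<Longrightarrow> v \<in> N \<Longrightarrow> m \<otimes> v = v \<otimes> m \<Longrightarrow> v = \<one>"
begin

abbreviation KM where "KM \<equiv> H\<lparr>carrier := M\<rparr>"
abbreviation AN where "AN \<equiv> H\<lparr>carrier := N\<rparr>"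

text \<open>Conjugation from the other side than in \<open>cj\<close>, since
  \<open>fpf_action\<close> asks for a left action.\<close>

definition ac :: "'a \<Rightarrow> 'a \<Rightarrow> 'a" where "ac m v = m \<otimes> v \<otimes> inv m"

sublocale N: normal N H by (rule normal)
sublocale M: subgroup M H by (rule sub)

lemma ac_closed: "h \<in> carrier H \<Longrightarrow> v \<in> N \<Longrightarrow> ac h v \<in> N"
  unfolding ac_def by (rule N.inv_op_closed2)

lemma ac_mult: "h \<in> carrier H \<Longrightarrow> v \<in> carrier H \<Longrightarrow> w \<in> carrier H \<Longrightarrow> ac h (v \<otimes> w) = ac h v \<otimes> ac h w"
  unfolding ac_def by (simp add: m_assoc) (simp add: m_assoc[symmetric])

lemma ac_comp: "g \<in> carrier H \<Longrightarrow> h \<in> carrier H \<Longrightarrow> v \<in> carrier H \<Longrightarrow> ac (g \<otimes> h) v = ac g (ac h v)"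
  unfolding ac_def by (simp add: m_assoc inv_mult_group)

lemma ac_eq_iff: "h \<in> carrier H \<Longrightarrow> v \<in> carrier H \<Longrightarrow> w \<in> carrier H \<Longrightarrow> ac h v = w \<longleftrightarrow> h \<otimes> v = w \<otimes> h"
  unfolding ac_def by (metis inv_solve_right m_closed)

lemma fpf_action: "fpf_action KM AN ac"
proof -
  interpret K: group KM by (rule subgroup_imp_group[OF sub])
  interpret A: group AN by (rule subgroup_imp_group[OF N.subgroup_axioms])
  have "comm_group AN" by (rule A.group_comm_groupI) (simp add: commN)
  then show ?thesis
  proof (intro fpf_action.intro fpf_action_axioms.intro K.group_axioms)
    show "finite (carrier KM)" "finite (carrier AN)"
      using fin finite_subset[OF M.subset] finite_subset[OF N.subset] by simp_all
    show "carrier AN \<noteq> {\<one>\<^bsub>AN\<^esub>}" using nontriv by simp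
    show "ac g \<in> hom AN AN" if "g \<in> carrier KM" for g
      using that by (intro homI) (simp_all add: ac_closed ac_mult)
    show "ac (g \<otimes>\<^bsub>KM\<^esub> h) v = ac g (ac h v)"
      if "g \<in> carrier KM" "h \<in> carrier KM" "v \<in> carrier AN" for g h v
      using that ac_comp[of g h v] by simp
    show "ac \<one>\<^bsub>KM\<^esub> v = v" if "v \<in> carrier AN" for v using that by (simp add: ac_def)
    show "v = \<one>\<^bsub>AN\<^esub>" if "g \<in> carrier KM" "g \<noteq> \<one>\<^bsub>KM\<^esub>" "v \<in> carrier AN" "ac g v = v" for g v
      using that ac_eq_iff[of g v v] fpf_M[of g v] by simp
  qed
qed

lemma split_unique:
  assumes "n \<in> N" "n' \<in> N" "m \<in> M" "m' \<in> M" "n \<otimes> m = n' \<otimes> m'"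
  shows "n = n'" "m = m'"
  using product_unique[OF N.subgroup_axioms sub cap assms] .

definition pr :: "'a \<Rightarrow> 'a" where "pr h = (THE m. m \<in> M \<and> (\<exists>n\<in>N. h = n \<otimes> m))"

lemma pr_mult [simp]: "n \<in> N \<Longrightarrow> m \<in> M \<Longrightarrow> pr (n \<otimes> m) = m"
  unfolding pr_def
proof (rule the_equality)
  assume nm: "n \<in> N" "m \<in> M"
  then show "m \<in> M \<and> (\<exists>n'\<in>N. n \<otimes> m = n' \<otimes> m)" by blast
  fix m' assume "m' \<in> M \<and> (\<exists>n'\<in>N. n \<otimes> m = n' \<otimes> m')"
  then obtain n' where "m' \<in> M" "n' \<in> N" "n \<otimes> m = n' \<otimes> m'" by blast
  then show "m' = m" using split_unique(2)[of n n' m m'] nm by simp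
qed

lemma pr_M [simp]: "m \<in> M \<Longrightarrow> pr m = m"
  using pr_mult[of \<one> m] by simp

lemma swap: "n \<in> N \<Longrightarrow> m \<in> M \<Longrightarrow> m \<otimes> n = ac m n \<otimes> m"
  unfolding ac_def by (simp add: m_assoc)

lemma mult_split:
  assumes "n \<in> N" "m \<in> M" "n' \<in> N" "m' \<in> M"
  shows "(n \<otimes> m) \<otimes> (n' \<otimes> m') = (n \<otimes> ac m n') \<otimes> (m \<otimes> m')"
proof -
  have "(n \<otimes> m) \<otimes> (n' \<otimes> m') = n \<otimes> (m \<otimes> n') \<otimes> m'" using assms by (simp add: m_assoc)
  also have "\<dots> = n \<otimes> (ac m n' \<otimes> m) \<otimes> m'" using swap assms by simp
  finally show ?thesis using assms ac_closed[of m n'] by (simp add: m_assoc)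
qed

lemma pr_hom: "group_hom H KM pr"
proof -
  have "pr \<in> hom H KM"
  proof (rule homI)
    fix x assume "x \<in> carrier H"
    then obtain n m where nm: "n \<in> N" "m \<in> M" "x = n \<otimes> m" using decomp by blast
    then show "pr x \<in> carrier KM" by simp
    fix y assume "y \<in> carrier H"
    then obtain n' m' where nm': "n' \<in> N" "m' \<in> M" "y = n' \<otimes> m'" using decomp by blast
    have "x \<otimes> y = (n \<otimes> ac m n') \<otimes> (m \<otimes> m')" using mult_split nm nm' by simp
    then show "pr (x \<otimes> y) = pr x \<otimes>\<^bsub>KM\<^esub> pr y" using nm nm' ac_closed[of m n'] by simp
  qed
  then show ?thesis
    unfolding group_hom_def group_hom_axioms_def using is_group subgroup_imp_group[OF sub] by simp
qed

lemma pr_img: "pr ` carrier H = carrier KM"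
proof
  show "pr ` carrier H \<subseteq> carrier KM" using group_hom.hom_closed[OF pr_hom] by blast
  show "carrier KM \<subseteq> pr ` carrier H"
  proof
    fix m assume "m \<in> carrier KM"
    then show "m \<in> pr ` carrier H" by (intro image_eqI[of _ _ m]) simp_all
  qed
qed

lemma pr_eq_one_iff: "h \<in> carrier H \<Longrightarrow> pr h = \<one> \<longleftrightarrow> h \<in> N"
proof -
  assume "h \<in> carrier H"
  then obtain n m where nm: "n \<in> N" "m \<in> M" "h = n \<otimes> m" using decomp by blast
  have "h \<in> N \<longleftrightarrow> m = \<one>"
  proof
    assume "h \<in> N"
    then have "m = \<one>" using split_unique(2)[of h n \<one> m] nm by simp
    then show "m = \<one>" .
  qed (use nm in simp)
  then show ?thesis using nm by simp
qed

lemma card_eq: "card (carrier H) = card N * card M"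
proof -
  have "bij_betw (\<lambda>(n, m). n \<otimes> m) (N \<times> M) (carrier H)"
    unfolding bij_betw_def
  proof
    show "inj_on (\<lambda>(n, m). n \<otimes> m) (N \<times> M)" using split_unique by (fastforce intro: inj_onI)
    show "(\<lambda>(n, m). n \<otimes> m) ` (N \<times> M) = carrier H"
    proof
      show "(\<lambda>(n, m). n \<otimes> m) ` (N \<times> M) \<subseteq> carrier H" by auto
      show "carrier H \<subseteq> (\<lambda>(n, m). n \<otimes> m) ` (N \<times> M)"
      proof
        fix h assume "h \<in> carrier H"
        then obtain n m where "n \<in> N" "m \<in> M" "h = n \<otimes> m" using decomp by blast
        then show "h \<in> (\<lambda>(n, m). n \<otimes> m) ` (N \<times> M)" by (intro image_eqI[of _ _ "(n, m)"]) auto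
      qed
    qed
  qed
  then show ?thesis using bij_betw_same_card by (metis card_cartesian_product)
qed

text \<open>Elements outside \<open>N\<close> are conjugate to their component in \<open>M\<close>, because \<open>n \<mapsto> n (m n\<^sup>-\<^sup>1 m\<^sup>-\<^sup>1)\<close> is
  injective on the finite set \<open>N\<close>.\<close>

lemma conj_to_complement:
  assumes v: "v \<in> N" and m: "m \<in> M" "m \<noteq> \<one>"
  shows "conj_in H m (v \<otimes> m)"
proof -
  let ?f = "\<lambda>n. n \<otimes> ac m (inv n)"
  have mc: "m \<in> carrier H" using m by simp
  have finN: "finite N" using fin N.subset finite_subset by blast
  have "inj_on ?f N"
  proof (rule inj_onI)
    fix a b assume ab: "a \<in> N" "b \<in> N" "a \<otimes> ac m (inv a) = b \<otimes> ac m (inv b)"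
    have c: "a \<in> carrier H" "b \<in> carrier H" using ab by auto
    have inv1: "a \<otimes> m \<otimes> inv a = b \<otimes> m \<otimes> inv b"
    proof -
      have "x \<otimes> m \<otimes> inv x = x \<otimes> ac m (inv x) \<otimes> m" if "x \<in> carrier H" for x
        using that mc unfolding ac_def by (simp add: m_assoc)
      then show ?thesis using ab(3) c by simp
    qed
    define d where "d = inv b \<otimes> a"
    have dN: "d \<in> N" unfolding d_def using ab by simp
    have "m \<otimes> d = inv b \<otimes> (b \<otimes> m \<otimes> inv b) \<otimes> a" unfolding d_def using c mc
      by (simp add: m_assoc) (simp add: m_assoc[symmetric])
    also have "\<dots> = d \<otimes> m" unfolding inv1[symmetric] d_def using c mc by (simp add: m_assoc)
    finally have "d = \<one>" using fpf_M[OF m dN] by blast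
    moreover have "b \<otimes> d = a" unfolding d_def using c by (simp add: m_assoc[symmetric])
    ultimately show "a = b" using c by simp
  qed
  moreover have "?f ` N \<subseteq> N" using ac_closed mc by auto
  ultimately have "?f ` N = N" using finN by (intro endo_inj_surj)
  then have "v \<in> ?f ` N" using v by simp
  then obtain n where n: "n \<in> N" "v = n \<otimes> ac m (inv n)" by blast
  have nc: "n \<in> carrier H" using n by simp
  have "v \<otimes> m = inv (inv n) \<otimes> m \<otimes> inv n"
    unfolding n(2) ac_def using nc mc by (simp add: m_assoc)
  then show ?thesis unfolding conj_in_def using nc by blast
qed

text \<open>The case distinction common to \<open>MP\<close> and \<open>SMP\<close>, with
  \<open>P\<close> standing for either conclusion. \<open>N\<close> is normal, so \<open>x\<close>
  and \<open>y\<close> lie both inside or both outside it. Outside, the components in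
  \<open>M\<close> have equal normal closures there, and each element is conjugate to its component
  by \<open>conj_to_complement\<close>.\<close>

lemma MP_transfer:
  assumes K: "MP KM \<or> SMP KM" and x: "x \<in> carrier H" and y: "y \<in> carrier H"
    and eq: "normal_closure H x = normal_closure H y"
    and inN: "\<And>u v. u \<in> N \<Longrightarrow> u \<noteq> \<one> \<Longrightarrow> v \<in> N \<Longrightarrow> v \<noteq> \<one> \<Longrightarrow> P u v" "P \<one> \<one>"
    and out: "\<And>m m' u v. m \<in> M \<Longrightarrow> m' \<in> M \<Longrightarrow> m \<noteq> \<one> \<Longrightarrow> m' \<noteq> \<one> \<Longrightarrow> normal_closure KM m = normal_closure KM m' \<Longrightarrow>
      conj_in H m u \<Longrightarrow> conj_in H m' v \<Longrightarrow> P u v"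
  shows "P x y"
proof (cases "x \<in> N")
  case True
  have "normal_closure H x \<subseteq> N" using normal_closure_least[OF normal True] .
  then have yN: "y \<in> N" using normal_closure_mem[OF y] eq by blast
  have "x = \<one> \<longleftrightarrow> y = \<one>"
    using normal_closure_mem[OF x] normal_closure_mem[OF y] normal_closure_one eq by auto
  then show ?thesis using inN True yN by blast
next
  case False
  interpret p: group_hom H KM pr by (rule pr_hom)
  have yN: "y \<notin> N"
  proof
    assume "y \<in> N"
    then have "normal_closure H y \<subseteq> N" using normal_closure_least[OF normal] by blast
    then show False using normal_closure_mem[OF x] eq False by blast
  qed
  have e: "normal_closure KM (pr x) = normal_closure KM (pr y)"
    using p.normal_closure_img[OF pr_img x] p.normal_closure_img[OF pr_img y] eq by simp
  have ne: "pr x \<noteq> \<one>" "pr y \<noteq> \<one>" using pr_eq_one_iff x y False yN by auto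
  obtain n m where nm: "n \<in> N" "m \<in> M" "x = n \<otimes> m" using decomp x by blast
  obtain n' m' where nm': "n' \<in> N" "m' \<in> M" "y = n' \<otimes> m'" using decomp y by blast
  have "conj_in H m x" "conj_in H m' y" using conj_to_complement nm nm' ne by auto
  then show ?thesis using out[of m m' x y] e ne nm nm' by simp
qed

lemma conj_in_KM: "conj_in KM x y \<Longrightarrow> conj_in H x y"
  unfolding conj_in_def using m_inv_consistent[OF sub] by auto

lemma inv_KM: "m \<in> M \<Longrightarrow> inv\<^bsub>KM\<^esub> m = inv m"
  using m_inv_consistent[OF sub] by simp

lemma MP_of_complement:
  assumes K: "MP KM" and t: "half_transitive_action KM AN ac"
  shows "MP H"
  unfolding MP_def
proof (intro ballI impI)
  fix x y assume xy: "x \<in> carrier H" "y \<in> carrier H" "normal_closure H x = normal_closure H y"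
  interpret t: half_transitive_action KM AN ac by (rule t)
  show "conj_in H y x \<or> conj_in H (inv y) x"
  proof (rule MP_transfer[OF _ xy])
    show "MP KM \<or> SMP KM" using K by blast
    show "conj_in H \<one> \<one> \<or> conj_in H (inv \<one>) \<one>" using conj_in_refl by simp
  next
    fix u v assume uv: "u \<in> N" "u \<noteq> \<one>" "v \<in> N" "v \<noteq> \<one>"
    obtain g where g: "g \<in> M" "u = ac g v \<or> u = ac g (inv\<^bsub>AN\<^esub> v)" using t.trans[of u v] uv by auto
    have "inv\<^bsub>AN\<^esub> v = inv v" using m_inv_consistent[OF N.subgroup_axioms] uv by simp
    moreover have "conj_in H w (ac g w)" for w
      unfolding conj_in_def ac_def using g by (intro bexI[of _ "inv g"]) auto
    ultimately show "conj_in H v u \<or> conj_in H (inv v) u" using g by metis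
  next
    fix m m' u v assume m: "m \<in> M" "m' \<in> M" "normal_closure KM m = normal_closure KM m'"
      "conj_in H m u" "conj_in H m' v"
    have "conj_in KM m' m \<or> conj_in KM (inv\<^bsub>KM\<^esub> m') m" using K m(1-3) unfolding MP_def by simp
    then have "conj_in H m' m \<or> conj_in H (inv m') m" using conj_in_KM inv_KM m(2) by metis
    moreover have "conj_in H v m'" using conj_in_sym m by simp
    moreover have "conj_in H (inv v) (inv m')" using conj_in_inv[OF \<open>conj_in H v m'\<close>] conj_in_closed m by simp
    moreover have "v \<in> carrier H" using conj_in_closed m by auto
    ultimately show "conj_in H v u \<or> conj_in H (inv v) u"
      using conj_in_trans m(4) by (metis inv_closed)
  qed
qed

lemma SMP_of_complement:
  assumes K: "SMP KM" and t: "\<And>u v. u \<in> N \<Longrightarrow> u \<noteq> \<one> \<Longrightarrow> v \<in> N \<Longrightarrow> v \<noteq> \<one> \<Longrightarrow> conj_in H v u"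
  shows "SMP H"
  unfolding SMP_def
proof (intro ballI impI)
  fix x y assume xy: "x \<in> carrier H" "y \<in> carrier H" "normal_closure H x = normal_closure H y"
  show "conj_in H y x"
  proof (rule MP_transfer[OF _ xy])
    show "MP KM \<or> SMP KM" using K by blast
    show "conj_in H \<one> \<one>" using conj_in_refl by simp
  next
    fix m m' u v assume m: "m \<in> M" "m' \<in> M" "normal_closure KM m = normal_closure KM m'"
      "conj_in H m u" "conj_in H m' v"
    have "conj_in KM m' m" using K m(1-3) unfolding SMP_def by simp
    then have "conj_in H m' m" using conj_in_KM by blast
    moreover have "conj_in H v m'" using conj_in_sym m by simp
    moreover have "v \<in> carrier H" using conj_in_closed m by auto
    ultimately show "conj_in H v u" using conj_in_trans m(4) by metis
  qed (use t in blast)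
qed

text \<open>A subgroup above \<open>M\<close> that meets \<open>N\<close> nontrivially contains
  \<open>N\<close>, by transitivity up to inversion, so \<open>M\<close> is maximal. Commutators of
  a core element with elements of \<open>N\<close> lie in both the core and \<open>N\<close>, hence
  vanish, and an element of \<open>M\<close> centralising \<open>N\<close> is trivial.\<close>

lemma primitive_of_half_transitive:
  assumes t: "half_transitive_action KM AN ac"
  shows "primitive H"
  unfolding primitive_def
proof (intro exI conjI)
  interpret t: half_transitive_action KM AN ac by (rule t)
  show "maximal_subgroup H M"
    unfolding maximal_subgroup_def
  proof (intro conjI allI impI)
    show "subgroup M H" by (rule sub)
    show "M \<noteq> carrier H" using cap nontriv N.subset N.one_closed by auto
    fix L assume L: "subgroup L H \<and> M \<subseteq> L"
    interpret L: subgroup L H using L by blast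
    show "L = M \<or> L = carrier H"
    proof (cases "L \<inter> N \<subseteq> {\<one>}")
      case True
      have "L \<subseteq> M"
      proof
        fix x assume x: "x \<in> L"
        then obtain n m where nm: "n \<in> N" "m \<in> M" "x = n \<otimes> m" using decomp L.subset by blast
        then have "n = x \<otimes> inv m" by (simp add: m_assoc)
        then have "n \<in> L" using x nm(2) L by auto
        then have "n = \<one>" using True nm by blast
        then show "x \<in> M" using nm by simp
      qed
      then show ?thesis using L by blast
    next
      case False
      then obtain v where v: "v \<in> L" "v \<in> N" "v \<noteq> \<one>" by blast
      have "N \<subseteq> L"
      proof
        fix u assume u: "u \<in> N"
        show "u \<in> L"
        proof (cases "u = \<one>")
          case uone: False
          obtain g where g: "g \<in> M" "u = ac g v \<or> u = ac g (inv\<^bsub>AN\<^esub> v)" using t.trans[of u v] u uone v by auto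
          have "inv\<^bsub>AN\<^esub> v = inv v" using m_inv_consistent[OF N.subgroup_axioms] v by simp
          then show ?thesis using g v L unfolding ac_def by auto
        qed simp
      qed
      then have "carrier H \<subseteq> L" using decomp L by (metis L.m_closed subset_iff)
      then show ?thesis using L.subset by blast
    qed
  qed
  have cN: "core H M \<lhd> H" using core_normal[OF sub] .
  interpret C: normal "core H M" H by (rule cN)
  have cM: "core H M \<subseteq> M" using core_subset M.subset by blast
  have "core H M \<subseteq> {\<one>}"
  proof
    fix m assume m: "m \<in> core H M"
    then have mM: "m \<in> M" using cM by blast
    obtain v where v: "v \<in> N" "v \<noteq> \<one>" using nontriv N.one_closed by blast
    have c: "m \<in> carrier H" "v \<in> carrier H" using mM v by auto
    have "m \<otimes> (v \<otimes> inv m \<otimes> inv v) \<in> core H M" using m C.inv_op_closed2[of v "inv m"] c by simp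
    moreover have "(m \<otimes> v \<otimes> inv m) \<otimes> inv v \<in> N" using N.inv_op_closed2[of m v] c v by simp
    moreover have "m \<otimes> (v \<otimes> inv m \<otimes> inv v) = (m \<otimes> v \<otimes> inv m) \<otimes> inv v" using c by (simp add: m_assoc)
    ultimately have "(m \<otimes> v \<otimes> inv m) \<otimes> inv v = \<one>" using cM cap by auto
    then have "m \<otimes> v \<otimes> inv m = v" using c by (metis inv_closed inv_equality inv_inv m_closed)
    then have "m \<otimes> v = v \<otimes> m" using ac_eq_iff[of m v v] c unfolding ac_def by simp
    then show "m \<in> {\<one>}" using fpf_M[OF mM _ v(1)] v(2) by blast
  qed
  then show "core H M = {\<one>}" using C.one_closed by blast
qed

end

text \<open>\<open>\<alpha>\<close> is chosen elementwise. Faithfulness of the second action makes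
  it multiplicative, and faithfulness of the first with injectivity of \<open>\<beta>\<close> makes
  it injective. The isomorphism sends \<open>n \<otimes> m\<close> to the product of
  \<open>\<beta> n\<close> and \<open>\<alpha> m\<close>; it is onto because the orders
  agree.\<close>

lemma split_iso:
  assumes "affine_split H N M" "affine_split H' N' M'"
    and eq: "equivariant_iso (H\<lparr>carrier := M\<rparr>) (H\<lparr>carrier := N\<rparr>) (affine_split.ac H)
      (H'\<lparr>carrier := M'\<rparr>) (H'\<lparr>carrier := N'\<rparr>) (affine_split.ac H') \<beta>"
    and cM: "card M = card M'"
  shows "H \<cong> H'"
proof -
  interpret S: affine_split H N M by fact
  interpret S': affine_split H' N' M' by fact
  interpret V: fpf_action S.KM S.AN S.ac by (rule S.fpf_action)
  interpret W: fpf_action S'.KM S'.AN S'.ac by (rule S'.fpf_action)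
  have \<beta>: "\<beta> \<in> iso S.AN S'.AN" using eq unfolding equivariant_iso_def by blast
  have bij: "bij_betw \<beta> N N'" using \<beta> unfolding iso_def by simp
  have \<beta>c: "\<beta> v \<in> N'" if "v \<in> N" for v using bij that bij_betwE by blast
  have \<beta>m: "\<beta> (u \<otimes>\<^bsub>H\<^esub> v) = \<beta> u \<otimes>\<^bsub>H'\<^esub> \<beta> v" if "u \<in> N" "v \<in> N" for u v
    using \<beta> that unfolding iso_def hom_def by simp
  have ex: "\<forall>g\<in>M. \<exists>g'. g' \<in> M' \<and> (\<forall>v\<in>N. \<beta> (S.ac g v) = S'.ac g' (\<beta> v))"
    using eq unfolding equivariant_iso_def by simp blast
  then obtain \<alpha> where \<alpha>: "\<And>g. g \<in> M \<Longrightarrow> \<alpha> g \<in> M'"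
    "\<And>g v. g \<in> M \<Longrightarrow> v \<in> N \<Longrightarrow> \<beta> (S.ac g v) = S'.ac (\<alpha> g) (\<beta> v)"
    using bchoice[OF ex] by blast
  have surj: "\<exists>v\<in>N. u = \<beta> v" if "u \<in> N'" for u using bij that unfolding bij_betw_def by blast
  have \<alpha>m: "\<alpha> (g \<otimes>\<^bsub>H\<^esub> h) = \<alpha> g \<otimes>\<^bsub>H'\<^esub> \<alpha> h" if gh: "g \<in> M" "h \<in> M" for g h
  proof (rule W.act_eqI)
    fix u assume "u \<in> carrier S'.AN"
    then obtain v where v: "v \<in> N" "u = \<beta> v" using surj by auto
    have "S'.ac (\<alpha> (g \<otimes>\<^bsub>H\<^esub> h)) u = \<beta> (S.ac g (S.ac h v))"
      using \<alpha>(2)[of "g \<otimes>\<^bsub>H\<^esub> h" v] S.ac_comp[of g h v] gh v by simp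
    also have "\<dots> = S'.ac (\<alpha> g) (S'.ac (\<alpha> h) u)"
      using \<alpha>(2) gh v S.ac_closed[of h v] by simp
    also have "\<dots> = S'.ac (\<alpha> g \<otimes>\<^bsub>H'\<^esub> \<alpha> h) u"
      using S'.ac_comp[of "\<alpha> g" "\<alpha> h" u] \<alpha>(1) gh \<beta>c v by simp
    finally show "S'.ac (\<alpha> (g \<otimes>\<^bsub>H\<^esub> h)) u = S'.ac (\<alpha> g \<otimes>\<^bsub>H'\<^esub> \<alpha> h) u" .
  qed (use \<alpha>(1) gh in simp_all)
  have \<alpha>i: "inj_on \<alpha> M"
  proof (rule inj_onI)
    fix g h assume gh: "g \<in> M" "h \<in> M" "\<alpha> g = \<alpha> h"
    show "g = h"
    proof (rule V.act_eqI)
      fix v assume v: "v \<in> carrier S.AN"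
      then have "\<beta> (S.ac g v) = \<beta> (S.ac h v)" using \<alpha>(2) gh by simp
      then show "S.ac g v = S.ac h v"
        using bij S.ac_closed[of g v] S.ac_closed[of h v] gh v unfolding bij_betw_def inj_on_def by simp
    qed (use gh in simp_all)
  qed
  define f where "f h = \<beta> (h \<otimes>\<^bsub>H\<^esub> inv\<^bsub>H\<^esub> (S.pr h)) \<otimes>\<^bsub>H'\<^esub> \<alpha> (S.pr h)" for h
  have f: "f (n \<otimes>\<^bsub>H\<^esub> m) = \<beta> n \<otimes>\<^bsub>H'\<^esub> \<alpha> m" if "n \<in> N" "m \<in> M" for n m
    unfolding f_def using that by (simp add: S.m_assoc)
  have fc: "f h \<in> carrier H'" if "h \<in> carrier H" for h
  proof -
    obtain n m where nm: "n \<in> N" "m \<in> M" "h = n \<otimes>\<^bsub>H\<^esub> m" using S.decomp \<open>h \<in> carrier H\<close> by blast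
    then show ?thesis using f \<beta>c \<alpha>(1) by simp
  qed
  have "f \<in> hom H H'"
  proof (rule homI)
    fix x y assume "x \<in> carrier H" "y \<in> carrier H"
    then obtain n m n' m' where nm: "n \<in> N" "m \<in> M" "x = n \<otimes>\<^bsub>H\<^esub> m" "n' \<in> N" "m' \<in> M" "y = n' \<otimes>\<^bsub>H\<^esub> m'"
      using S.decomp by metis
    have "f (x \<otimes>\<^bsub>H\<^esub> y) = f ((n \<otimes>\<^bsub>H\<^esub> S.ac m n') \<otimes>\<^bsub>H\<^esub> (m \<otimes>\<^bsub>H\<^esub> m'))"
      using S.mult_split nm by simp
    also have "\<dots> = \<beta> (n \<otimes>\<^bsub>H\<^esub> S.ac m n') \<otimes>\<^bsub>H'\<^esub> \<alpha> (m \<otimes>\<^bsub>H\<^esub> m')"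
      using nm S.ac_closed[of m n'] by (intro f) simp_all
    also have "\<dots> = (\<beta> n \<otimes>\<^bsub>H'\<^esub> S'.ac (\<alpha> m) (\<beta> n')) \<otimes>\<^bsub>H'\<^esub> (\<alpha> m \<otimes>\<^bsub>H'\<^esub> \<alpha> m')"
      using nm S.ac_closed[of m n'] \<beta>m \<alpha>(2) \<alpha>m by simp
    also have "\<dots> = f x \<otimes>\<^bsub>H'\<^esub> f y"
      using S'.mult_split[of "\<beta> n" "\<alpha> m" "\<beta> n'" "\<alpha> m'"] nm \<beta>c \<alpha>(1) f by simp
    finally show "f (x \<otimes>\<^bsub>H\<^esub> y) = f x \<otimes>\<^bsub>H'\<^esub> f y" .
  qed (rule fc)
  moreover have "bij_betw f (carrier H) (carrier H')"
  proof -
    have inj: "inj_on f (carrier H)"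
    proof (rule inj_onI)
      fix x y assume xy: "x \<in> carrier H" "y \<in> carrier H" "f x = f y"
      then obtain n m n' m' where nm: "n \<in> N" "m \<in> M" "x = n \<otimes>\<^bsub>H\<^esub> m" "n' \<in> N" "m' \<in> M" "y = n' \<otimes>\<^bsub>H\<^esub> m'"
        using S.decomp by metis
      then have "\<beta> n \<otimes>\<^bsub>H'\<^esub> \<alpha> m = \<beta> n' \<otimes>\<^bsub>H'\<^esub> \<alpha> m'" using xy(3) f by simp
      then have "\<beta> n = \<beta> n'" "\<alpha> m = \<alpha> m'"
        using S'.split_unique[of "\<beta> n" "\<beta> n'" "\<alpha> m" "\<alpha> m'"] nm \<beta>c \<alpha>(1) by simp_all
      then show "x = y" using nm bij \<alpha>i unfolding bij_betw_def by (metis inj_onD)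
    qed
    have "f ` carrier H = carrier H'"
    proof (rule card_subset_eq)
      show "f ` carrier H \<subseteq> carrier H'" using fc by blast
      show "card (f ` carrier H) = card (carrier H')"
        using inj S.card_eq S'.card_eq bij_betw_same_card[OF bij] cM by (simp add: card_image)
    qed (rule S'.fin)
    then show ?thesis using inj unfolding bij_betw_def by blast
  qed
  ultimately show ?thesis by (intro is_isoI[of f] isoI)
qed

text \<open>Orders of kernel and complement for \<open>C_2\<close>, \<open>C_3\<close>,
  \<open>S_3\<close>, \<open>A_4\<close>, the group of order 21, \<open>AGL(1,5)\<close>,
  \<open>AGL(1,7)\<close> and \<open>M(9)\<close>, in this order.\<close>

definition affine_pairs :: "(nat \<times> nat) set" where
  "affine_pairs = {(2, 1), (3, 1), (3, 2), (4, 3), (7, 3), (5, 4), (7, 6), (9, 8)}"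

text \<open>The last clause separates \<open>M(9)\<close> from \<open>AGL(1,9)\<close>, which has
  the same pair \<open>(9, 8)\<close> but a cyclic complement; exponent 4 leaves only the quaternion
  group.\<close>

definition affine_model :: "('a, 'b) monoid_scheme \<Rightarrow> nat \<Rightarrow> nat \<Rightarrow> bool" where
  "affine_model G q k \<longleftrightarrow> (\<exists>N M. affine_split G N M \<and> card N = q \<and> card M = k \<and>
     (k = 8 \<longrightarrow> (\<forall>g\<in>M. g [^]\<^bsub>G\<^esub> (4::nat) = \<one>\<^bsub>G\<^esub>)))"

lemma (in group) commute_of_prime_order:
  assumes p: "Factorial_Ring.prime (order G)" and xy: "x \<in> carrier G" "y \<in> carrier G"
  shows "x \<otimes> y = y \<otimes> x"
proof (cases "x = \<one>")
  case False
  have fin: "finite (carrier G)"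
    using p card.infinite unfolding order_def by (metis not_prime_0)
  have "ord x dvd order G" using ord_dvd_group_order[OF xy(1)] .
  then have "ord x = order G" using p False ord_eq_1[OF xy(1)] unfolding prime_nat_iff by blast
  then have "generate G {x} = carrier G"
    by (intro card_subset_eq fin) (use generate_in_carrier[of "{x}"] generate_pow_card[OF xy(1)] xy in \<open>auto simp: order_def\<close>)
  then show ?thesis using commute_generate[OF xy(1)] xy by simp
qed (use xy in simp)

text \<open>An element and its inverse have the same normal closure, and conjugate elements are
  equal here.\<close>

lemma (in group) SMP_commutative_exponent_2:
  assumes "SMP G" and comm: "\<And>x y. x \<in> carrier G \<Longrightarrow> y \<in> carrier G \<Longrightarrow> x \<otimes> y = y \<otimes> x"
    and x: "x \<in> carrier G"
  shows "x \<otimes> x = \<one>"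
proof -
  have inv_mem: "inv u \<in> normal_closure G u" if "u \<in> carrier G" for u
    using normal_closure_mem[OF that] normal_imp_subgroup[OF normal_closure_normal[OF that]]
    by (rule subgroup.m_inv_closed[rotated])
  have "normal_closure G x = normal_closure G (inv x)"
    using inv_mem[OF x] inv_mem[of "inv x"] x by (intro normal_closure_eqI) auto
  then have "conj_in G (inv x) x" using assms(1) x unfolding SMP_def by simp
  then obtain g where g: "g \<in> carrier G" "x = cj g (inv x)" unfolding conj_in_def cj_def by blast
  have "cj g (inv x) = inv x" using cj_eq_self_iff[of g "inv x"] comm[of "inv x" g] g(1) x by simp
  then have "x = inv x" using g by simp
  then show ?thesis using r_inv[OF x] by simp
qed

lemma (in group) SMP_of_exponent_2:
  assumes "\<And>x. x \<in> carrier G \<Longrightarrow> x \<otimes> x = \<one>"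
  shows "SMP G"
proof -
  have inv: "inv x = x" if "x \<in> carrier G" for x using assms[OF that] inv_equality that by simp
  have "x \<otimes> y = y \<otimes> x" if "x \<in> carrier G" "y \<in> carrier G" for x y
    using inv_mult_group[of x y] inv[of "x \<otimes> y"] inv that by simp
  moreover have "x [^] (4::nat) = \<one>" if "x \<in> carrier G" for x
    using assms that by (simp add: eval_nat_numeral m_assoc)
  ultimately have "MP G" by (intro MP_of_commutative) blast+
  then show ?thesis unfolding MP_def SMP_def using inv by metis
qed

context affine_split
begin

lemma finite_N: "finite N" and finite_M: "finite M"
  using fin finite_subset[OF M.subset] finite_subset[OF N.subset] by auto

lemma half_transitive_of_pair:
  assumes "(card N, card M) \<in> affine_pairs"
  shows "half_transitive_action KM AN ac"
proof -
  interpret V: fpf_action KM AN ac by (rule fpf_action)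
  show ?thesis by (rule V.half_transitive_of_card) (use assms in \<open>auto simp: affine_pairs_def\<close>)
qed

lemma commute_M:
  assumes "(card N, card M) \<in> affine_pairs" "card M \<noteq> 8" and gh: "g \<in> M" "h \<in> M"
  shows "g \<otimes> h = h \<otimes> g"
proof -
  interpret V: fpf_action KM AN ac by (rule fpf_action)
  have pr5: "Factorial_Ring.prime (5::nat)" and pr7: "Factorial_Ring.prime (7::nat)" by simp_all
  have "Factorial_Ring.prime (card N) \<or> Factorial_Ring.prime (card M)"
    using assms(1,2) two_is_prime_nat pr5 pr7 unfolding affine_pairs_def by auto
  then show ?thesis
  proof
    assume "Factorial_Ring.prime (card N)"
    then show ?thesis using V.commute_of_prime_card[of g h] gh by simp
  next
    assume "Factorial_Ring.prime (card M)"
    then show ?thesis using V.commute_of_prime_order[of g h] gh by (simp add: order_def)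
  qed
qed

lemma MP_KM_of_pair:
  assumes p: "(card N, card M) \<in> affine_pairs"
    and exp4: "card M = 8 \<Longrightarrow> \<forall>g\<in>M. g [^] (4::nat) = \<one>"
  shows "MP KM"
proof (cases "card M = 8")
  case True
  interpret V: fpf_action KM AN ac by (rule fpf_action)
  have "SMP KM"
    by (rule V.SMP_of_card_8) (use True exp4[OF True] nat_pow_consistent in auto)
  then show ?thesis by (rule SMP_imp_MP)
next
  case False
  interpret V: fpf_action KM AN ac by (rule fpf_action)
  show ?thesis
  proof (rule V.MP_of_commutative)
    show "x \<otimes>\<^bsub>KM\<^esub> y = y \<otimes>\<^bsub>KM\<^esub> x" if "x \<in> carrier KM" "y \<in> carrier KM" for x y
      using commute_M[OF p False] that by simp
    fix x assume x: "x \<in> carrier KM"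
    have "V.ord x dvd card M" using V.ord_dvd_group_order[OF x] by (simp add: order_def)
    moreover have "card M dvd 4 \<or> card M dvd 6" using p False unfolding affine_pairs_def by auto
    ultimately have "V.ord x dvd 4 \<or> V.ord x dvd 6" using dvd_trans by blast
    then show "x [^]\<^bsub>KM\<^esub> (4::nat) = \<one>\<^bsub>KM\<^esub> \<or> x [^]\<^bsub>KM\<^esub> (6::nat) = \<one>\<^bsub>KM\<^esub>"
      using V.pow_eq_id[OF x] by blast
  qed
qed

text \<open>For even |M| the involution of \<open>M\<close> inverts \<open>N\<close>, so each orbit
  contains inverses and transitivity up to inversion becomes transitivity. With trivial
  \<open>M\<close> there is only one nontrivial element. \<open>M\<close> itself has exponent 2 or
  is quaternion.\<close>

lemma SMP_of_pair:
  assumes p: "(card N, card M) \<in> {(2, 1), (3, 2), (9, 8)}"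
    and exp4: "card M = 8 \<Longrightarrow> \<forall>g\<in>M. g [^] (4::nat) = \<one>"
  shows "SMP H"
proof (rule SMP_of_complement)
  interpret V: fpf_action KM AN ac by (rule fpf_action)
  interpret t: half_transitive_action KM AN ac
    by (rule half_transitive_of_pair) (use p in \<open>auto simp: affine_pairs_def\<close>)
  show "SMP KM"
  proof (cases "card M = 8")
    case True
    then show ?thesis
      by (intro V.SMP_of_card_8) (use exp4[OF True] nat_pow_consistent in auto)
  next
    case False
    show ?thesis
    proof (rule V.SMP_of_exponent_2)
      fix x assume x: "x \<in> carrier KM"
      have "V.ord x dvd card M" using V.ord_dvd_group_order[OF x] by (simp add: order_def)
      moreover have "card M dvd 2" using p False by auto
      ultimately have "x [^]\<^bsub>KM\<^esub> (2::nat) = \<one>\<^bsub>KM\<^esub>" using V.pow_eq_id[OF x, of 2] dvd_trans by blast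
      moreover have "x [^]\<^bsub>KM\<^esub> (2::nat) = x [^] (2::nat)" using nat_pow_consistent by simp
      ultimately show "x \<otimes>\<^bsub>KM\<^esub> x = \<one>\<^bsub>KM\<^esub>" using x by (simp add: numeral_2_eq_2)
    qed
  qed
  fix u v assume uv: "u \<in> N" "u \<noteq> \<one>" "v \<in> N" "v \<noteq> \<one>"
  have conj: "conj_in H w (ac g w)" if "g \<in> M" for g w
    unfolding conj_in_def ac_def using that by (intro bexI[of _ "inv g"]) auto
  show "conj_in H v u"
  proof (cases "card M = 1")
    case True
    then have "card N = 2" using p by auto
    then have "card (N - {\<one>}) = 1" using finite_N by (simp add: card_Diff_singleton)
    then obtain w where "N - {\<one>} = {w}" by (rule card_1_singletonE)
    moreover have "u \<in> N - {\<one>}" "v \<in> N - {\<one>}" using uv by simp_all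
    ultimately have "u = v" by simp
    then show ?thesis using conj_in_refl uv by simp
  next
    case False
    then have "even (card (carrier KM))" using p by auto
    then obtain z where z: "z \<in> carrier KM" "z \<noteq> \<one>\<^bsub>KM\<^esub>" "z \<otimes>\<^bsub>KM\<^esub> z = \<one>\<^bsub>KM\<^esub>"
      using V.ex_involution by blast
    obtain g where g: "g \<in> M" "u = ac g v \<or> u = ac g (inv\<^bsub>AN\<^esub> v)" using t.trans[of u v] uv by auto
    moreover have "ac g (inv\<^bsub>AN\<^esub> v) = ac (g \<otimes> z) v"
      using V.involution_inverts[OF z, of v] ac_comp[of g z v] g(1) z(1) uv by simp
    ultimately show ?thesis using conj[of g v] conj[of "g \<otimes> z" v] z(1) by auto
  qed
qed

text \<open>\<open>M\<close> is a quotient of \<open>H\<close>, so it would be abelian with the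
  strong property and hence of exponent 2; but it has at most one involution and more than two
  elements. The remaining case of trivial \<open>M\<close> is the group of order 3.\<close>

lemma not_SMP_of_pair:
  assumes p: "(card N, card M) \<in> affine_pairs - {(2, 1), (3, 2), (9, 8)}"
  shows "\<not> SMP H"
proof
  assume S: "SMP H"
  have p': "(card N, card M) \<in> affine_pairs" "card M \<noteq> 8" using p unfolding affine_pairs_def by auto
  interpret V: fpf_action KM AN ac by (rule fpf_action)
  show False
  proof (cases "card M = 1")
    case True
    then have c3: "card N = 3" using p unfolding affine_pairs_def by auto
    have "order H = 3" using card_eq True c3 by (simp add: order_def)
    then have comm: "x \<otimes> y = y \<otimes> x" if "x \<in> carrier H" "y \<in> carrier H" for x y
      using commute_of_prime_order that by simp
    obtain v where v: "v \<in> N" "v \<noteq> \<one>" using nontriv N.one_closed by blast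
    have vc: "v \<in> carrier H" using v by simp
    have "v \<otimes> v = \<one>" using SMP_commutative_exponent_2[OF S comm vc] by blast
    moreover have "v [^] (3::nat) = \<one>" using pow_order_eq_1[OF vc] \<open>order H = 3\<close> by simp
    ultimately show False using v vc by (simp add: eval_nat_numeral)
  next
    case False
    then have c: "card M > 2" using p unfolding affine_pairs_def by auto
    have SK: "SMP KM" using group_hom.SMP_img[OF pr_hom fin pr_img S] .
    obtain g where g: "g \<in> carrier KM" "g \<otimes>\<^bsub>KM\<^esub> g \<noteq> \<one>\<^bsub>KM\<^esub>"
      using V.ex_square_nontrivial[OF V.subgroup_self, of "{}"] c by auto
    moreover have "g \<otimes>\<^bsub>KM\<^esub> g = \<one>\<^bsub>KM\<^esub>"
      by (rule V.SMP_commutative_exponent_2[OF SK _ g(1)]) (use commute_M[OF p'] in simp)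
    ultimately show False by blast
  qed
qed

end

lemma affine_model_primitive_MP:
  assumes "affine_model H q k" "(q, k) \<in> affine_pairs"
  shows "primitive H" "MP H"
proof -
  obtain N M where S: "affine_split H N M" "card N = q" "card M = k"
    "k = 8 \<longrightarrow> (\<forall>g\<in>M. g [^]\<^bsub>H\<^esub> (4::nat) = \<one>\<^bsub>H\<^esub>)" using assms(1) unfolding affine_model_def by blast
  interpret affine_split H N M by (rule S)
  have t: "half_transitive_action KM AN ac" using half_transitive_of_pair assms(2) S by simp
  show "primitive H" using primitive_of_half_transitive t .
  show "MP H" using MP_of_complement[OF MP_KM_of_pair t] assms(2) S by simp
qed

lemma affine_model_SMP_iff:
  assumes "affine_model H q k" "(q, k) \<in> affine_pairs"
  shows "SMP H \<longleftrightarrow> (q, k) \<in> {(2, 1), (3, 2), (9, 8)}"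
proof -
  obtain N M where S: "affine_split H N M" "card N = q" "card M = k"
    "k = 8 \<longrightarrow> (\<forall>g\<in>M. g [^]\<^bsub>H\<^esub> (4::nat) = \<one>\<^bsub>H\<^esub>)" using assms(1) unfolding affine_model_def by blast
  interpret affine_split H N M by (rule S)
  have "SMP H" if "(q, k) \<in> {(2, 1), (3, 2), (9, 8)}"
    by (rule SMP_of_pair) (use that S(2-4) in simp_all)
  moreover have "\<not> SMP H" if "(q, k) \<notin> {(2, 1), (3, 2), (9, 8)}"
    by (rule not_SMP_of_pair) (use that assms(2) S(2,3) in simp)
  ultimately show ?thesis by blast
qed

lemma affine_model_unique:
  assumes "affine_model H q k" "affine_model H' q k" "(q, k) \<in> affine_pairs"
  shows "H \<cong> H'"
proof -
  obtain N M where S: "affine_split H N M" "card N = q" "card M = k"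
    "k = 8 \<longrightarrow> (\<forall>g\<in>M. g [^]\<^bsub>H\<^esub> (4::nat) = \<one>\<^bsub>H\<^esub>)" using assms(1) unfolding affine_model_def by blast
  obtain N' M' where S': "affine_split H' N' M'" "card N' = q" "card M' = k"
    "k = 8 \<longrightarrow> (\<forall>g\<in>M'. g [^]\<^bsub>H'\<^esub> (4::nat) = \<one>\<^bsub>H'\<^esub>)" using assms(2) unfolding affine_model_def by blast
  interpret S: affine_split H N M by (rule S)
  interpret S': affine_split H' N' M' by (rule S')
  have "\<exists>\<beta>. equivariant_iso S.KM S.AN S.ac S'.KM S'.AN S'.ac \<beta>"
  proof (cases "k = 8")
    case True
    then have "q = 9" using assms(3) unfolding affine_pairs_def by auto
    show ?thesis
      by (rule equivariant_iso_9_8[OF S.fpf_action S'.fpf_action])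
         (use S S' True \<open>q = 9\<close> S.nat_pow_consistent[symmetric] S'.nat_pow_consistent[symmetric] in auto)
  next
    case F8: False
    show ?thesis
    proof (cases "q = 4")
      case True
      then have "k = 3" using assms(3) unfolding affine_pairs_def by auto
      show ?thesis
        by (rule equivariant_iso_4_3[OF S.fpf_action S'.fpf_action]) (use S S' True \<open>k = 3\<close> in auto)
    next
      case False
      have pr5: "Factorial_Ring.prime (5::nat)" and pr7: "Factorial_Ring.prime (7::nat)" by simp_all
      have "(q, k) \<in> {(2, 1), (3, 1), (3, 2), (7, 3), (5, 4), (7, 6)}"
        using assms(3) False F8 unfolding affine_pairs_def by simp
      then have "Factorial_Ring.prime q \<and> (k = 1 \<or> q = k + 1 \<or> q = 7 \<and> k = 3)"
        using two_is_prime_nat pr5 pr7 by (elim insertE) simp_all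
      then show ?thesis
        using equivariant_iso_prime[OF S.fpf_action S'.fpf_action] S(2,3) S'(2,3) by simp
    qed
  qed
  then show ?thesis using split_iso[OF S(1) S'(1)] S(3) S'(3) by auto
qed

section \<open>Primitive groups with the Magnus property\<close>

text \<open>The class equation: class sizes are powers of \<open>p\<close>, and without a nontrivial
  central element all classes but that of the identity would have size divisible by
  \<open>p\<close>.\<close>

lemma (in group) center_nontrivial:
  assumes p: "Factorial_Ring.prime p" and o: "order G = p ^ n" and n: "n > 0"
  obtains z where "z \<in> carrier G" "z \<noteq> \<one>" "\<And>x. x \<in> carrier G \<Longrightarrow> z \<otimes> x = x \<otimes> z"
proof -
  have fin: "finite (carrier G)"
    using o p by (metis card.infinite order_def power_eq_0_iff not_prime_0)
  let ?\<phi> = "\<lambda>g. \<lambda>h\<in>carrier G. g \<otimes> h \<otimes> inv g"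
  interpret act: group_action G "carrier G" ?\<phi> by (rule action_by_conjugation)
  let ?O = "orbits G (carrier G) ?\<phi>"
  have orb1: "orbit G ?\<phi> \<one> = {\<one>}"
  proof
    show "orbit G ?\<phi> \<one> \<subseteq> {\<one>}" unfolding orbit_def by auto
    show "{\<one>} \<subseteq> orbit G ?\<phi> \<one>" using act.orbit_refl[of \<one>] by simp
  qed
  have mem1: "{\<one>} \<in> ?O" unfolding orbits_def using orb1 by blast
  have finO: "finite ?O" unfolding orbits_def using fin by simp
  have "\<exists>z\<in>carrier G. z \<noteq> \<one> \<and> (\<forall>x\<in>carrier G. z \<otimes> x = x \<otimes> z)"
  proof (rule ccontr)
    assume nz: "\<not> ?thesis"
    have dvd: "p dvd card C" if C: "C \<in> ?O" "C \<noteq> {\<one>}" for C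
    proof -
      obtain x where x: "x \<in> carrier G" "C = orbit G ?\<phi> x" using C unfolding orbits_def by blast
      have "card C dvd p ^ n" using act.orbit_stabilizer_theorem[OF x(1)] unfolding x(2) o by (rule dvdI[OF sym])
      then obtain i where i: "card C = p ^ i" using divides_primepow_nat[OF p] by blast
      show ?thesis
      proof (cases "i = 0")
        case False
        then show ?thesis using i by simp
      next
        case True
        then obtain y where y: "C = {y}" using i card_1_singletonE[of C] by auto
        have self: "x \<in> C" unfolding x(2) using act.orbit_refl x(1) by blast
        have "x \<noteq> \<one>" using C(2) y self by blast
        moreover have "x \<otimes> g = g \<otimes> x" if g: "g \<in> carrier G" for g
        proof -
          have "?\<phi> g x \<in> C" unfolding x(2) orbit_def using g by blast
          then have "g \<otimes> x \<otimes> inv g = x" using y self x(1) by simp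
          then have "g \<otimes> x = x \<otimes> g" using g x(1) by (metis inv_solve_right m_closed)
          then show ?thesis by simp
        qed
        ultimately show ?thesis using nz x(1) by blast
      qed
    qed
    have "order G = (\<Sum>C\<in>?O. card C)"
      using act.disjoint_sum[OF fin, of "\<lambda>_. 1 :: nat"] unfolding order_def by simp
    also have "\<dots> = card {\<one>} + (\<Sum>C\<in>?O - {{\<one>}}. card C)" using finO mem1 by (rule sum.remove)
    finally have e: "p ^ n = 1 + (\<Sum>C\<in>?O - {{\<one>}}. card C)" using o by simp
    have "p dvd (\<Sum>C\<in>?O - {{\<one>}}. card C)" using dvd by (intro dvd_sum) auto
    moreover have "p dvd 1 + (\<Sum>C\<in>?O - {{\<one>}}. card C)" unfolding e[symmetric] using n by (simp add: dvd_power)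
    ultimately have "p dvd 1" using dvd_add_left_iff by blast
    then show False using p not_prime_unit by blast
  qed
  then show thesis using that by blast
qed

text \<open>All nontrivial elements of a minimal normal subgroup \<open>N\<close> have normal closure \<open>N\<close>, hence are
  conjugate up to inversion and of the same prime order.\<close>

lemma (in group) MP_minimal_normal_abelian:
  assumes fin: "finite (carrier G)" and MP: "MP G" and nt: "carrier G \<noteq> {\<one>}"
  obtains N where "N \<lhd> G" "N \<noteq> {\<one>}" "\<And>x y. x \<in> N \<Longrightarrow> y \<in> N \<Longrightarrow> x \<otimes> y = y \<otimes> x"
    "\<And>x. x \<in> N \<Longrightarrow> x \<noteq> \<one> \<Longrightarrow> normal_closure G x = N"
proof -
  let ?P = "\<lambda>N. N \<lhd> G \<and> N \<noteq> {\<one>}"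
  have "?P (carrier G)" using normal_self nt by blast
  then obtain N where N: "?P N" and least: "\<And>L. ?P L \<Longrightarrow> card N \<le> card L"
    using ex_has_least_nat[of ?P "carrier G" card] by blast
  interpret N: normal N G using N by blast
  have finN: "finite N" using finite_subset[OF N.subset fin] .
  have ncl: "normal_closure G x = N" if x: "x \<in> N" "x \<noteq> \<one>" for x
  proof (rule card_seteq[OF finN])
    have xc: "x \<in> carrier G" using x by simp
    show "normal_closure G x \<subseteq> N" using normal_closure_least N x by blast
    have "normal_closure G x \<noteq> {\<one>}" using normal_closure_mem[OF xc] x by blast
    then show "card N \<le> card (normal_closure G x)" using least normal_closure_normal[OF xc] by blast
  qed
  have trans: "\<exists>g\<in>carrier G. x = cj g y \<or> x = cj g (inv y)" if "x \<in> N" "x \<noteq> \<one>" "y \<in> N" "y \<noteq> \<one>" for x y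
  proof -
    have "normal_closure G x = normal_closure G y" using ncl that by simp
    moreover have "x \<in> carrier G" "y \<in> carrier G" using that by simp_all
    ultimately have "conj_in G y x \<or> conj_in G (inv y) x" using MP unfolding MP_def by blast
    then show ?thesis unfolding conj_in_def cj_def by blast
  qed
  have "card N \<noteq> 1" using N N.one_closed by (metis card_1_singletonE singletonD)
  then obtain p where p: "Factorial_Ring.prime p" "p dvd card N" using prime_factor_nat by blast
  obtain e where e: "e \<in> N" "e \<noteq> \<one>" "e [^] p = \<one>" using subgroup_cauchy[OF N.subgroup_axioms finN p] .
  have expo: "x [^] p = \<one>" if x: "x \<in> N" for x
  proof (cases "x = \<one>")
    case False
    obtain g where g: "g \<in> carrier G" "x = cj g e \<or> x = cj g (inv e)" using trans[OF x False e(1,2)] by blast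
    have "inv e [^] p = \<one>" using nat_pow_inv[of e p] e by simp
    moreover have "cj g \<one> = \<one>" using g(1) by (simp add: cj_def)
    ultimately show ?thesis using cj_nat_pow[OF g(1), of e p] cj_nat_pow[OF g(1), of "inv e" p] g(2) e by auto
  qed simp
  interpret NG: group "G\<lparr>carrier := N\<rparr>" by (rule subgroup_imp_group[OF N.subgroup_axioms])
  \<comment> \<open>An element of prime order \<open>r\<close> is also killed by \<open>p\<close>,
    so by Cauchy \<open>p\<close> is the only prime dividing |N| and \<open>N\<close> is a
    \<open>p\<close>-group.\<close>
  have only_p: "r = p" if r: "Factorial_Ring.prime r" "r dvd card N" for r
  proof -
    obtain x where x: "x \<in> N" "x \<noteq> \<one>" "x [^] r = \<one>" using subgroup_cauchy[OF N.subgroup_axioms finN r] .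
    have xc: "x \<in> carrier G" using x by simp
    show ?thesis using ord_eq_prime[OF xc x(2,3) r(1)] ord_eq_prime[OF xc x(2) expo[OF x(1)] p(1)] by simp
  qed
  have cN: "card N > 0" using finN N.one_closed card_gt_0_iff by blast
  obtain m where m: "card N = p ^ multiplicity p (card N) * m" "\<not> p dvd m"
    using multiplicity_decompose'[of "card N" p] cN p(1) not_prime_unit by (metis less_not_refl2)
  have "m = 1"
  proof (rule ccontr)
    assume "m \<noteq> 1"
    then obtain r where r: "Factorial_Ring.prime r" "r dvd m" using prime_factor_nat by blast
    then have "r dvd card N" using m(1) by (metis dvd_mult)
    then show False using only_p r m(2) by blast
  qed
  moreover have "multiplicity p (card N) \<noteq> 0"
  proof
    assume "multiplicity p (card N) = 0"
    then have "card N = 1" using m(1) \<open>m = 1\<close> by simp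
    then show False using \<open>card N \<noteq> 1\<close> by blast
  qed
  ultimately obtain z where z: "z \<in> N" "z \<noteq> \<one>" "\<And>x. x \<in> N \<Longrightarrow> z \<otimes> x = x \<otimes> z"
    using NG.center_nontrivial[OF p(1), of "multiplicity p (card N)"] m(1) by (auto simp: order_def)
  have inv_z: "inv z \<otimes> x = x \<otimes> inv z" if "x \<in> N" for x
    using commute_int_pow[of x z "- 1"] z(3)[OF that] z(1) that by (simp add: int_pow_neg)
  \<comment> \<open>A nontrivial \<open>x\<close> in \<open>N\<close> is a conjugate in
    \<open>G\<close> of the central element \<open>z\<close> or its inverse, and conjugation
    preserves \<open>N\<close>, hence its centre.\<close>
  have "x \<otimes> y = y \<otimes> x" if xy: "x \<in> N" "y \<in> N" for x y
  proof (cases "x = \<one>")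
    case False
    obtain g w where g: "g \<in> carrier G" "x = cj g w" "w = z \<or> w = inv z"
      using trans[OF xy(1) False z(1,2)] by blast
    have w: "w \<in> N" "\<And>u. u \<in> N \<Longrightarrow> w \<otimes> u = u \<otimes> w" using g(3) z inv_z by auto
    have yN: "cj (inv g) y \<in> N" unfolding cj_def using N.inv_op_closed2[OF g(1) xy(2)] g(1) by simp
    have y: "y = cj g (cj (inv g) y)" using cj_cj[of "inv g" g y] g(1) xy by simp
    have "x \<otimes> y = cj g (w \<otimes> cj (inv g) y)"
      using y g(2) cj_mult[OF g(1), of w "cj (inv g) y"] w(1) yN by simp
    also have "\<dots> = cj g (cj (inv g) y \<otimes> w)" using w(2) yN by simp
    also have "\<dots> = y \<otimes> x" using y g(2) cj_mult[OF g(1), of "cj (inv g) y" w] w(1) yN by simp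
    finally show ?thesis .
  qed (use xy in simp)
  then show thesis using that N ncl by blast
qed

theorem (in group) primitive_MP_affine_model:
  assumes fin: "finite (carrier G)" and prim: "primitive G" and MP: "MP G"
  shows "\<exists>q k. (q, k) \<in> affine_pairs \<and> affine_model G q k"
proof -
  obtain M where M: "maximal_subgroup G M" and core1: "core G M = {\<one>}"
    using prim unfolding primitive_def by blast
  have sub: "subgroup M G" and neq: "M \<noteq> carrier G" using M unfolding maximal_subgroup_def by auto
  interpret M: subgroup M G by (rule sub)
  have nt: "carrier G \<noteq> {\<one>}"
  proof
    assume e: "carrier G = {\<one>}"
    have "M \<subseteq> {\<one>}" using M.subset unfolding e .
    then have "M = {\<one>}" using M.one_closed by blast
    then show False using neq e by simp
  qed
  have "\<exists>N. N \<lhd> G \<and> N \<noteq> {\<one>} \<and> (\<forall>x\<in>N. \<forall>y\<in>N. x \<otimes> y = y \<otimes> x) \<and>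
      (\<forall>x\<in>N. x \<noteq> \<one> \<longrightarrow> normal_closure G x = N)"
    by (rule MP_minimal_normal_abelian[OF fin MP nt]) (intro exI conjI ballI impI)
  then obtain N where normal: "N \<lhd> G" and N1: "N \<noteq> {\<one>}"
    and comm_ncl: "\<forall>x\<in>N. \<forall>y\<in>N. x \<otimes> y = y \<otimes> x" "\<forall>x\<in>N. x \<noteq> \<one> \<longrightarrow> normal_closure G x = N"
    by (elim exE conjE)
  have comm: "x \<otimes> y = y \<otimes> x" if "x \<in> N" "y \<in> N" for x y using comm_ncl(1) that by blast
  have ncl: "normal_closure G x = N" if "x \<in> N" "x \<noteq> \<one>" for x using comm_ncl(2) that by blast
  interpret N: normal N G by (rule normal)
  \<comment> \<open>\<open>N\<close> is not inside \<open>M\<close>, for then it would be inside the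
    trivial core; so maximality of \<open>M\<close> makes the product everything.\<close>
  have NM: "\<exists>n\<in>N. \<exists>m\<in>M. g = n \<otimes> m" if g: "g \<in> carrier G" for g
  proof -
    have S: "subgroup (N <#> M) G" using mult_norm_subgroup[OF normal sub] .
    have MS: "M \<subseteq> N <#> M"
    proof
      fix m assume m: "m \<in> M"
      then have "\<one> \<otimes> m \<in> N <#> M" using N.one_closed unfolding set_mult_def by blast
      then show "m \<in> N <#> M" using m by simp
    qed
    have NS: "N \<subseteq> N <#> M"
    proof
      fix n assume n: "n \<in> N"
      then have "n \<otimes> \<one> \<in> N <#> M" using M.one_closed unfolding set_mult_def by blast
      then show "n \<in> N <#> M" using n by simp
    qed
    have "N <#> M \<noteq> M"
    proof
      assume "N <#> M = M"
      then have "N \<subseteq> core G M" using normal_subset_core[OF normal _ M.subset] NS by simp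
      then show False using core1 N1 N.one_closed by blast
    qed
    then have "N <#> M = carrier G" using M S MS unfolding maximal_subgroup_def by blast
    then have "g \<in> N <#> M" using g by simp
    then show ?thesis unfolding set_mult_def by blast
  qed
  \<comment> \<open>The intersection is normalised by \<open>M\<close> and centralised by the
    abelian group \<open>N\<close>, so it lies in the core.\<close>
  have cap: "N \<inter> M = {\<one>}"
  proof
    show "N \<inter> M \<subseteq> {\<one>}"
    proof
      fix d assume d: "d \<in> N \<inter> M"
      have "d \<in> core G M"
      proof (rule mem_coreI)
        fix g assume "g \<in> carrier G"
        then obtain n m where nm: "n \<in> N" "m \<in> M" "g = n \<otimes> m" using NM by blast
        have dN: "m \<otimes> d \<otimes> inv m \<in> N" and dM: "m \<otimes> d \<otimes> inv m \<in> M"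
          using d nm N.inv_op_closed2[of m d] by auto
        have "g \<otimes> d \<otimes> inv g = n \<otimes> (m \<otimes> d \<otimes> inv m) \<otimes> inv n"
          unfolding nm(3) using d nm by (simp add: m_assoc inv_mult_group)
        also have "\<dots> = m \<otimes> d \<otimes> inv m \<otimes> n \<otimes> inv n" using comm[OF nm(1) dN] by simp
        also have "\<dots> = m \<otimes> d \<otimes> inv m" using d nm by (simp add: m_assoc)
        finally show "g \<otimes> d \<otimes> inv g \<in> M" using dM by simp
      qed (use d M.subset in auto)
      then show "d \<in> {\<one>}" using core1 by simp
    qed
  qed simp
  \<comment> \<open>An element centralising \<open>N\<close> has the same conjugate under
    \<open>n k\<close> and a suitable rearrangement \<open>k d\<close>, namely its conjugate under
    \<open>k\<close>, which stays in \<open>M\<close>; so it lies in the core.\<close>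
  have cent: "m = \<one>" if m: "m \<in> M" "\<And>v. v \<in> N \<Longrightarrow> m \<otimes> v = v \<otimes> m" for m
  proof -
    have "m \<in> core G M"
    proof (rule mem_coreI)
      fix g assume "g \<in> carrier G"
      then obtain n k where nk: "n \<in> N" "k \<in> M" "g = n \<otimes> k" using NM by blast
      define d where "d = inv k \<otimes> n \<otimes> k"
      have dN: "d \<in> N" unfolding d_def using N.inv_op_closed1[of k n] nk by simp
      have nkd: "n \<otimes> k = k \<otimes> d" unfolding d_def using nk by (simp add: m_assoc) (simp add: m_assoc[symmetric])
      have "g \<otimes> m \<otimes> inv g = k \<otimes> (d \<otimes> m) \<otimes> inv d \<otimes> inv k"
        unfolding nk(3) nkd using nk m(1) dN by (simp add: m_assoc inv_mult_group)
      also have "\<dots> = k \<otimes> (m \<otimes> d) \<otimes> inv d \<otimes> inv k" using m(2)[OF dN] by simp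
      also have "\<dots> = k \<otimes> m \<otimes> inv k" using nk m(1) dN by (simp add: m_assoc)
      finally show "g \<otimes> m \<otimes> inv g \<in> M" using nk m(1) by simp
    qed (use m(1) M.subset in auto)
    then show ?thesis using core1 by simp
  qed
  \<comment> \<open>Some \<open>u\<close> in \<open>N\<close> does not commute with
    \<open>m\<close>. Its commutator with \<open>v \<otimes> m\<close> is a nontrivial element of
    \<open>N\<close> inside the normal closure, and its own normal closure is
    \<open>N\<close>.\<close>
  have N_sub: "N \<subseteq> normal_closure G (v \<otimes> m)" if m: "m \<in> M" "m \<noteq> \<one>" and v: "v \<in> N" for m v
  proof -
    obtain u where u: "u \<in> N" "m \<otimes> u \<noteq> u \<otimes> m" using cent[OF m(1)] m(2) by blast
    define x where "x = v \<otimes> m"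
    have xc: "x \<in> carrier G" unfolding x_def using v m by simp
    have uc: "u \<in> carrier G" using u by simp
    interpret X: normal "normal_closure G x" G by (rule normal_closure_normal[OF xc])
    have xX: "x \<in> normal_closure G x" using normal_closure_mem[OF xc] .
    define c where "c = u \<otimes> x \<otimes> inv u \<otimes> inv x"
    have cX: "c \<in> normal_closure G x" unfolding c_def
      using X.inv_op_closed2[OF uc xX] X.m_inv_closed[OF xX] X.m_closed by blast
    have "c = u \<otimes> (x \<otimes> inv u \<otimes> inv x)" unfolding c_def using uc xc by (simp add: m_assoc)
    then have cN: "c \<in> N" using N.inv_op_closed2[OF xc, of "inv u"] u by simp
    have "c \<noteq> \<one>"
    proof
      assume "c = \<one>"
      then have "c \<otimes> x \<otimes> u = x \<otimes> u" using uc xc by simp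
      then have "u \<otimes> x = x \<otimes> u" unfolding c_def using uc xc by (simp add: m_assoc)
      then have e: "u \<otimes> v \<otimes> m = v \<otimes> (m \<otimes> u)" unfolding x_def using uc v m by (simp add: m_assoc)
      have "v \<otimes> (u \<otimes> m) = u \<otimes> v \<otimes> m" using comm[OF v u(1)] uc v m by (simp add: m_assoc[symmetric])
      then have "v \<otimes> (u \<otimes> m) = v \<otimes> (m \<otimes> u)" using e by simp
      then have "u \<otimes> m = m \<otimes> u" using uc v m by simp
      then show False using u by simp
    qed
    then have "N = normal_closure G c" using ncl cN by simp
    also have "\<dots> \<subseteq> normal_closure G x" using normal_closure_least[OF normal_closure_normal[OF xc] cX] .
    finally show ?thesis unfolding x_def .
  qed
  \<comment> \<open>The whole coset \<open>N m\<close> has one normal closure, so the Magnus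
    property applies. With the conjugating element written as \<open>n k\<close>, comparison of
    components in \<open>M\<close> gives \<open>m = k m' k^-1\<close> for either choice of
    \<open>m'\<close>, and conjugation by \<open>n\<close> alone remains.\<close>
  have conj: "\<exists>n\<in>N. v \<otimes> m = n \<otimes> m \<otimes> inv n" if m: "m \<in> M" "m \<noteq> \<one>" and v: "v \<in> N" for m v
  proof -
    have c: "v \<in> carrier G" "m \<in> carrier G" "v \<otimes> m \<in> carrier G" using v m by simp_all
    have sg: "subgroup (normal_closure G x) G" if "x \<in> carrier G" for x
      using normal_closure_normal[OF that] by (rule normal_imp_subgroup)
    have "v \<otimes> m \<in> normal_closure G m"
      using N_sub[OF m N.one_closed] v normal_closure_mem[OF c(2)] subgroup.m_closed[OF sg[OF c(2)]] c by auto
    moreover have "inv v \<otimes> (v \<otimes> m) \<in> normal_closure G (v \<otimes> m)"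
    proof (rule subgroup.m_closed[OF sg[OF c(3)]])
      have "inv v \<in> N" using v by simp
      then show "inv v \<in> normal_closure G (v \<otimes> m)" using N_sub[OF m v] by blast
    qed (rule normal_closure_mem[OF c(3)])
    moreover have "inv v \<otimes> (v \<otimes> m) = m" using c by (simp add: m_assoc[symmetric])
    ultimately have "normal_closure G (v \<otimes> m) = normal_closure G m"
      by (intro normal_closure_eqI c) simp_all
    then have "conj_in G m (v \<otimes> m) \<or> conj_in G (inv m) (v \<otimes> m)" using MP c unfolding MP_def by blast
    then obtain g m' where g: "g \<in> carrier G" "v \<otimes> m = g \<otimes> m' \<otimes> inv g" "m' = m \<or> m' = inv m"
      unfolding conj_in_def by (metis inv_closed inv_inv)
    obtain n k where nk: "n \<in> N" "k \<in> M" "g = n \<otimes> k" using NM g(1) by blast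
    have m': "m' \<in> M" using g(3) m by auto
    have kc: "k \<in> carrier G" "n \<in> carrier G" "m' \<in> carrier G" using nk m' by simp_all
    have red: "\<exists>n\<in>N. n' \<otimes> (l \<otimes> w \<otimes> inv l) \<otimes> inv n' = n \<otimes> (l \<otimes> w \<otimes> inv l)"
      if "n' \<in> N" "l \<in> M" "w \<in> M" for n' l w
    proof (rule bexI)
      have h: "n' \<in> carrier G" "l \<otimes> w \<otimes> inv l \<in> carrier G" using that by simp_all
      show "n' \<otimes> (l \<otimes> w \<otimes> inv l) \<otimes> inv n'
          = (n' \<otimes> ((l \<otimes> w \<otimes> inv l) \<otimes> inv n' \<otimes> inv (l \<otimes> w \<otimes> inv l))) \<otimes> (l \<otimes> w \<otimes> inv l)"
        using h by (simp add: m_assoc del: inv_mult_group)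
      show "n' \<otimes> ((l \<otimes> w \<otimes> inv l) \<otimes> inv n' \<otimes> inv (l \<otimes> w \<otimes> inv l)) \<in> N"
        using N.inv_op_closed2[OF h(2), of "inv n'"] that by simp
    qed
    have decomp: "v \<otimes> m = n \<otimes> (k \<otimes> m' \<otimes> inv k) \<otimes> inv n"
      unfolding g(2) nk(3) using kc by (simp add: m_assoc inv_mult_group)
    have mk: "m = k \<otimes> m' \<otimes> inv k"
    proof -
      obtain n' where n': "n' \<in> N" "v \<otimes> m = n' \<otimes> (k \<otimes> m' \<otimes> inv k)"
        using red[OF nk(1,2) m'] decomp by auto
      show ?thesis
        by (rule product_unique(2)[OF N.subgroup_axioms sub cap v n'(1) m(1) _ n'(2)]) (use nk m' in simp)
    qed
    obtain l where l: "l \<in> N" "v \<otimes> m = l \<otimes> m \<otimes> inv l"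
      using decomp mk nk(1) by auto
    then show ?thesis by blast
  qed
  \<comment> \<open>The commutator map with \<open>m\<close> is onto \<open>N\<close> by
    \<open>conj\<close>, hence injective; an element of \<open>N\<close> commuting with
    \<open>m\<close> has the same image as \<open>\<one>\<close>.\<close>
  have fpf: "v = \<one>" if m: "m \<in> M" "m \<noteq> \<one>" and v: "v \<in> N" "m \<otimes> v = v \<otimes> m" for m v
  proof -
    let ?F = "\<lambda>n. n \<otimes> m \<otimes> inv n \<otimes> inv m"
    have mc: "m \<in> carrier G" using m by simp
    have "N \<subseteq> ?F ` N"
    proof
      fix w assume w: "w \<in> N"
      then obtain n where n: "n \<in> N" "w \<otimes> m = n \<otimes> m \<otimes> inv n" using conj[OF m] by blast
      have "w = w \<otimes> m \<otimes> inv m" using w mc by (simp add: m_assoc)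
      then have "w = ?F n" using n(2) by simp
      then show "w \<in> ?F ` N" using n(1) by blast
    qed
    then have inj: "inj_on ?F N" using finite_surj_inj[OF finite_subset[OF N.subset fin]] by blast
    have "?F v = ?F \<one>"
      using v(2)[symmetric] mc N.mem_carrier[OF v(1)] by (simp add: m_assoc)
    then show ?thesis using inj v(1) N.one_closed unfolding inj_on_def by blast
  qed
  have "affine_split G N M"
    by (intro affine_split.intro affine_split_axioms.intro is_group)
       (fact fin normal sub comm cap NM N1 fpf)+
  then interpret S: affine_split G N M .
  interpret V: fpf_action S.KM S.AN S.ac by (rule S.fpf_action)
  \<comment> \<open>\<open>N\<close> is abelian, so only the component in \<open>M\<close> of a
    conjugating element matters; \<open>conj_in\<close> and \<open>ac\<close> conjugate from
    opposite sides, hence \<open>inv k\<close>.\<close>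
  have t: "half_transitive_action S.KM S.AN S.ac"
  proof unfold_locales
    fix u v assume "u \<in> carrier S.AN" "u \<noteq> \<one>\<^bsub>S.AN\<^esub>" "v \<in> carrier S.AN" "v \<noteq> \<one>\<^bsub>S.AN\<^esub>"
    then have uv: "u \<in> N" "u \<noteq> \<one>" "v \<in> N" "v \<noteq> \<one>" by simp_all
    have "normal_closure G u = normal_closure G v" using ncl uv by simp
    moreover have "u \<in> carrier G" "v \<in> carrier G" using uv by simp_all
    ultimately have "conj_in G v u \<or> conj_in G (inv v) u" using MP unfolding MP_def by blast
    then obtain g w where g: "g \<in> carrier G" "u = inv g \<otimes> w \<otimes> g" "w = v \<or> w = inv v"
      unfolding conj_in_def by blast
    obtain n k where nk: "n \<in> N" "k \<in> M" "g = n \<otimes> k" using NM g(1) by blast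
    have w: "w \<in> N" using g(3) uv by auto
    have c: "n \<in> carrier G" "k \<in> carrier G" "w \<in> carrier G" using nk w by simp_all
    have "u = inv k \<otimes> (inv n \<otimes> (w \<otimes> n)) \<otimes> k" unfolding g(2) nk(3) using c by (simp add: m_assoc inv_mult_group)
    also have "\<dots> = inv k \<otimes> (inv n \<otimes> (n \<otimes> w)) \<otimes> k" using comm[OF w nk(1)] by simp
    also have "\<dots> = S.ac (inv k) w" unfolding S.ac_def using c by (simp add: m_assoc[symmetric])
    finally have "u = S.ac (inv k) w" .
    moreover have "inv\<^bsub>S.AN\<^esub> v = inv v" using m_inv_consistent[OF N.subgroup_axioms] uv by simp
    moreover have "inv k \<in> carrier S.KM" using nk(2) by simp
    ultimately show "\<exists>g\<in>carrier S.KM. u = S.ac g v \<or> u = S.ac g (inv\<^bsub>S.AN\<^esub> v)" using g(3) by auto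
  qed
  interpret t: half_transitive_action S.KM S.AN S.ac by (rule t)
  have "MP S.KM" using group_hom.MP_img[OF S.pr_hom fin S.pr_img MP] .
  then interpret A: MP_action S.KM S.AN S.ac by unfold_locales
  have "(card N, card M) \<in> affine_pairs" using A.card_pairs unfolding affine_pairs_def by simp
  moreover have "affine_model G (card N) (card M)"
    unfolding affine_model_def
  proof (intro exI conjI impI ballI)
    show "affine_split G N M" by (rule S.affine_split_axioms)
    fix g assume 8: "card M = 8" and g: "g \<in> M"
    show "g [^] (4::nat) = \<one>"
      using A.exponent_4_of_power_2[OF V.subgroup_self, of 3 g] 8 g nat_pow_consistent[of g 4 M] by simp
  qed simp_all
  ultimately show ?thesis by blast
qed

section \<open>The eight groups\<close>

text \<open>In a finite group inverses are powers, so closure under multiplication suffices.\<close>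

lemma (in group) finite_subgroupI:
  assumes fin: "finite (carrier G)" and S: "S \<subseteq> carrier G" "\<one> \<in> S"
    and closed: "\<And>x y. x \<in> S \<Longrightarrow> y \<in> S \<Longrightarrow> x \<otimes> y \<in> S"
  shows "subgroup S G"
proof (rule subgroupI)
  fix a assume a: "a \<in> S"
  then have ac: "a \<in> carrier G" using S by blast
  have pow: "a [^] n \<in> S" for n :: nat by (induction n) (use S closed a in auto)
  have "ord a > 0" using ord_ge_1[OF fin ac] by simp
  then have "a [^] (ord a - 1) \<otimes> a = \<one>"
    using pow_ord_eq_1[OF ac] ac by (metis Suc_diff_1 nat_pow_Suc)
  then have "inv a = a [^] (ord a - 1)" using ac by (simp add: inv_equality)
  then show "inv a \<in> S" using pow by simp
qed (use S closed in auto)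

text \<open>Tailored to concrete groups: no inverses to compute, normality tested only against
  \<open>M\<close> in the form \<open>m \<otimes> n = n' \<otimes> m\<close>, and a count of
  elements in place of an explicit decomposition.\<close>

lemma (in group) affine_splitI:
  assumes fin: "finite (carrier G)"
    and N: "N \<subseteq> carrier G" "\<one> \<in> N" "\<And>x y. x \<in> N \<Longrightarrow> y \<in> N \<Longrightarrow> x \<otimes> y \<in> N"
    and M: "M \<subseteq> carrier G" "\<one> \<in> M" "\<And>x y. x \<in> M \<Longrightarrow> y \<in> M \<Longrightarrow> x \<otimes> y \<in> M"
    and comm: "\<And>x y. x \<in> N \<Longrightarrow> y \<in> N \<Longrightarrow> x \<otimes> y = y \<otimes> x"
    and norm: "\<And>m n. m \<in> M \<Longrightarrow> n \<in> N \<Longrightarrow> \<exists>n'\<in>N. m \<otimes> n = n' \<otimes> m"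
    and cap: "N \<inter> M \<subseteq> {\<one>}" and card: "card (carrier G) = card N * card M" and nt: "N \<noteq> {\<one>}"
    and fpf: "\<And>m v. m \<in> M \<Longrightarrow> m \<noteq> \<one> \<Longrightarrow> v \<in> N \<Longrightarrow> m \<otimes> v = v \<otimes> m \<Longrightarrow> v = \<one>"
  shows "affine_split G N M"
proof -
  have sN: "subgroup N G" and sM: "subgroup M G" using finite_subgroupI[OF fin] N M by blast+
  have cap': "N \<inter> M = {\<one>}" using cap N(2) M(2) by blast
  have NMc: "n \<in> carrier G" "m \<in> carrier G" if "n \<in> N" "m \<in> M" for n m using that N(1) M(1) by blast+
  have "(\<lambda>(n, m). n \<otimes> m) ` (N \<times> M) = carrier G"
  proof (rule card_subset_eq[OF fin])
    show "(\<lambda>(n, m). n \<otimes> m) ` (N \<times> M) \<subseteq> carrier G" using NMc by auto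
    have "inj_on (\<lambda>(n, m). n \<otimes> m) (N \<times> M)"
    proof (rule inj_onI, clarify)
      fix n m n' m' assume "n \<in> N" "m \<in> M" "n' \<in> N" "m' \<in> M" "n \<otimes> m = n' \<otimes> m'"
      then show "n = n' \<and> m = m'"
        using product_unique[OF sN sM cap', of n n' m m'] by simp
    qed
    then show "card ((\<lambda>(n, m). n \<otimes> m) ` (N \<times> M)) = card (carrier G)"
      using card by (simp add: card_image card_cartesian_product)
  qed
  then have dec: "\<exists>n\<in>N. \<exists>m\<in>M. h = n \<otimes> m" if h: "h \<in> carrier G" for h
  proof -
    have "h \<in> (\<lambda>(n, m). n \<otimes> m) ` (N \<times> M)" using h \<open>_ ` (N \<times> M) = carrier G\<close> by simp
    then show ?thesis by auto
  qed
  have "x \<otimes> h \<otimes> inv x \<in> N" if x: "x \<in> carrier G" and h: "h \<in> N" for x h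
  proof -
    obtain n m where nm: "n \<in> N" "m \<in> M" "x = n \<otimes> m" using dec x by blast
    obtain h' where h': "h' \<in> N" "m \<otimes> h = h' \<otimes> m" using norm[OF nm(2) h] by blast
    have c: "n \<in> carrier G" "m \<in> carrier G" "h \<in> carrier G" "h' \<in> carrier G" using nm h h' N(1) M(1) by auto
    have "x \<otimes> h \<otimes> inv x = n \<otimes> (m \<otimes> h) \<otimes> inv m \<otimes> inv n"
      unfolding nm(3) using c by (simp add: m_assoc inv_mult_group)
    also have "\<dots> = n \<otimes> h' \<otimes> inv n" unfolding h'(2) using c by (simp add: m_assoc)
    finally show ?thesis using nm(1) h'(1) subgroup.m_inv_closed[OF sN] N(3) by simp
  qed
  then have "N \<lhd> G" using normal_invI[OF sN] by blast
  then show ?thesis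
    unfolding affine_split_def affine_split_axioms_def
    using is_group fin sM comm cap' dec nt fpf by blast
qed

lemma affine_model_integer_mod_group:
  assumes "n \<ge> 2"
  shows "affine_model (integer_mod_group n) n 1"
proof -
  interpret group "integer_mod_group n" by simp
  have c: "carrier (integer_mod_group n) = {0..<int n}" using assms by (simp add: carrier_integer_mod_group)
  have "affine_split (integer_mod_group n) {0..<int n} {0}"
  proof (rule affine_splitI)
    have "1 \<in> {0..<int n}" using assms by simp
    then show "{0..<int n} \<noteq> {\<one>\<^bsub>integer_mod_group n\<^esub>}" by (metis one_integer_mod_group singletonD zero_neq_one)
  qed (use assms in \<open>auto simp: c add.commute\<close>)
  then show ?thesis unfolding affine_model_def by (intro exI[of _ "{0..<int n}"] exI[of _ "{0}"]) simp
qed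

text \<open>Starts from relations satisfied in \<open>S_3\<close>, so that for permutations only a
  transposition and a 3-cycle have to be evaluated.\<close>

lemma (in group) affine_model_order_6:
  assumes o: "card (carrier G) = 6" and c: "c \<in> carrier G" "c \<noteq> \<one>" "c \<otimes> (c \<otimes> c) = \<one>"
    and t: "t \<in> carrier G" "t \<noteq> \<one>" "t \<otimes> t = \<one>" and tc: "t \<otimes> c = (c \<otimes> c) \<otimes> t"
  shows "affine_model G 3 2"
proof -
  define d where "d = c \<otimes> c"
  have d: "d \<in> carrier G" unfolding d_def using c by simp
  have cd: "c \<otimes> d = \<one>" "d \<otimes> c = \<one>" "d \<otimes> d = c"
    unfolding d_def using c by (simp_all add: m_assoc)
  have td: "t \<otimes> d = c \<otimes> t"
  proof -
    have tc': "t \<otimes> c = d \<otimes> t" using tc d_def by simp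
    have "t \<otimes> d = (t \<otimes> c) \<otimes> c" unfolding d_def using t c by (simp add: m_assoc)
    also have "\<dots> = (d \<otimes> t) \<otimes> c" by (simp only: tc')
    also have "\<dots> = d \<otimes> (t \<otimes> c)" using t c d by (simp add: m_assoc)
    also have "\<dots> = d \<otimes> (d \<otimes> t)" by (simp only: tc')
    also have "\<dots> = (d \<otimes> d) \<otimes> t" using t d by (simp add: m_assoc)
    finally show ?thesis using cd by simp
  qed
  have ne: "d \<noteq> \<one>" "d \<noteq> c" using cd c d by auto
  have "t \<noteq> c" using t(3) ne(1) unfolding d_def by auto
  have "t \<noteq> d" using t(3) cd(3) c(2) by auto
  have N3: "card {\<one>, c, d} = 3" using ne c by auto
  have M2: "card {\<one>, t} = 2" using t by auto
  have "affine_split G {\<one>, c, d} {\<one>, t}"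
  proof (rule affine_splitI)
    show "finite (carrier G)" using o by (simp add: card_ge_0_finite)
    show "\<exists>n'\<in>{\<one>, c, d}. m \<otimes> n = n' \<otimes> m" if "m \<in> {\<one>, t}" "n \<in> {\<one>, c, d}" for m n
      using that c d t tc td unfolding d_def[symmetric] by auto
    show "v = \<one>" if "m \<in> {\<one>, t}" "m \<noteq> \<one>" "v \<in> {\<one>, c, d}" "m \<otimes> v = v \<otimes> m" for m v
    proof (rule ccontr)
      assume "v \<noteq> \<one>"
      then have "t \<otimes> c = c \<otimes> t \<or> t \<otimes> d = d \<otimes> t" using that by auto
      then have "d \<otimes> t = c \<otimes> t" using tc td unfolding d_def[symmetric] by auto
      then show False using ne c d t by simp
    qed
  qed (use c d t cd ne o N3 M2 \<open>t \<noteq> c\<close> \<open>t \<noteq> d\<close> d_def in auto)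
  then show ?thesis unfolding affine_model_def using N3 M2 by (intro exI conjI) auto
qed

text \<open>\<open>a\<close> and \<open>b\<close> span a Klein four-group whose nontrivial elements
  \<open>a\<close>, \<open>b\<close>, \<open>a \<otimes> b\<close> are permuted cyclically by
  \<open>c\<close>. The relations for \<open>e = c \<otimes> c\<close> come from applying those of
  \<open>c\<close> twice.\<close>

lemma (in group) affine_model_order_12:
  assumes o: "card (carrier G) = 12" and a: "a \<in> carrier G" "a \<noteq> \<one>" "a \<otimes> a = \<one>"
    and b: "b \<in> carrier G" "b \<noteq> \<one>" "b \<otimes> b = \<one>" and ab: "a \<noteq> b" "a \<otimes> b = b \<otimes> a"
    and c: "c \<in> carrier G" "c \<noteq> \<one>" "c \<otimes> (c \<otimes> c) = \<one>"
    and ca: "c \<otimes> a = b \<otimes> c" and cb: "c \<otimes> b = (a \<otimes> b) \<otimes> c"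
  shows "affine_model G 4 3"
proof -
  define d where "d = a \<otimes> b"
  define e where "e = c \<otimes> c"
  have cl: "d \<in> carrier G" "e \<in> carrier G" unfolding d_def e_def using a b c by auto
  have tab: "a \<otimes> b = d" "b \<otimes> a = d" "a \<otimes> d = b" "d \<otimes> a = b" "b \<otimes> d = a" "d \<otimes> b = a" "d \<otimes> d = \<one>"
  proof -
    show "a \<otimes> b = d" "b \<otimes> a = d" using ab d_def by auto
    show "a \<otimes> d = b" unfolding d_def using a b m_assoc[of a a b, symmetric] by simp
    show "b \<otimes> d = a" unfolding d_def ab(2) using a b m_assoc[of b b a, symmetric] by simp
    show "d \<otimes> b = a" unfolding d_def using a b by (simp add: m_assoc)
    show da: "d \<otimes> a = b" unfolding d_def ab(2) using a b by (simp add: m_assoc)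
    have "d \<otimes> d = d \<otimes> a \<otimes> b" using m_assoc[of d a b] a b cl d_def by simp
    then show "d \<otimes> d = \<one>" using da b by simp
  qed
  have ne: "d \<noteq> \<one>" "d \<noteq> a" "d \<noteq> b" using tab a b ab by auto
  have ce: "c \<otimes> e = \<one>" "e \<otimes> c = \<one>" "e \<otimes> e = c" "c \<otimes> c = e"
    unfolding e_def using c by (simp_all add: m_assoc)
  have cb': "c \<otimes> b = d \<otimes> c" using cb d_def by simp
  have cd: "c \<otimes> d = a \<otimes> c"
  proof -
    have "c \<otimes> d = (c \<otimes> a) \<otimes> b" unfolding d_def using a b c by (simp add: m_assoc)
    also have "\<dots> = b \<otimes> (c \<otimes> b)" unfolding ca using b c by (simp add: m_assoc)
    also have "\<dots> = (b \<otimes> d) \<otimes> c" unfolding cb' using b c cl by (simp add: m_assoc)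
    finally show ?thesis using tab by simp
  qed
  have twice: "e \<otimes> x = z \<otimes> e" if "c \<otimes> x = y \<otimes> c" "c \<otimes> y = z \<otimes> c" "x \<in> carrier G" "y \<in> carrier G" "z \<in> carrier G" for x y z
  proof -
    have "e \<otimes> x = c \<otimes> (c \<otimes> x)" unfolding e_def using that(3) c(1) by (simp add: m_assoc)
    also have "\<dots> = (c \<otimes> y) \<otimes> c" unfolding that(1) using that(4) c(1) by (simp add: m_assoc)
    also have "\<dots> = z \<otimes> e" unfolding that(2) e_def using that(5) c(1) by (simp add: m_assoc)
    finally show ?thesis .
  qed
  have ea: "e \<otimes> a = d \<otimes> e" by (rule twice[OF ca cb']) (use a b cl in auto)
  have eb: "e \<otimes> b = a \<otimes> e" by (rule twice[OF cb' cd]) (use a b cl in auto)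
  have ed: "e \<otimes> d = b \<otimes> e" by (rule twice[OF cd ca]) (use a b cl in auto)
  have nec: "e \<noteq> \<one>" "e \<noteq> c" using ce c cl by auto
  have sq: "x \<otimes> x = \<one>" if "x \<in> {\<one>, a, b, d}" for x using that a b tab by auto
  have cN: "c \<notin> {\<one>, a, b, d}" using sq[of c] ce nec by auto
  have eN: "e \<notin> {\<one>, a, b, d}" using sq[of e] ce c by auto
  have N4: "card {\<one>, a, b, d} = 4" using ne a b ab by auto
  have M3: "card {\<one>, c, e} = 3" using nec c by auto
  have "affine_split G {\<one>, a, b, d} {\<one>, c, e}"
  proof (rule affine_splitI)
    show "finite (carrier G)" using o by (simp add: card_ge_0_finite)
    show "x \<otimes> y \<in> {\<one>, a, b, d}" if "x \<in> {\<one>, a, b, d}" "y \<in> {\<one>, a, b, d}" for x y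
      using that a b cl tab by auto
    show "x \<otimes> y = y \<otimes> x" if "x \<in> {\<one>, a, b, d}" "y \<in> {\<one>, a, b, d}" for x y
      using that a b cl tab by (elim insertE emptyE) simp_all
    show "\<exists>n'\<in>{\<one>, a, b, d}. m \<otimes> n = n' \<otimes> m" if "m \<in> {\<one>, c, e}" "n \<in> {\<one>, a, b, d}" for m n
      using that a b c cl ca cb' cd ea eb ed by (elim insertE emptyE) simp_all
    show "v = \<one>" if mv: "m \<in> {\<one>, c, e}" "m \<noteq> \<one>" "v \<in> {\<one>, a, b, d}" "m \<otimes> v = v \<otimes> m" for m v
    proof (rule ccontr)
      assume v: "v \<noteq> \<one>"
      have mc: "m \<in> carrier G" "v \<in> carrier G" using mv a b c cl by auto
      have "m \<otimes> v = w \<otimes> m \<Longrightarrow> w \<in> carrier G \<Longrightarrow> w = v" for w using mv(4) mc by simp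
      moreover have "\<exists>w\<in>{a, b, d}. w \<noteq> v \<and> m \<otimes> v = w \<otimes> m"
        using mv(1-3) v ca cb' cd ea eb ed ne ab by (elim insertE emptyE) auto
      ultimately show False using a b cl by auto
    qed
  qed (use a b c cl ce o N4 M3 cN eN ne in auto)
  then show ?thesis unfolding affine_model_def using N4 M3 by (intro exI conjI) auto
qed

lemma affine_model_sym_group_3: "affine_model (sym_group 3) 3 2"
proof -
  interpret group "sym_group 3" by (rule sym_group_is_group)
  define t :: "nat \<Rightarrow> nat" where "t = transpose 1 2"
  define c :: "nat \<Rightarrow> nat" where "c = transpose 1 2 \<circ> transpose 2 3"
  have p: "transpose 1 2 permutes {1..3::nat}" "transpose 2 3 permutes {1..3::nat}"
    by (auto intro!: permutes_swap_id)
  show ?thesis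
  proof (rule affine_model_order_6[of c t])
    show "card (carrier (sym_group 3)) = 6" by (simp add: sym_group_card_carrier eval_nat_numeral)
    show "t \<in> carrier (sym_group 3)" "c \<in> carrier (sym_group 3)"
      unfolding t_def c_def sym_group_carrier using p permutes_compose by blast+
    have "t 1 \<noteq> id 1" "c 1 \<noteq> id 1" unfolding t_def c_def by (simp_all add: transpose_def)
    then show "t \<noteq> \<one>\<^bsub>sym_group 3\<^esub>" "c \<noteq> \<one>\<^bsub>sym_group 3\<^esub>" unfolding sym_group_one by metis+
  qed (simp_all add: sym_group_mult sym_group_one t_def c_def fun_eq_iff transpose_def)
qed

lemma affine_model_alt_group_4: "affine_model (alt_group 4) 4 3"
proof -
  interpret group "alt_group 4" by (rule alt_group_is_group)
  define a :: "nat \<Rightarrow> nat" where "a = transpose 1 2 \<circ> transpose 3 4"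
  define b :: "nat \<Rightarrow> nat" where "b = transpose 1 3 \<circ> transpose 2 4"
  define c :: "nat \<Rightarrow> nat" where "c = transpose 1 3 \<circ> transpose 3 2"
  have mem: "transpose i j \<circ> transpose k l \<in> carrier (alt_group 4)"
    if "i \<in> {1..4}" "j \<in> {1..4}" "k \<in> {1..4}" "l \<in> {1..4}" "i \<noteq> j" "k \<noteq> l" for i j k l
    unfolding alt_group_carrier
  proof
    show "transpose i j \<circ> transpose k l permutes {1..4}"
      by (rule permutes_compose) (use that in \<open>auto intro: permutes_swap_id\<close>)
    show "evenperm (transpose i j \<circ> transpose k l)"
      using that by (simp add: evenperm_comp permutation_swap_id evenperm_swap)
  qed
  show ?thesis
  proof (rule affine_model_order_12[of a b c])
    show "card (carrier (alt_group 4)) = 12"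
      using alt_group_card_carrier[of 4] by (simp add: eval_nat_numeral)
    show "a \<in> carrier (alt_group 4)" "b \<in> carrier (alt_group 4)" "c \<in> carrier (alt_group 4)"
      unfolding a_def b_def c_def by (rule mem; simp)+
    have "a 1 \<noteq> id 1" "b 1 \<noteq> id 1" "c 1 \<noteq> id 1" "a 1 \<noteq> b 1"
      unfolding a_def b_def c_def by (simp_all add: transpose_def)
    then show "a \<noteq> \<one>\<^bsub>alt_group 4\<^esub>" "b \<noteq> \<one>\<^bsub>alt_group 4\<^esub>" "c \<noteq> \<one>\<^bsub>alt_group 4\<^esub>" "a \<noteq> b"
      unfolding alt_group_one by metis+
  qed (auto simp: alt_group_mult alt_group_one a_def b_def c_def fun_eq_iff transpose_def)
qed

text \<open>The kernel consists of the translations, the complement of the multiplications by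
  elements of \<open>U\<close>. A fixed vector \<open>b\<close> satisfies
  \<open>q dvd (a - 1) * b\<close>, which primality of \<open>q\<close> resolves. The condition on
  \<open>card U\<close> makes the exponent clause of \<open>affine_model\<close> vacuous.\<close>

lemma affine_model_aff1:
  fixes q :: int
  assumes p: "Factorial_Ring.prime q" and U: "U \<subseteq> {1..<q}" "1 \<in> U"
    and mult: "\<And>a b. a \<in> U \<Longrightarrow> b \<in> U \<Longrightarrow> a * b mod q \<in> U"
    and inv: "\<And>a. a \<in> U \<Longrightarrow> \<exists>b\<in>U. b * a mod q = 1" and neq8: "card U \<noteq> 8"
  shows "affine_model (aff1 q U) (nat q) (card U)"
proof -
  have q: "q > 1" using p prime_gt_1_int by blast
  have finU: "finite U" using U(1) finite_subset by blast
  have c: "carrier (aff1 q U) = U \<times> {0..<q}" by (simp add: aff1_def)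
  have m: "(a, b) \<otimes>\<^bsub>aff1 q U\<^esub> (d, e) = (a * d mod q, (a * e + b) mod q)" for a b d e :: int by (simp add: aff1_def)
  have o: "\<one>\<^bsub>aff1 q U\<^esub> = (1, 0)" by (simp add: aff1_def)
  interpret group "aff1 q U"
  proof (rule groupI)
    fix x y assume "x \<in> carrier (aff1 q U)" "y \<in> carrier (aff1 q U)"
    then show "x \<otimes>\<^bsub>aff1 q U\<^esub> y \<in> carrier (aff1 q U)" using mult q by (auto simp: c m)
  next
    show "\<one>\<^bsub>aff1 q U\<^esub> \<in> carrier (aff1 q U)" using U q by (simp add: c o)
  next
    fix x y z
    obtain a b d e f g :: int where "x = (a, b)" "y = (d, e)" "z = (f, g)" by (metis surj_pair)
    moreover have "(a * d mod q * g + (a * e + b) mod q) mod q = (a * ((d * g + e) mod q) + b) mod q"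
    proof -
      have "(a * d mod q * g + (a * e + b) mod q) mod q = (a * d * g + (a * e + b)) mod q"
        by (metis mod_add_left_eq mod_add_right_eq mod_mult_left_eq)
      also have "\<dots> = (a * (d * g + e) + b) mod q" by (simp add: algebra_simps)
      also have "\<dots> = (a * ((d * g + e) mod q) + b) mod q"
        by (metis mod_add_left_eq mod_mult_right_eq)
      finally show ?thesis .
    qed
    ultimately show "x \<otimes>\<^bsub>aff1 q U\<^esub> y \<otimes>\<^bsub>aff1 q U\<^esub> z = x \<otimes>\<^bsub>aff1 q U\<^esub> (y \<otimes>\<^bsub>aff1 q U\<^esub> z)"
      by (simp add: m mod_simps mult.assoc)
  next
    fix x assume "x \<in> carrier (aff1 q U)"
    then obtain a b where x: "x = (a, b)" "a \<in> U" "b \<in> {0..<q}" by (auto simp: c)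
    then show "\<one>\<^bsub>aff1 q U\<^esub> \<otimes>\<^bsub>aff1 q U\<^esub> x = x" using U by (auto simp: m o)
    obtain a' where a': "a' \<in> U" "a' * a mod q = 1" using inv x by blast
    have "(a', (- (a' * b)) mod q) \<otimes>\<^bsub>aff1 q U\<^esub> x = \<one>\<^bsub>aff1 q U\<^esub>"
      using a' by (simp add: x(1) m o mod_simps)
    moreover have "(a', (- (a' * b)) mod q) \<in> carrier (aff1 q U)" using a' q by (simp add: c)
    ultimately show "\<exists>y\<in>carrier (aff1 q U). y \<otimes>\<^bsub>aff1 q U\<^esub> x = \<one>\<^bsub>aff1 q U\<^esub>" by blast
  qed
  have "affine_split (aff1 q U) ({1} \<times> {0..<q}) (U \<times> {0})"
  proof (rule affine_splitI)
    show "\<exists>n'\<in>{1} \<times> {0..<q}. k \<otimes>\<^bsub>aff1 q U\<^esub> n = n' \<otimes>\<^bsub>aff1 q U\<^esub> k"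
      if "k \<in> U \<times> {0}" "n \<in> {1} \<times> {0..<q}" for k n
    proof -
      obtain a b where "k = (a, 0)" "n = (1, b)" using \<open>k \<in> U \<times> {0}\<close> \<open>n \<in> {1} \<times> {0..<q}\<close> by auto
      then show ?thesis using q by (intro bexI[of _ "(1, a * b mod q)"]) (auto simp: m)
    qed
    show "v = \<one>\<^bsub>aff1 q U\<^esub>"
      if kv: "k \<in> U \<times> {0}" "k \<noteq> \<one>\<^bsub>aff1 q U\<^esub>" "v \<in> {1} \<times> {0..<q}" "k \<otimes>\<^bsub>aff1 q U\<^esub> v = v \<otimes>\<^bsub>aff1 q U\<^esub> k" for k v
    proof -
      obtain a b where ab: "k = (a, 0)" "v = (1, b)" "a \<in> U" "b \<in> {0..<q}" using kv(1,3) by auto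
      have "a * b mod q = b mod q" using kv(4) ab by (simp add: m)
      then have "q dvd a * b - b" by (simp add: mod_eq_dvd_iff)
      then have "q dvd (a - 1) * b" by (simp add: algebra_simps)
      then have "q dvd a - 1 \<or> q dvd b" using p prime_dvd_multD by blast
      moreover have "\<not> q dvd a - 1"
      proof -
        have "0 < a - 1" "a - 1 < q" using ab(1,3) kv(2) U(1) by (auto simp: o)
        then show ?thesis using zdvd_not_zless by blast
      qed
      ultimately have "q dvd b" by blast
      then have "b = 0" using ab(4) zdvd_not_zless[of b q] by (cases "b = 0") auto
      then show ?thesis using ab by (simp add: o)
    qed
    have "(1, 1) \<in> {1::int} \<times> {0..<q}" using q by simp
    then show "{1} \<times> {0..<q} \<noteq> {\<one>\<^bsub>aff1 q U\<^esub>}" unfolding o by (metis prod.inject singletonD zero_neq_one)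
  qed (use q U mult finU in \<open>auto simp: c m o card_cartesian_product add.commute\<close>)
  then show ?thesis unfolding affine_model_def using q finU neq8
    by (intro exI[of _ "{1} \<times> {0..<q}"] exI[of _ "U \<times> {0}"]) (simp add: card_cartesian_product)
qed

lemma affine_model_AGL1_5: "affine_model (AGL1 5) 5 4"
proof -
  have U: "{1..<5::int} = {1, 2, 3, 4}" by auto
  have "affine_model (aff1 5 {1..<5}) (nat 5) (card {1..<5::int})"
    by (rule affine_model_aff1) (auto simp: U)
  then show ?thesis unfolding AGL1_def by simp
qed

lemma affine_model_AGL1_7: "affine_model (AGL1 7) 7 6"
proof -
  have U: "{1..<7::int} = {1, 2, 3, 4, 5, 6}" by auto
  have "affine_model (aff1 7 {1..<7}) (nat 7) (card {1..<7::int})"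
    by (rule affine_model_aff1) (auto simp: U)
  then show ?thesis unfolding AGL1_def by simp
qed

lemma affine_model_C7_C3: "affine_model C7_C3 7 3"
proof -
  have "affine_model (aff1 7 {1, 2, 4}) (nat 7) (card {1, 2, 4::int})"
    by (rule affine_model_aff1) auto
  moreover have "card {1, 2, 4::int} = 3" by simp
  ultimately show ?thesis unfolding C7_C3_def by (simp only: nat_numeral)
qed

text \<open>The matrices listed are \<open>1, i, j, -1, -i, -j, i j, - i j\<close>. The explicit
  list turns facts about \<open>Q8\<close> into finite checks.\<close>

lemma Q8_eq:
  "Q8 = {((1,0),(0,1)), ((0,2),(1,0)), ((1,1),(1,2)), ((2,0),(0,2)), ((0,1),(2,0)), ((2,2),(2,1)),
         ((2,1),(1,1)), ((1,2),(2,2))}" (is "_ = ?S")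
proof
  show "Q8 \<subseteq> ?S"
  proof
    fix A assume "A \<in> Q8"
    then show "A \<in> ?S"
    proof induction
      case Q8_one
      show ?case by (simp add: GL3_one_def)
    next
      case (Q8_i A)
      from Q8_i.IH show ?case by (elim insertE emptyE) (simp_all add: mmul3_def Q8i_def)
    next
      case (Q8_j A)
      from Q8_j.IH show ?case by (elim insertE emptyE) (simp_all add: mmul3_def Q8j_def)
    qed
  qed
  have one: "((1,0),(0,1)) \<in> Q8" using Q8_one by (simp add: GL3_one_def)
  have i: "((0,2),(1,0)) \<in> Q8" using Q8_i[OF one] by (simp add: mmul3_def Q8i_def)
  have j: "((1,1),(1,2)) \<in> Q8" using Q8_j[OF one] by (simp add: mmul3_def Q8j_def)
  have i2: "((2,0),(0,2)) \<in> Q8" using Q8_i[OF i] by (simp add: mmul3_def Q8i_def)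
  have i3: "((0,1),(2,0)) \<in> Q8" using Q8_i[OF i2] by (simp add: mmul3_def Q8i_def)
  have j3: "((2,2),(2,1)) \<in> Q8" using Q8_j[OF i2] by (simp add: mmul3_def Q8j_def)
  have k: "((2,1),(1,1)) \<in> Q8" using Q8_j[OF i] by (simp add: mmul3_def Q8j_def)
  have k3: "((1,2),(2,2)) \<in> Q8" using Q8_j[OF i3] by (simp add: mmul3_def Q8j_def)
  show "?S \<subseteq> Q8" using one i j i2 i3 j3 k k3 by simp
qed

lemma mod_sum_mult_mod:
  fixes n :: int
  shows "(a * (u mod n) + b * (v mod n)) mod n = (a * u + b * v) mod n"
    and "((u mod n) * a + (v mod n) * b) mod n = (u * a + v * b) mod n"
proof -
  show "(a * (u mod n) + b * (v mod n)) mod n = (a * u + b * v) mod n"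
    using mod_add_eq[of "a * (u mod n)" n "b * (v mod n)"] mod_add_eq[of "a * u" n "b * v"]
    by (simp only: mod_mult_right_eq)
  show "((u mod n) * a + (v mod n) * b) mod n = (u * a + v * b) mod n"
    using mod_add_eq[of "(u mod n) * a" n "(v mod n) * b"] mod_add_eq[of "u * a" n "v * b"]
    by (simp only: mod_mult_left_eq)
qed

lemma mmul3_assoc: "mmul3 (mmul3 A B) C = mmul3 A (mmul3 B C)"
  unfolding mmul3_def
  by (simp add: mod_sum_mult_mod split: prod.splits) (simp add: algebra_simps)

lemma mvec3_mmul3: "mvec3 (mmul3 A B) v = mvec3 A (mvec3 B v)"
  unfolding mmul3_def mvec3_def
  by (simp add: mod_sum_mult_mod split: prod.splits) (simp add: algebra_simps)

lemma mvec3_vadd3: "mvec3 A (vadd3 v w) = vadd3 (mvec3 A v) (mvec3 A w)"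
  unfolding vadd3_def mvec3_def
  by (simp add: mod_sum_mult_mod mod_add_eq split: prod.splits) (simp add: algebra_simps)

lemma vadd3_assoc: "vadd3 (vadd3 u v) w = vadd3 u (vadd3 v w)"
  by (auto simp: vadd3_def mod_simps algebra_simps split: prod.splits)

lemma vadd3_commute: "vadd3 v w = vadd3 w v"
  by (auto simp: vadd3_def algebra_simps split: prod.splits)

lemma vadd3_closed: "vadd3 v w \<in> {0..<3} \<times> {0..<3}"
  by (auto simp: vadd3_def split: prod.splits)

lemma mvec3_closed: "mvec3 A v \<in> {0..<3} \<times> {0..<3}"
  by (auto simp: mvec3_def split: prod.splits)

lemma vadd3_0: "v \<in> {0..<3} \<times> {0..<3} \<Longrightarrow> vadd3 v (0,0) = v"
  by (auto simp: vadd3_def)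

lemma mvec3_one: "v \<in> {0..<3} \<times> {0..<3} \<Longrightarrow> mvec3 GL3_one v = v"
  by (auto simp: mvec3_def GL3_one_def)

lemma mvec3_0: "mvec3 A (0,0) = (0,0)"
  by (auto simp: mvec3_def split: prod.splits)

lemma Q8_mult_one: "A \<in> Q8 \<Longrightarrow> mmul3 A GL3_one = A"
  unfolding Q8_eq GL3_one_def by (elim insertE emptyE) (simp_all add: mmul3_def)

lemma Q8_mult: "B \<in> Q8 \<Longrightarrow> A \<in> Q8 \<Longrightarrow> mmul3 A B \<in> Q8"
proof (induction rule: Q8.induct)
  case Q8_one
  then show ?case by (simp add: Q8_mult_one)
qed (simp_all add: mmul3_assoc[symmetric] Q8_i Q8_j)

lemma Q8_one_mult: "A \<in> Q8 \<Longrightarrow> mmul3 GL3_one A = A"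
  unfolding Q8_eq GL3_one_def by (elim insertE emptyE) (simp_all add: mmul3_def)

lemma Q8_power_4: "A \<in> Q8 \<Longrightarrow> mmul3 (mmul3 A A) (mmul3 A A) = GL3_one"
  unfolding Q8_eq GL3_one_def by (elim insertE emptyE) (simp_all add: mmul3_def)

lemma Q8_fixed_point_free:
  assumes "A \<in> Q8" "A \<noteq> GL3_one" "v \<in> {0..<3} \<times> {0..<3}" "mvec3 A v = v"
  shows "v = (0, 0)"
proof -
  have "{0..<3::int} = {0, 1, 2}" by auto
  then obtain x y where "v = (x, y)" "x \<in> {0, 1, 2}" "y \<in> {0, 1, 2}" using assms(3) by auto
  then show ?thesis
    using assms(1,2,4) unfolding Q8_eq GL3_one_def
    by (elim insertE emptyE) (simp_all add: mvec3_def)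
qed

lemma affine_model_M9: "affine_model M9 9 8"
proof -
  let ?V = "{0..<3::int} \<times> {0..<3::int}"
  have c: "carrier M9 = Q8 \<times> ?V" by (simp add: M9_def)
  have m: "(A, v) \<otimes>\<^bsub>M9\<^esub> (B, w) = (mmul3 A B, vadd3 (mvec3 A w) v)" for A B v w
    by (simp add: M9_def)
  have o: "\<one>\<^bsub>M9\<^esub> = (GL3_one, (0, 0))" by (simp add: M9_def)
  have V0: "(0, 0) \<in> ?V" by simp
  have cardQ: "card Q8 = 8" and finQ: "finite Q8" unfolding Q8_eq by auto
  interpret group M9
  proof (rule groupI)
    fix x y assume "x \<in> carrier M9" "y \<in> carrier M9"
    then obtain A v B w where "x = (A, v)" "y = (B, w)" "A \<in> Q8" "B \<in> Q8" unfolding c by blast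
    then show "x \<otimes>\<^bsub>M9\<^esub> y \<in> carrier M9" using Q8_mult vadd3_closed by (simp only: c m mem_Times_iff fst_conv snd_conv)
  next
    show "\<one>\<^bsub>M9\<^esub> \<in> carrier M9" using Q8_one by (simp add: c o)
  next
    fix x y z show "x \<otimes>\<^bsub>M9\<^esub> y \<otimes>\<^bsub>M9\<^esub> z = x \<otimes>\<^bsub>M9\<^esub> (y \<otimes>\<^bsub>M9\<^esub> z)"
      by (cases x; cases y; cases z) (simp only: m mmul3_assoc mvec3_mmul3 mvec3_vadd3 vadd3_assoc)
  next
    fix x assume "x \<in> carrier M9"
    then obtain A v where x: "x = (A, v)" "A \<in> Q8" "v \<in> ?V" by (auto simp: c)
    show "\<one>\<^bsub>M9\<^esub> \<otimes>\<^bsub>M9\<^esub> x = x" using x by (simp only: o m Q8_one_mult mvec3_one vadd3_0)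
    \<comment> \<open>\<open>B\<close> is the inverse of \<open>A\<close>, as \<open>A\<close> has
      exponent 4. With \<open>w = B v\<close> the translation part of the inverse is
      \<open>- w\<close>, which modulo 3 is \<open>w + w\<close>.\<close>
    define B where "B = mmul3 A (mmul3 A A)"
    define w where "w = mvec3 B v"
    have B: "B \<in> Q8" unfolding B_def using x Q8_mult by blast
    have BA: "mmul3 B A = GL3_one" unfolding B_def using Q8_power_4[OF x(2)] by (simp only: mmul3_assoc)
    have w: "w \<in> ?V" unfolding w_def by (rule mvec3_closed)
    have "(B, vadd3 w w) \<otimes>\<^bsub>M9\<^esub> x = \<one>\<^bsub>M9\<^esub>"
    proof -
      have "vadd3 w (vadd3 w w) = (0, 0)" by (cases w) (simp add: vadd3_def mod_simps; presburger)
      then show ?thesis by (simp add: x(1) m o BA w_def[symmetric])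
    qed
    moreover have "(B, vadd3 w w) \<in> carrier M9" unfolding c using B vadd3_closed by blast
    ultimately show "\<exists>y\<in>carrier M9. y \<otimes>\<^bsub>M9\<^esub> x = \<one>\<^bsub>M9\<^esub>" by blast
  qed
  have "affine_split M9 ({GL3_one} \<times> ?V) (Q8 \<times> {(0, 0)})"
  proof (rule affine_splitI)
    show "finite (carrier M9)" unfolding c using finQ by simp
    show "{GL3_one} \<times> ?V \<subseteq> carrier M9" unfolding c using Q8_one by blast
    show "Q8 \<times> {(0, 0)} \<subseteq> carrier M9" unfolding c using V0 by blast
    show "\<one>\<^bsub>M9\<^esub> \<in> {GL3_one} \<times> ?V" "\<one>\<^bsub>M9\<^esub> \<in> Q8 \<times> {(0, 0)}" using Q8_one by (simp_all add: o)
    show "x \<otimes>\<^bsub>M9\<^esub> y \<in> {GL3_one} \<times> ?V" if "x \<in> {GL3_one} \<times> ?V" "y \<in> {GL3_one} \<times> ?V" for x y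
    proof -
      obtain v w where "x = (GL3_one, v)" "y = (GL3_one, w)" using \<open>x \<in> _\<close> \<open>y \<in> _\<close> by blast
      then show ?thesis using vadd3_closed Q8_one_mult[OF Q8_one]
        by (simp only: m mem_Times_iff fst_conv snd_conv singleton_iff)
    qed
    show "x \<otimes>\<^bsub>M9\<^esub> y \<in> Q8 \<times> {(0, 0)}" if "x \<in> Q8 \<times> {(0, 0)}" "y \<in> Q8 \<times> {(0, 0)}" for x y
      using that Q8_mult by (auto simp: m mvec3_0 vadd3_def)
    show "x \<otimes>\<^bsub>M9\<^esub> y = y \<otimes>\<^bsub>M9\<^esub> x" if xy: "x \<in> {GL3_one} \<times> ?V" "y \<in> {GL3_one} \<times> ?V" for x y
    proof -
      obtain v w where "x = (GL3_one, v)" "y = (GL3_one, w)" "v \<in> ?V" "w \<in> ?V" using xy by blast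
      then show ?thesis by (simp only: m mvec3_one) (metis vadd3_commute)
    qed
    show "\<exists>n'\<in>{GL3_one} \<times> ?V. k \<otimes>\<^bsub>M9\<^esub> n = n' \<otimes>\<^bsub>M9\<^esub> k"
      if kn: "k \<in> Q8 \<times> {(0, 0)}" "n \<in> {GL3_one} \<times> ?V" for k n
    proof -
      obtain A v where kn: "k = (A, (0, 0))" "n = (GL3_one, v)" "A \<in> Q8" "v \<in> ?V" using kn by blast
      then have "k \<otimes>\<^bsub>M9\<^esub> n = (GL3_one, mvec3 A v) \<otimes>\<^bsub>M9\<^esub> k"
        by (simp only: m Q8_one_mult Q8_mult_one mvec3_0 vadd3_commute)
      then show ?thesis using mvec3_closed by blast
    qed
    show "({GL3_one} \<times> ?V) \<inter> (Q8 \<times> {(0, 0)}) \<subseteq> {\<one>\<^bsub>M9\<^esub>}" unfolding o by blast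
    show "card (carrier M9) = card ({GL3_one} \<times> ?V) * card (Q8 \<times> {(0::int, 0::int)})"
      by (simp add: c card_cartesian_product cardQ)
    have "(GL3_one, (1, 0)) \<in> {GL3_one} \<times> ?V" by simp
    then show "{GL3_one} \<times> ?V \<noteq> {\<one>\<^bsub>M9\<^esub>}" unfolding o by (metis prod.inject singletonD zero_neq_one)
    show "u = \<one>\<^bsub>M9\<^esub>" if ku: "k \<in> Q8 \<times> {(0, 0)}" "k \<noteq> \<one>\<^bsub>M9\<^esub>" "u \<in> {GL3_one} \<times> ?V"
      "k \<otimes>\<^bsub>M9\<^esub> u = u \<otimes>\<^bsub>M9\<^esub> k" for k u
    proof -
      obtain A v where kv: "k = (A, (0, 0))" "u = (GL3_one, v)" "A \<in> Q8" "v \<in> ?V" using ku(1,3) by blast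
      have "vadd3 (mvec3 A v) (0, 0) = vadd3 (mvec3 GL3_one (0, 0)) v" using ku(4) kv by (simp only: m prod.inject)
      then have "mvec3 A v = v"
        using vadd3_0[OF mvec3_closed] vadd3_0[OF kv(4)] by (simp only: mvec3_0) (metis vadd3_commute)
      moreover have "A \<noteq> GL3_one" using ku(2) unfolding kv(1) o by simp
      ultimately have "v = (0, 0)" using Q8_fixed_point_free kv by blast
      then show ?thesis unfolding kv(2) o by simp
    qed
  qed
  moreover have "g [^]\<^bsub>M9\<^esub> (4::nat) = \<one>\<^bsub>M9\<^esub>" if g: "g \<in> Q8 \<times> {(0, 0)}" for g
  proof -
    obtain A where A: "g = (A, (0, 0))" "A \<in> Q8" using g by blast
    have gc: "g \<in> carrier M9" unfolding c using A V0 by blast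
    have gg: "g \<otimes>\<^bsub>M9\<^esub> g = (mmul3 A A, (0, 0))" by (simp add: A m mvec3_0 vadd3_def)
    have "g [^]\<^bsub>M9\<^esub> (4::nat) = (g \<otimes>\<^bsub>M9\<^esub> g) \<otimes>\<^bsub>M9\<^esub> (g \<otimes>\<^bsub>M9\<^esub> g)"
      using gc by (simp add: eval_nat_numeral m_assoc)
    also have "\<dots> = \<one>\<^bsub>M9\<^esub>" unfolding gg m o using Q8_power_4[OF A(2)] by (simp add: mvec3_0 vadd3_def)
    finally show ?thesis .
  qed
  moreover have "card ({GL3_one} \<times> ?V) = 9" "card (Q8 \<times> {(0::int, 0::int)}) = 8"
    by (simp_all add: card_cartesian_product cardQ)
  ultimately show ?thesis unfolding affine_model_def by blast
qed

section \<open>Assembling the classification\<close>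

lemma affine_model_iso:
  assumes "group H" and K: "affine_model K q k" "(q, k) \<in> affine_pairs" and iso: "H \<cong> K"
  shows "primitive H" "MP H" "SMP H \<longleftrightarrow> (q, k) \<in> {(2,1),(3,2),(9,8)}"
proof -
  obtain N M where "affine_split K N M" using K(1) unfolding affine_model_def by blast
  then interpret K: affine_split K N M .
  interpret H: group H by fact
  have iso': "K \<cong> H" by (rule H.iso_sym[OF iso])
  have fin: "finite (carrier K)" "finite (carrier H)" using K.fin iso' iso_finite by auto
  show "primitive H" "MP H"
    using primitive_iso[OF K.is_group H.is_group iso'] MP_iso[OF K.is_group H.is_group iso' fin(1)]
      affine_model_primitive_MP[OF K] by argo+
  have "SMP H \<longleftrightarrow> SMP K"
    using SMP_iso[OF K.is_group H.is_group iso' fin(1)] SMP_iso[OF H.is_group K.is_group iso fin(2)] by argo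
  then show "SMP H \<longleftrightarrow> (q, k) \<in> {(2,1),(3,2),(9,8)}" using affine_model_SMP_iff[OF K] by simp
qed

theorem theorem1p2:
  fixes G :: "('a, 'b) monoid_scheme"
  assumes "group G" and "finite (carrier G)" and "carrier G \<noteq> {\<one>\<^bsub>G\<^esub>}" and "MP G"
  shows "(\<exists>(I :: nat set) (Hs :: nat \<Rightarrow> nat monoid). finite I \<and>
            (\<forall>i\<in>I. group (Hs i) \<and> finite (carrier (Hs i)) \<and> primitive (Hs i) \<and> MP (Hs i)) \<and>
            iso_subdirect (G Mod Frattini G) I Hs)
       \<and> (SMP G \<longrightarrow>
          (\<exists>(I :: nat set) (Hs :: nat \<Rightarrow> nat monoid). finite I \<and>
            (\<forall>i\<in>I. group (Hs i) \<and> finite (carrier (Hs i)) \<and> primitive (Hs i) \<and> SMP (Hs i)) \<and>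
            iso_subdirect (G Mod Frattini G) I Hs))
       \<and> (\<forall>H :: ('c, 'd) monoid_scheme. group H \<and> finite (carrier H) \<longrightarrow>
            ((primitive H \<and> MP H) \<longleftrightarrow>
              (H \<cong> integer_mod_group 2 \<or> H \<cong> integer_mod_group 3 \<or> H \<cong> sym_group 3 \<or>
               H \<cong> alt_group 4 \<or> H \<cong> AGL1 5 \<or> H \<cong> C7_C3 \<or> H \<cong> AGL1 7 \<or> H \<cong> M9)))
       \<and> (\<forall>H :: ('c, 'd) monoid_scheme. group H \<and> finite (carrier H) \<longrightarrow>
            ((primitive H \<and> SMP H) \<longleftrightarrow>
              (H \<cong> integer_mod_group 2 \<or> H \<cong> sym_group 3 \<or> H \<cong> M9)))"
proof (intro conjI impI allI)
  interpret group G by fact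
  obtain I :: "nat set" and Hs :: "nat \<Rightarrow> nat monoid" and h where I: "finite I"
    and sub: "iso_subdirect (G Mod Frattini G) I Hs"
    and h: "\<And>i. i \<in> I \<Longrightarrow> group_hom G (Hs i) (h i)"
    and surj: "\<And>i. i \<in> I \<Longrightarrow> h i ` carrier G = carrier (Hs i)"
    and prim: "\<And>i. i \<in> I \<Longrightarrow> primitive (Hs i)"
    using Frattini_quotient_subdirect[OF assms(2)] by metis
  have Hs: "group (Hs i)" "finite (carrier (Hs i))" if "i \<in> I" for i
    using h[OF that] surj[OF that, symmetric] assms(2) by (auto simp: group_hom_def)
  show "\<exists>(I :: nat set) (Hs :: nat \<Rightarrow> nat monoid). finite I \<and>
      (\<forall>i\<in>I. group (Hs i) \<and> finite (carrier (Hs i)) \<and> primitive (Hs i) \<and> MP (Hs i)) \<and>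
      iso_subdirect (G Mod Frattini G) I Hs"
    by (rule exI[of _ I], rule exI[of _ Hs]) (simp add: I sub Hs prim group_hom.MP_img[OF h assms(2) surj assms(4)])
  show "\<exists>(I :: nat set) (Hs :: nat \<Rightarrow> nat monoid). finite I \<and>
      (\<forall>i\<in>I. group (Hs i) \<and> finite (carrier (Hs i)) \<and> primitive (Hs i) \<and> SMP (Hs i)) \<and>
      iso_subdirect (G Mod Frattini G) I Hs" if "SMP G"
    by (rule exI[of _ I], rule exI[of _ Hs]) (simp add: I sub Hs prim group_hom.SMP_img[OF h assms(2) surj that])
next
  fix H :: "('c, 'd) monoid_scheme"
  assume "group H \<and> finite (carrier H)"
  then interpret H: group H by blast
  have fin: "finite (carrier H)" using \<open>group H \<and> finite (carrier H)\<close> by blast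
  have C2: "affine_model (integer_mod_group 2) 2 1" and C3: "affine_model (integer_mod_group 3) 3 1"
    using affine_model_integer_mod_group by auto
  note models = C2 C3 affine_model_sym_group_3 affine_model_alt_group_4 affine_model_AGL1_5
    affine_model_C7_C3 affine_model_AGL1_7 affine_model_M9
  have pairs: "(2, 1) \<in> affine_pairs" "(3, 1) \<in> affine_pairs" "(3, 2) \<in> affine_pairs"
    "(4, 3) \<in> affine_pairs" "(5, 4) \<in> affine_pairs" "(7, 3) \<in> affine_pairs"
    "(7, 6) \<in> affine_pairs" "(9, 8) \<in> affine_pairs"
    by (simp_all add: affine_pairs_def)
  have model: "\<exists>q k. (q, k) \<in> affine_pairs \<and> affine_model H q k" if "primitive H" "MP H"
    using H.primitive_MP_affine_model fin that by blast
  note to = affine_model_unique[of H, OF _ models(1) pairs(1)]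
      affine_model_unique[of H, OF _ models(2) pairs(2)]
      affine_model_unique[of H, OF _ models(3) pairs(3)]
      affine_model_unique[of H, OF _ models(4) pairs(4)]
      affine_model_unique[of H, OF _ models(5) pairs(5)]
      affine_model_unique[of H, OF _ models(6) pairs(6)]
      affine_model_unique[of H, OF _ models(7) pairs(7)]
      affine_model_unique[of H, OF _ models(8) pairs(8)]
  note iso_to = affine_model_iso(1,2)[OF H.is_group models(1) pairs(1)]
      affine_model_iso(1,2)[OF H.is_group models(2) pairs(2)]
      affine_model_iso(1,2)[OF H.is_group models(3) pairs(3)]
      affine_model_iso(1,2)[OF H.is_group models(4) pairs(4)]
      affine_model_iso(1,2)[OF H.is_group models(5) pairs(5)]
      affine_model_iso(1,2)[OF H.is_group models(6) pairs(6)]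
      affine_model_iso(1,2)[OF H.is_group models(7) pairs(7)]
      affine_model_iso(1,2)[OF H.is_group models(8) pairs(8)]
  show "(primitive H \<and> MP H) \<longleftrightarrow>
      (H \<cong> integer_mod_group 2 \<or> H \<cong> integer_mod_group 3 \<or> H \<cong> sym_group 3 \<or>
       H \<cong> alt_group 4 \<or> H \<cong> AGL1 5 \<or> H \<cong> C7_C3 \<or> H \<cong> AGL1 7 \<or> H \<cong> M9)" (is "_ \<longleftrightarrow> ?iso")
  proof
    assume "primitive H \<and> MP H"
    then obtain q k where "(q, k) \<in> affine_pairs" "affine_model H q k" using model by blast
    then have "affine_model H 2 1 \<or> affine_model H 3 1 \<or> affine_model H 3 2 \<or> affine_model H 4 3 \<or>
        affine_model H 5 4 \<or> affine_model H 7 3 \<or> affine_model H 7 6 \<or> affine_model H 9 8"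
      unfolding affine_pairs_def by auto
    then show ?iso using to by argo
  next
    assume ?iso
    then show "primitive H \<and> MP H" using iso_to by argo
  qed
next
  fix H :: "('c, 'd) monoid_scheme"
  assume "group H \<and> finite (carrier H)"
  then interpret H: group H by blast
  have fin: "finite (carrier H)" using \<open>group H \<and> finite (carrier H)\<close> by blast
  have C2: "affine_model (integer_mod_group 2) 2 1" using affine_model_integer_mod_group by auto
  have pairs: "(2, 1) \<in> affine_pairs" "(3, 2) \<in> affine_pairs" "(9, 8) \<in> affine_pairs"
    by (simp_all add: affine_pairs_def)
  show "(primitive H \<and> SMP H) \<longleftrightarrow>
      (H \<cong> integer_mod_group 2 \<or> H \<cong> sym_group 3 \<or> H \<cong> M9)"
  proof
    assume H: "primitive H \<and> SMP H"
    then have "MP H" using SMP_imp_MP by blast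
    then obtain q k where qk: "(q, k) \<in> affine_pairs" "affine_model H q k"
      using H.primitive_MP_affine_model fin H by blast
    then have "(q, k) \<in> {(2,1),(3,2),(9,8)}" using affine_model_SMP_iff H by blast
    then consider "affine_model H 2 1" | "affine_model H 3 2" | "affine_model H 9 8" using qk(2) by auto
    then show "H \<cong> integer_mod_group 2 \<or> H \<cong> sym_group 3 \<or> H \<cong> M9"
      using affine_model_unique[of H, OF _ C2 pairs(1)] affine_model_unique[of H, OF _ affine_model_sym_group_3 pairs(2)]
        affine_model_unique[of H, OF _ affine_model_M9 pairs(3)] by argo
  next
    assume "H \<cong> integer_mod_group 2 \<or> H \<cong> sym_group 3 \<or> H \<cong> M9"
    then show "primitive H \<and> SMP H"
      using affine_model_iso(1,3)[OF H.is_group C2 pairs(1)]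
        affine_model_iso(1,3)[OF H.is_group affine_model_sym_group_3 pairs(2)]
        affine_model_iso(1,3)[OF H.is_group affine_model_M9 pairs(3)]
      by (elim disjE) simp_all
  qed
qed

end
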